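(* Let $K$ be an algebraically closed field of characteristic zero and let $a,b\ge 0$ be integers, not both zero. For the Lie algebras $\mathfrak q=\mathfrak q(a,b)$ and $\mathfrak r=\mathfrak r(a,b)$ one has $\mathrm{ind}\,\mathfrak q=\gcd(2a,a+b)$ and $\mathrm{ind}\,\mathfrak r=\gcd(2a,b)$.
   Context: The index of a finite-dimensional Lie algebra $\mathfrak h$ is $\mathrm{ind}\,\mathfrak h=\min_{\gamma\in\mathfrak h^*}\dim\mathfrak h_\gamma$, where $\mathfrak h_\gamma=\{\xi\in\mathfrak h\mid\gamma([\xi,\mathfrak h])=0\}$. Convention: $\gcd(0,n)=n$; $\mathfrak{gl}_0=0$, $K^0=0$. The Lie algebra $\mathfrak q(a,b)=(\mathfrak{gl}_a\oplus\mathfrak{gl}_b)\ltimes 2(K^a\otimes K^b)$ is the Lie algebra of $Q(a,b)=(\mathrm{GL}_a\times\mathrm{GL}_b)\ltimes\exp(2K^a\otimes K^b)$, where $2(K^a\otimes K^b)$ is the direct sum of two copies of $K^a\otimes K^b$, it is an Abelian ideal, and $\mathrm{GL}_a$, $\mathrm{GL}_b$ act in the natural way on $K^a$, $K^b$. The Lie algebra $\mathfrak r(a,b)=(\mathfrak{gl}_a\oplus\mathfrak{gl}_b)\ltimes\big((\mathfrak{gl}_a^{\mathsf{ab}}\oplus W)\oplus V\big)$ is the Lie algebra of $R(a,b)=(\mathrm{GL}_a\times\mathrm{GL}_b)\ltimes\exp((\mathfrak{gl}_a^{\mathsf{ab}}\oplus W)\oplus V)$. Here $\mathfrak{gl}_a^{\mathsf{ab}}$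 is a copy of the vector space $\mathfrak{gl}_a$, on which $\mathrm{GL}_a$ acts via the adjoint representation and $\mathrm{GL}_b$ acts trivially; $W\cong V\cong K^a\otimes K^b$ with the natural action of $\mathrm{GL}_a\times\mathrm{GL}_b$. In the nilpotent ideal $(\mathfrak{gl}_a^{\mathsf{ab}}\oplus W)\oplus V$ one has $[\mathfrak{gl}_a^{\mathsf{ab}},\mathfrak{gl}_a^{\mathsf{ab}}]=[W,W]=0$, $V$ is central in this ideal, and the bracket $\mathfrak{gl}_a^{\mathsf{ab}}\times W\to V$ is the natural matrix action $[A,w]=(A\otimes\mathrm{id})w$ (identifying $W\cong V\cong K^a\otimes K^b$), so that $[\mathfrak{gl}_a^{\mathsf{ab}},W]=V$. *)

theory Defs
  imports "Jordan_Normal_Form.VS_Connect"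
begin

text \<open>
  The ground field is a type \<open>'k\<close> of class \<open>field\<close>, viewed as the ring \<^term>\<open>class_ring\<close>.
  Vector spaces are \<open>module\<close> records over it, and dimensions are those of
  \<^const>\<open>vectorspace.dim\<close>.
\<close>

record ('k, 'v) lie_alg = "('k, 'v) module" +
  bracket :: "'v \<Rightarrow> 'v \<Rightarrow> 'v"

locale lie_algebra = vectorspace "class_ring :: 'k :: field ring" L
  for L :: "('k :: field, 'v, 'm) lie_alg_scheme" (structure) +
  assumes bracket_closed:
      "\<lbrakk>x \<in> carrier L; y \<in> carrier L\<rbrakk> \<Longrightarrow> bracket L x y \<in> carrier L"
    and bracket_add_left:
      "\<lbrakk>x \<in> carrier L; y \<in> carrier L; z \<in> carrier L\<rbrakk> \<Longrightarrow>
         bracket L (x \<oplus> y) z = bracket L x z \<oplus> bracket L y z"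
    and bracket_add_right:
      "\<lbrakk>x \<in> carrier L; y \<in> carrier L; z \<in> carrier L\<rbrakk> \<Longrightarrow>
         bracket L x (y \<oplus> z) = bracket L x y \<oplus> bracket L x z"
    and bracket_smult_left:
      "\<lbrakk>x \<in> carrier L; y \<in> carrier L\<rbrakk> \<Longrightarrow> bracket L (c \<odot> x) y = c \<odot> bracket L x y"
    and bracket_smult_right:
      "\<lbrakk>x \<in> carrier L; y \<in> carrier L\<rbrakk> \<Longrightarrow> bracket L x (c \<odot> y) = c \<odot> bracket L x y"
    and bracket_self: "x \<in> carrier L \<Longrightarrow> bracket L x x = \<zero>"
    and jacobi:
      "\<lbrakk>x \<in> carrier L; y \<in> carrier L; z \<in> carrier L\<rbrakk> \<Longrightarrow>
         bracket L x (bracket L y z) \<oplus> bracket L y (bracket L z x)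
           \<oplus> bracket L z (bracket L x y) = \<zero>"

definition field_module :: "('k :: field, 'k) module" where
  "field_module = \<lparr>carrier = UNIV, mult = (*), one = 1, zero = 0, add = (+), smult = (*)\<rparr>"

text \<open>
  The values of a functional outside \<^term>\<open>carrier L\<close> are arbitrary; they do not affect
  the stabiliser.
\<close>
definition lie_dual :: "('k :: field, 'v, 'm) lie_alg_scheme \<Rightarrow> ('v \<Rightarrow> 'k) set" where
  "lie_dual L = LinearCombinations.module_hom class_ring L field_module"

definition lie_stabiliser ::
    "('k :: field, 'v, 'm) lie_alg_scheme \<Rightarrow> ('v \<Rightarrow> 'k) \<Rightarrow> 'v set" where
  "lie_stabiliser L \<gamma> = {x \<in> carrier L. \<forall>y \<in> carrier L. \<gamma> (bracket L x y) = 0}"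

text \<open>The infimum is over a nonempty set of natural numbers, hence a minimum.\<close>
definition lie_index :: "('k :: field, 'v, 'm) lie_alg_scheme \<Rightarrow> nat" where
  "lie_index L =
     (INF \<gamma> \<in> lie_dual L. vectorspace.dim class_ring (L\<lparr>carrier := lie_stabiliser L \<gamma>\<rparr>))"

definition commutator :: "'k :: comm_ring_1 mat \<Rightarrow> 'k mat \<Rightarrow> 'k mat" where
  "commutator A B = A * B - B * A"

text \<open>
  \<open>K\<^sup>a \<otimes> K\<^sup>b\<close> is realised as the space of \<open>a \<times> b\<close> matrices, the pure tensor \<open>u \<otimes> v\<close> being the
  rank-one matrix with entries \<open>u\<^sub>i v\<^sub>j\<close>. Then \<open>A \<otimes> id\<close> is left multiplication by \<open>A\<close>, \<open>id \<otimes> B\<close>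
  is right multiplication by the transpose of \<open>B\<close>, and the natural action of \<open>gl\<^sub>a \<oplus> gl\<^sub>b\<close> is
  the following one.
\<close>
definition tensor_act :: "'k :: comm_ring_1 mat \<Rightarrow> 'k mat \<Rightarrow> 'k mat \<Rightarrow> 'k mat" where
  "tensor_act A B w = A * w + w * transpose_mat B"

definition pure_tensor :: "'k :: comm_ring_1 vec \<Rightarrow> 'k vec \<Rightarrow> 'k mat" where
  "pure_tensor u v = mat (dim_vec u) (dim_vec v) (\<lambda>(i, j). u $ i * v $ j)"

lemma left_mult_pure_tensor:
  assumes "A \<in> carrier_mat a a" "u \<in> carrier_vec a" "v \<in> carrier_vec b"
  shows "A * pure_tensor u v = pure_tensor (A *\<^sub>v u) v"
  using assms
  by (intro eq_matI) (auto simp: pure_tensor_def scalar_prod_def sum_distrib_left sum_distrib_right mult_ac)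

lemma tensor_act_pure_tensor:
  assumes "A \<in> carrier_mat a a" "B \<in> carrier_mat b b" "u \<in> carrier_vec a" "v \<in> carrier_vec b"
  shows "tensor_act A B (pure_tensor u v) = pure_tensor (A *\<^sub>v u) v + pure_tensor u (B *\<^sub>v v)"
  unfolding tensor_act_def left_mult_pure_tensor[OF assms(1,3,4)] using assms
  by (intro arg_cong2[where f = "(+)"] eq_matI refl)
     (auto simp: pure_tensor_def scalar_prod_def sum_distrib_left sum_distrib_right mult_ac)

definition q_lie :: "'k :: field itself \<Rightarrow> nat \<Rightarrow> nat \<Rightarrow>
    ('k, ('k mat \<times> 'k mat) \<times> ('k mat \<times> 'k mat)) lie_alg" where
  "q_lie ty a b = module.extend
     (direct_sum
       (direct_sum (module_mat ty a a) (module_mat ty b b))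
       (direct_sum (module_mat ty a b) (module_mat ty a b)))
     (lie_alg.fields (\<lambda>((A, B), (u, v)) ((A', B'), (u', v')).
       ((commutator A A', commutator B B'),
        (tensor_act A B u' - tensor_act A' B' u,
         tensor_act A B v' - tensor_act A' B' v))))"

text \<open>
  An element \<open>((A, B), ((X, w), v))\<close> has \<open>X\<close> in the abelian copy of \<open>gl\<^sub>a\<close>, \<open>w \<in> W\<close> and \<open>v \<in> V\<close>.
  The terms \<open>X * w' - X' * w\<close> come from the bracket of the nilpotent ideal.
\<close>
definition r_lie :: "'k :: field itself \<Rightarrow> nat \<Rightarrow> nat \<Rightarrow>
    ('k, ('k mat \<times> 'k mat) \<times> (('k mat \<times> 'k mat) \<times> 'k mat)) lie_alg" where
  "r_lie ty a b = module.extend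
     (direct_sum
       (direct_sum (module_mat ty a a) (module_mat ty b b))
       (direct_sum
         (direct_sum (module_mat ty a a) (module_mat ty a b))
         (module_mat ty a b)))
     (lie_alg.fields (\<lambda>((A, B), ((X, w), v)) ((A', B'), ((X', w'), v')).
       ((commutator A A', commutator B B'),
        ((commutator A X' - commutator A' X,
          tensor_act A B w' - tensor_act A' B' w),
         (tensor_act A B v' - tensor_act A' B' v) + (X * w' - X' * w)))))"

lemma module_module_mat: "Module.module (class_ring :: 'k :: field ring) (module_mat TYPE('k) m n)"
proof -
  interpret abelian_group "module_mat TYPE('k) m n" by (rule abelian_group_mat)
  show ?thesis
    by unfold_locales
       (auto simp: module_mat_simps add_smult_distrib_left_mat add_smult_distrib_right_mat
             intro!: eq_matI)
qed

lemma module_extend: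
  assumes "Module.module R M"
  shows "Module.module R (module.extend M F)"
proof -
  interpret Module.module R M by (rule assms)
  have "\<exists>y \<in> carrier M. y \<oplus>\<^bsub>M\<^esub> x = \<zero>\<^bsub>M\<^esub>" if "x \<in> carrier M" for x
    using that by (intro bexI[where x = "\<ominus>\<^bsub>M\<^esub> x"]) (simp_all add: l_neg)
  then have "abelian_group (module.extend M F)"
    by (intro abelian_groupI) (simp_all add: module.extend_def a_ac)
  then show ?thesis
    by (intro moduleI)
       (simp_all add: R.is_cring module.extend_def smult_l_distr smult_r_distr smult_assoc1)
qed

lemmas lie_simps = module.extend_def lie_alg.fields_def direct_sum_def module_mat_simps

lemma mat_dim_simps:
  fixes A B C :: "'k :: comm_ring_1 mat"
  shows "\<lbrakk>dim_col A = dim_row B; dim_col B = dim_row C\<rbrakk> \<Longrightarrow> A * B * C = A * (B * C)"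
    and "\<lbrakk>dim_row B = dim_row C; dim_col B = dim_col C; dim_col A = dim_row B\<rbrakk> \<Longrightarrow>
           A * (B + C) = A * B + A * C"
    and "\<lbrakk>dim_row B = dim_row C; dim_col B = dim_col C; dim_col A = dim_row B\<rbrakk> \<Longrightarrow>
           A * (B - C) = A * B - A * C"
    and "\<lbrakk>dim_row A = dim_row B; dim_col A = dim_col B; dim_col A = dim_row C\<rbrakk> \<Longrightarrow>
           (A + B) * C = A * C + B * C"
    and "\<lbrakk>dim_row A = dim_row B; dim_col A = dim_col B; dim_col A = dim_row C\<rbrakk> \<Longrightarrow>
           (A - B) * C = A * C - B * C"
    and "dim_col A = dim_row B \<Longrightarrow> (c \<cdot>\<^sub>m A) * B = c \<cdot>\<^sub>m (A * B)"
    and "dim_col A = dim_row B \<Longrightarrow> A * (c \<cdot>\<^sub>m B) = c \<cdot>\<^sub>m (A * B)"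
    and "\<lbrakk>dim_row A = dim_row B; dim_col A = dim_col B\<rbrakk> \<Longrightarrow> (A + B)\<^sup>T = A\<^sup>T + B\<^sup>T"
    and "\<lbrakk>dim_row A = dim_row B; dim_col A = dim_col B\<rbrakk> \<Longrightarrow> (A - B)\<^sup>T = A\<^sup>T - B\<^sup>T"
    and "dim_col A = dim_row B \<Longrightarrow> (A * B)\<^sup>T = B\<^sup>T * A\<^sup>T"
    and "(c \<cdot>\<^sub>m A)\<^sup>T = c \<cdot>\<^sub>m A\<^sup>T"
  subgoal by (rule assoc_mult_mat[of _ _ "dim_col A" _ "dim_col B" _ "dim_col C"]) auto
  subgoal by (rule mult_add_distrib_mat[of _ _ "dim_col A" _ "dim_col B"]) auto
  subgoal by (rule mult_minus_distrib_mat[of _ _ "dim_col A" _ "dim_col B"]) auto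
  subgoal by (rule add_mult_distrib_mat[of _ _ "dim_col A" _ _ "dim_col C"]) auto
  subgoal by (rule minus_mult_distrib_mat[of _ _ "dim_col A" _ _ "dim_col C"]) auto
  subgoal by (intro eq_matI) auto
  subgoal by (intro eq_matI) auto
  subgoal by (intro eq_matI) auto
  subgoal by (intro eq_matI) auto
  subgoal by (rule transpose_mult[of _ _ "dim_col A" _ "dim_col B"]) auto
  subgoal by (intro eq_matI) auto
  done

lemma commutator_dim [simp]:
  "dim_row (commutator A B) = dim_row B" "dim_col (commutator A B) = dim_col A"
  by (simp_all add: commutator_def)

lemma tensor_act_dim [simp]:
  "dim_row (tensor_act A B w) = dim_row w" "dim_col (tensor_act A B w) = dim_row B"
  by (simp_all add: tensor_act_def)

lemma commutator_simps_1:
  fixes A B :: "'k :: comm_ring_1 mat"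
  assumes [simp]: "A \<in> carrier_mat a a" "B \<in> carrier_mat a a"
  shows "commutator A B \<in> carrier_mat a a"
    and "commutator (c \<cdot>\<^sub>m A) B = c \<cdot>\<^sub>m commutator A B"
    and "commutator A (c \<cdot>\<^sub>m B) = c \<cdot>\<^sub>m commutator A B"
  using assms[THEN carrier_matD(1)] assms[THEN carrier_matD(2)]
  by (auto intro!: eq_matI simp: commutator_def mat_dim_simps algebra_simps
           simp del: index_mult_mat(1))

lemma commutator_simps_2:
  fixes A :: "'k :: comm_ring_1 mat"
  assumes [simp]: "A \<in> carrier_mat a a"
  shows "commutator A A = 0\<^sub>m a a"
  using assms[THEN carrier_matD(1)] assms[THEN carrier_matD(2)]
  by (auto intro!: eq_matI simp: commutator_def mat_dim_simps algebra_simps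
           simp del: index_mult_mat(1))

lemma commutator_simps_3:
  fixes A B C :: "'k :: comm_ring_1 mat"
  assumes [simp]: "A \<in> carrier_mat a a" "B \<in> carrier_mat a a" "C \<in> carrier_mat a a"
  shows "commutator (A + B) C = commutator A C + commutator B C"
    and "commutator A (B + C) = commutator A B + commutator A C"
    and "commutator A (B - C) = commutator A B - commutator A C"
    and "commutator (commutator A B) C =
           commutator A (commutator B C) - commutator B (commutator A C)"
    and "commutator A (commutator B C) + commutator B (commutator C A)
           + commutator C (commutator A B) = 0\<^sub>m a a"
  using assms[THEN carrier_matD(1)] assms[THEN carrier_matD(2)]
  by (auto intro!: eq_matI simp: commutator_def mat_dim_simps algebra_simps
           simp del: index_mult_mat(1))

lemmas commutator_simps = commutator_simps_1 commutator_simps_2 commutator_simps_3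

lemma tensor_act_simps_1:
  fixes A B w :: "'k :: comm_ring_1 mat"
  assumes [simp]: "A \<in> carrier_mat a a" "B \<in> carrier_mat b b" "w \<in> carrier_mat a b"
  shows "tensor_act A B w \<in> carrier_mat a b"
    and "tensor_act (c \<cdot>\<^sub>m A) (c \<cdot>\<^sub>m B) w = c \<cdot>\<^sub>m tensor_act A B w"
    and "tensor_act A B (c \<cdot>\<^sub>m w) = c \<cdot>\<^sub>m tensor_act A B w"
  using assms[THEN carrier_matD(1)] assms[THEN carrier_matD(2)]
  by (auto intro!: eq_matI simp: commutator_def tensor_act_def mat_dim_simps algebra_simps
           simp del: index_mult_mat(1))

lemma tensor_act_simps_2:
  fixes A A' B B' w :: "'k :: comm_ring_1 mat"
  assumes [simp]: "A \<in> carrier_mat a a" "A' \<in> carrier_mat a a" "B \<in> carrier_mat b b" "B' \<in> carrier_mat b b" "w \<in> carrier_mat a b"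
  shows "tensor_act (A + A') (B + B') w = tensor_act A B w + tensor_act A' B' w"
    and "tensor_act (commutator A A') (commutator B B') w =
           tensor_act A B (tensor_act A' B' w) - tensor_act A' B' (tensor_act A B w)"
  using assms[THEN carrier_matD(1)] assms[THEN carrier_matD(2)]
  by (auto intro!: eq_matI simp: commutator_def tensor_act_def mat_dim_simps algebra_simps
           simp del: index_mult_mat(1))

lemma tensor_act_simps_3:
  fixes A B w w' :: "'k :: comm_ring_1 mat"
  assumes [simp]: "A \<in> carrier_mat a a" "B \<in> carrier_mat b b" "w \<in> carrier_mat a b" "w' \<in> carrier_mat a b"
  shows "tensor_act A B (w + w') = tensor_act A B w + tensor_act A B w'"
    and "tensor_act A B (w - w') = tensor_act A B w - tensor_act A B w'"
  using assms[THEN carrier_matD(1)] assms[THEN carrier_matD(2)]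
  by (auto intro!: eq_matI simp: commutator_def tensor_act_def mat_dim_simps algebra_simps
           simp del: index_mult_mat(1))

lemma tensor_act_simps_4:
  fixes A B w X :: "'k :: comm_ring_1 mat"
  assumes [simp]: "A \<in> carrier_mat a a" "B \<in> carrier_mat b b" "w \<in> carrier_mat a b" "X \<in> carrier_mat a a"
  shows "tensor_act A B (X * w) = commutator A X * w + X * tensor_act A B w"
  using assms[THEN carrier_matD(1)] assms[THEN carrier_matD(2)]
  by (auto intro!: eq_matI simp: commutator_def tensor_act_def mat_dim_simps algebra_simps
           simp del: index_mult_mat(1))

lemmas tensor_act_simps = tensor_act_simps_1 tensor_act_simps_2 tensor_act_simps_3 tensor_act_simps_4

lemma q_lie_algebra: "lie_algebra (q_lie TYPE('k :: field) a b)"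
proof -
  let ?L = "q_lie TYPE('k) a b"
  have "Module.module class_ring ?L"
    unfolding q_lie_def by (intro module_extend direct_sum_is_module module_module_mat)
  moreover have "field (class_ring :: 'k ring)" by (rule class_field.field_axioms)
  moreover have "lie_algebra_axioms ?L"
    apply (rule lie_algebra_axioms.intro)
    apply (simp_all only: q_lie_def lie_simps partial_object.simps monoid.simps ring.simps
      module.simps lie_alg.simps)
    subgoal
      by (elim SigmaE; simp add: commutator_simps tensor_act_simps;
          intro conjI add_carrier_mat minus_carrier_mat mult_carrier_mat;
          simp add: commutator_simps tensor_act_simps)
    subgoal
      by (elim SigmaE; simp add: commutator_simps tensor_act_simps; intro conjI eq_matI;
          simp add: mat_dim_simps algebra_simps del: index_mult_mat(1))
    subgoal
      by (elim SigmaE; simp add: commutator_simps tensor_act_simps; intro conjI eq_matI;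
          simp add: mat_dim_simps algebra_simps del: index_mult_mat(1))
    subgoal
      by (elim SigmaE; simp add: commutator_simps tensor_act_simps; intro conjI eq_matI;
          simp add: mat_dim_simps algebra_simps del: index_mult_mat(1))
    subgoal
      by (elim SigmaE; simp add: commutator_simps tensor_act_simps; intro conjI eq_matI;
          simp add: mat_dim_simps algebra_simps del: index_mult_mat(1))
    subgoal
      by (elim SigmaE; simp add: commutator_simps tensor_act_simps; intro conjI eq_matI;
          simp add: mat_dim_simps algebra_simps del: index_mult_mat(1))
    subgoal
      by (elim SigmaE; simp add: commutator_simps tensor_act_simps; intro conjI eq_matI;
          simp add: mat_dim_simps algebra_simps del: index_mult_mat(1))
    done
  ultimately show ?thesis by (intro lie_algebra.intro vectorspace.intro)
qed

lemma r_lie_algebra: "lie_algebra (r_lie TYPE('k :: field) a b)"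
proof -
  let ?L = "r_lie TYPE('k) a b"
  have "Module.module class_ring ?L"
    unfolding r_lie_def by (intro module_extend direct_sum_is_module module_module_mat)
  moreover have "field (class_ring :: 'k ring)" by (rule class_field.field_axioms)
  moreover have "lie_algebra_axioms ?L"
    apply (rule lie_algebra_axioms.intro)
    apply (simp_all only: r_lie_def lie_simps partial_object.simps monoid.simps ring.simps
      module.simps lie_alg.simps)
    subgoal
      by (elim SigmaE; simp add: commutator_simps tensor_act_simps;
          intro conjI add_carrier_mat minus_carrier_mat mult_carrier_mat;
          simp add: commutator_simps tensor_act_simps)
    subgoal
      by (elim SigmaE; simp add: commutator_simps tensor_act_simps; intro conjI eq_matI;
          simp add: mat_dim_simps algebra_simps del: index_mult_mat(1))
    subgoal
      by (elim SigmaE; simp add: commutator_simps tensor_act_simps; intro conjI eq_matI;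
          simp add: mat_dim_simps algebra_simps del: index_mult_mat(1))
    subgoal
      by (elim SigmaE; simp add: commutator_simps tensor_act_simps; intro conjI eq_matI;
          simp add: mat_dim_simps algebra_simps del: index_mult_mat(1))
    subgoal
      by (elim SigmaE; simp add: commutator_simps tensor_act_simps; intro conjI eq_matI;
          simp add: mat_dim_simps algebra_simps del: index_mult_mat(1))
    subgoal
      by (elim SigmaE; simp add: commutator_simps tensor_act_simps; intro conjI eq_matI;
          simp add: mat_dim_simps algebra_simps del: index_mult_mat(1))
    subgoal
      by (elim SigmaE; simp add: commutator_simps tensor_act_simps minus_carrier_mat
            mult_carrier_mat[of _ a a _ b]; intro conjI eq_matI;
          simp add: mat_dim_simps algebra_simps del: index_mult_mat(1))
    done
  ultimately show ?thesis by (intro lie_algebra.intro vectorspace.intro)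
qed

end

theory Submission
  imports Defs
begin

text \<open>
  Both Lie algebras are commutator algebras of block matrices \<open>[[A, u], [0, B]]\<close> with \<open>B\<close> arbitrary of size \<open>b\<close>,
  \<open>u\<close> arbitrary of size \<open>2 a \<times> b\<close> and \<open>A\<close> in an associative algebra \<open>S\<close> of matrices of size \<open>2 a\<close>: the diagonal
  copy of \<open>gl\<^sub>a\<close> for \<open>q\<close>, and \<open>gl\<^sub>a(K[\<epsilon>])\<close> with \<open>\<epsilon>\<^sup>2 = 0\<close>, the centraliser of a nilpotent \<open>N\<close>, for \<open>r\<close>.
  A functional has components \<open>\<alpha>\<close>, \<open>p\<close>, \<open>\<beta>\<close>, and its stabiliser is given by \<open>p A = B p\<close>,
  \<open>[\<beta>, B] + p u = 0\<close> and \<open>[\<alpha>, A] - u p\<close> being trace-orthogonal to \<open>S\<close>. Since stabiliser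
  dimensions are semicontinuous along lines and \<open>K\<close> is infinite, only generic \<open>p\<close> matter for the
  minimum, and for these the stabiliser is one of a smaller algebra: \<open>(a, b)\<close> becomes \<open>(a, b - 2 a)\<close> when \<open>p\<close> is injective, and \<open>(a, 2 a - b)\<close>, by passing from the kernel
  of a surjective \<open>p\<close> to its annihilator; for \<open>r\<close> and \<open>b \<le> a\<close> it becomes \<open>(a - b, b)\<close>, while \<open>q(a, b)\<close> and
  \<open>q(b, a)\<close> are isomorphic. These steps preserve the claimed gcd. The resulting Euclidean algorithm stops at
  \<open>gl\<^sub>n\<close>, \<open>gl\<^sub>n(K[\<epsilon>])\<close> and \<open>q(n, n)\<close>, where cyclic vectors give the indices \<open>n\<close>, \<open>2 n\<close> and \<open>2 n\<close>.
\<close>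

section \<open>Finitely supported matrices\<close>

text \<open>The reductions change block sizes at every step, so all blocks are placed in one ring of
  finitely supported matrices, used without a unit: a block is cut out by a pair of idempotents, and
  sizes occur only as cardinalities of index sets. The obstacle is that the index is a minimum over
  all functionals, while a reduction is available only where \<open>p\<close> has maximal rank. Such
  functionals are described as those for which a certain square matrix is invertible. This condition
  is polynomial along lines, and the inverse matrix itself provides the splitting maps that the
  reduction needs. Lower bounds are proved there and spread to all functionals; upper bounds mostly
  come from a functional whose \<open>p\<close> is a coordinate map. Stabilisers are compared only
  through linear injections. The duality step gives an inequality in one direction, but it is
  symmetric in the two complementary sizes, which suffices. The case \<open>q(n, n)\<close> is tied
  to \<open>gl_n(K[\<epsilon>])\<close>: a pair of square matrices with the first one invertible can
  be normalised to \<open>(1, P)\<close>, and what is left of the stabiliser equations says that an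
  element \<open>b + c \<epsilon>\<close> commutes with some
  \<open>P + Q \<epsilon>\<close>.\<close>

typedef (overloaded) ('i, 'a :: zero) fmat =
  "{f :: 'i \<Rightarrow> 'i \<Rightarrow> 'a. finite {i. \<exists>j. f i j \<noteq> 0 \<or> f j i \<noteq> 0}}"
  morphisms ent Fmat
  by (rule exI[of _ "\<lambda>_ _. 0"]) simp

definition supp :: "('i, 'a :: zero) fmat \<Rightarrow> 'i set" where
  "supp x = {i. \<exists>j. ent x i j \<noteq> 0 \<or> ent x j i \<noteq> 0}"

lemma finite_supp [simp]: "finite (supp x)"
  using ent[of x] by (simp add: supp_def)

lemma ent_nz_supp: "ent x i j \<noteq> 0 \<Longrightarrow> i \<in> supp x" "ent x i j \<noteq> 0 \<Longrightarrow> j \<in> supp x"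
  by (auto simp: supp_def)

lemma ent_supp [simp]: "i \<notin> supp x \<Longrightarrow> ent x i j = 0" "j \<notin> supp x \<Longrightarrow> ent x i j = 0"
  by (auto simp: supp_def)

lemma fmat_eqI: "(\<And>i j. ent x i j = ent y i j) \<Longrightarrow> x = y"
  by (metis ent_inject ext)

lemma ent_Fmat:
  assumes "finite I" "\<And>i j. f i j \<noteq> 0 \<Longrightarrow> i \<in> I \<and> j \<in> I"
  shows "ent (Fmat f) = f"
proof -
  have "{i. \<exists>j. f i j \<noteq> 0 \<or> f j i \<noteq> 0} \<subseteq> I" using assms(2) by blast
  then show ?thesis using assms(1) by (intro Fmat_inverse) (auto intro: finite_subset)
qed

instantiation fmat :: (type, field) ring
begin

definition "0 = Fmat (\<lambda>_ _. 0)"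
definition "x + y = Fmat (\<lambda>i j. ent x i j + ent y i j)"
definition "x - y = Fmat (\<lambda>i j. ent x i j - ent y i j)"
definition "- x = Fmat (\<lambda>i j. - ent x i j)"
definition "x * y = Fmat (\<lambda>i j. \<Sum>k\<in>supp x. ent x i k * ent y k j)"

lemma ent_0 [simp]: "ent (0 :: ('a, 'b) fmat) i j = 0"
  unfolding zero_fmat_def by (subst ent_Fmat[of "{}"]) auto

lemma ent_add [simp]: "ent (x + y :: ('a, 'b) fmat) i j = ent x i j + ent y i j"
  unfolding plus_fmat_def by (subst ent_Fmat[of "supp x \<union> supp y"]) (auto dest: ent_nz_supp)

lemma ent_minus [simp]: "ent (x - y :: ('a, 'b) fmat) i j = ent x i j - ent y i j"
  unfolding minus_fmat_def by (subst ent_Fmat[of "supp x \<union> supp y"]) (auto dest: ent_nz_supp)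

lemma ent_uminus [simp]: "ent (- x :: ('a, 'b) fmat) i j = - ent x i j"
  unfolding uminus_fmat_def by (subst ent_Fmat[of "supp x"]) (auto dest: ent_nz_supp)

lemma ent_mult: "ent (x * y :: ('a, 'b) fmat) i j = (\<Sum>k\<in>supp x. ent x i k * ent y k j)"
  unfolding times_fmat_def
  by (subst ent_Fmat[of "supp x \<union> supp y"]) (simp, rule ccontr, auto)

text \<open>The product sums over the support of the left factor only. Freedom in the summation
  range lets nested products be compared over one common range, which is how the ring laws are
  checked.\<close>

lemma ent_mult_over:
  assumes "finite I" "\<And>k. ent x i k \<noteq> 0 \<Longrightarrow> ent y k j \<noteq> 0 \<Longrightarrow> k \<in> I"
  shows "ent (x * y :: ('a, 'b) fmat) i j = (\<Sum>k\<in>I. ent x i k * ent y k j)"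
proof -
  have "(\<Sum>k\<in>supp x. ent x i k * ent y k j) = (\<Sum>k\<in>supp x \<union> I. ent x i k * ent y k j)"
    using assms(1) by (intro sum.mono_neutral_left) auto
  also have "\<dots> = (\<Sum>k\<in>I. ent x i k * ent y k j)"
    using assms by (intro sum.mono_neutral_right) auto
  finally show ?thesis by (simp add: ent_mult)
qed

instance
proof
  fix x y z :: "('a, 'b) fmat"
  define I where "I = supp x \<union> supp y \<union> supp z"
  have I: "finite I" "supp x \<subseteq> I" "supp y \<subseteq> I" "supp z \<subseteq> I" by (auto simp: I_def)
  have xy: "ent (x * y) i j = (\<Sum>k\<in>I. ent x i k * ent y k j)" for i j
    by (intro ent_mult_over) (use I in \<open>auto dest: ent_nz_supp\<close>)
  have xz: "ent (x * z) i j = (\<Sum>k\<in>I. ent x i k * ent z k j)" for i j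
    by (intro ent_mult_over) (use I in \<open>auto dest: ent_nz_supp\<close>)
  have yz: "ent (y * z) i j = (\<Sum>k\<in>I. ent y i k * ent z k j)" for i j
    by (intro ent_mult_over) (use I in \<open>auto dest: ent_nz_supp\<close>)
  have 1: "ent (x * y * z) i j = (\<Sum>k\<in>I. ent (x * y) i k * ent z k j)" for i j
    by (intro ent_mult_over) (use I in \<open>auto dest: ent_nz_supp\<close>)
  have 2: "ent (x * (y * z)) i j = (\<Sum>k\<in>I. ent x i k * ent (y * z) k j)" for i j
    by (intro ent_mult_over) (use I in \<open>auto dest: ent_nz_supp\<close>)
  show "x * y * z = x * (y * z)"
    by (intro fmat_eqI, simp only: 1 2 xy yz sum_distrib_left sum_distrib_right, subst sum.swap)
       (simp add: mult.assoc)
  have 3: "ent ((x + y) * z) i j = (\<Sum>k\<in>I. ent (x + y) i k * ent z k j)" for i j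
    by (intro ent_mult_over) (use I in \<open>auto dest: ent_nz_supp\<close>)
  show "(x + y) * z = x * z + y * z"
    by (intro fmat_eqI) (simp add: 3 xz yz sum.distrib distrib_right)
  have 4: "ent (x * (y + z)) i j = (\<Sum>k\<in>I. ent x i k * ent (y + z) k j)" for i j
    by (intro ent_mult_over) (use I in \<open>auto dest: ent_nz_supp\<close>)
  show "x * (y + z) = x * y + x * z"
    by (intro fmat_eqI) (simp add: 4 xz xy sum.distrib distrib_left)
qed (auto intro!: fmat_eqI)

end

definition sc :: "'a :: field \<Rightarrow> ('i, 'a) fmat \<Rightarrow> ('i, 'a) fmat" where
  "sc c x = Fmat (\<lambda>i j. c * ent x i j)"

lemma ent_sc [simp]: "ent (sc c x) i j = c * ent x i j"
  unfolding sc_def by (subst ent_Fmat[of "supp x"]) (auto dest: ent_nz_supp)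

text \<open>Spans, independence and dimension come from the vector space locale of HOL. The
  dimension used for Lie algebra records is matched with \<open>fm.dim\<close> only in
  \<open>dim_transfer\<close>.\<close>

interpretation fm: vector_space "sc :: 'a :: field \<Rightarrow> ('i, 'a) fmat \<Rightarrow> ('i, 'a) fmat"
  by unfold_locales (auto intro!: fmat_eqI simp: algebra_simps)

interpretation ff: vector_space "(*) :: 'a :: field \<Rightarrow> 'a \<Rightarrow> 'a"
  by unfold_locales (auto simp: algebra_simps)

interpretation fmfm: vector_space_pair "sc :: 'a :: field \<Rightarrow> ('i, 'a) fmat \<Rightarrow> ('i, 'a) fmat" "sc :: 'a :: field \<Rightarrow> ('j, 'a) fmat \<Rightarrow> ('j, 'a) fmat"
  by unfold_locales

interpretation fmff: vector_space_pair "sc :: 'a :: field \<Rightarrow> ('i, 'a) fmat \<Rightarrow> ('i, 'a) fmat" "(*) :: 'a :: field \<Rightarrow> 'a \<Rightarrow> 'a"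
  by unfold_locales

lemma ent_sum: "ent (sum f A) i j = (\<Sum>a\<in>A. ent (f a) i j)"
  for f :: "'b \<Rightarrow> ('i, 'a :: field) fmat"
  by (induction A rule: infinite_finite_induct) auto

lemma sc_mult_left [simp]: "sc c x * y = sc c (x * y)"
proof (intro fmat_eqI)
  fix i j
  have "ent (sc c x * y) i j = (\<Sum>k\<in>supp x. ent (sc c x) i k * ent y k j)"
    by (rule ent_mult_over, simp, rule ccontr, simp)
  also have "\<dots> = ent (sc c (x * y)) i j"
    unfolding ent_sc ent_mult[of x] sum_distrib_left by (simp only: mult.assoc)
  finally show "ent (sc c x * y) i j = ent (sc c (x * y)) i j" .
qed

lemma sc_mult_right [simp]: "x * sc c y = sc c (x * y)"
  by (intro fmat_eqI, unfold ent_sc ent_mult[of x] sum_distrib_left) (intro sum.cong refl mult.left_commute)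

definition tr :: "('i, 'a :: field) fmat \<Rightarrow> 'a" where
  "tr x = (\<Sum>i\<in>supp x. ent x i i)"

lemma tr_over: "finite I \<Longrightarrow> (\<And>i. ent x i i \<noteq> 0 \<Longrightarrow> i \<in> I) \<Longrightarrow> tr x = (\<Sum>i\<in>I. ent x i i)"
  unfolding tr_def
  by (rule trans[OF sum.mono_neutral_left[of "supp x \<union> I"] sum.mono_neutral_right]) auto

lemma tr_add [simp]: "tr (x + y) = tr x + tr y"
  by (subst (1 2 3) tr_over[of "supp x \<union> supp y"]) (auto simp: sum.distrib dest: ent_nz_supp)

lemma tr_sc [simp]: "tr (sc c x) = c * tr x"
  by (subst (1 2) tr_over[of "supp x"]) (auto simp: sum_distrib_left dest: ent_nz_supp)

lemma tr_0 [simp]: "tr 0 = 0" by (simp add: tr_def)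

lemma tr_uminus [simp]: "tr (- x) = - tr x"
  using tr_add[of x "- x"] by (simp add: eq_neg_iff_add_eq_0 add.commute)

lemma tr_minus [simp]: "tr (x - y) = tr x - tr y"
  using tr_add[of x "- y"] by simp

lemma tr_sum: "tr (sum f A) = (\<Sum>a\<in>A. tr (f a))"
  by (induction A rule: infinite_finite_induct) auto

lemma tr_mult_over:
  assumes "finite I" "supp x \<subseteq> I" "supp y \<subseteq> I"
  shows "tr (x * y) = (\<Sum>i\<in>I. \<Sum>k\<in>I. ent x i k * ent y k i)"
proof -
  have *: "ent (x * y) i i = (\<Sum>k\<in>I. ent x i k * ent y k i)" for i
    using assms by (intro ent_mult_over) (auto dest: ent_nz_supp)
  have "ent (x * y) i i = 0" if "i \<notin> I" for i
    using that assms(2) unfolding * by (intro sum.neutral ballI) (metis ent_supp(1) mult_zero_left subsetD)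
  then have "tr (x * y) = (\<Sum>i\<in>I. ent (x * y) i i)"
    using assms(1) by (intro tr_over) auto
  then show ?thesis by (simp add: *)
qed

lemma tr_commute: "tr (x * y) = tr (y * x)"
  by (subst (1 2) tr_mult_over[of "supp x \<union> supp y"])
     (auto simp: mult.commute intro: sum.swap)

definition mu :: "'i \<Rightarrow> 'i \<Rightarrow> ('i, 'a :: field) fmat" where
  "mu i j = Fmat (\<lambda>k l. if k = i \<and> l = j then 1 else 0)"

lemma ent_mu: "ent (mu i j) k l = (if k = i \<and> l = j then 1 else 0)"
  unfolding mu_def by (subst ent_Fmat[of "{i, j}"]) (auto split: if_splits)

lemma mu_mult: "mu i j * mu k l = (if j = k then mu i l else 0)"
  by (intro fmat_eqI, subst ent_mult_over[of "{j}"]) (auto simp: ent_mu split: if_splits)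

lemma tr_mult_mu: "tr (x * mu j i) = ent x i j" for x :: "('i, 'a :: field) fmat"
proof -
  have "supp (mu j i :: ('i, 'a) fmat) \<subseteq> {i, j}"
    by (auto simp: supp_def ent_mu split: if_splits)
  then have "tr (x * mu j i) = (\<Sum>k\<in>supp x \<union> {i, j}. \<Sum>l\<in>supp x \<union> {i, j}. ent x k l * ent (mu j i) l k)"
    by (intro tr_mult_over) auto
  also have "\<dots> = (\<Sum>k\<in>supp x \<union> {i, j}. \<Sum>l\<in>supp x \<union> {i, j}. if l = j then if k = i then ent x k l else 0 else 0)"
    by (intro sum.cong) (auto simp: ent_mu)
  also have "\<dots> = ent x i j" by (simp add: sum.delta)
  finally show ?thesis .
qed

lemma tr_mu_mult: "tr (mu j i * x) = ent x i j"
  by (simp add: tr_commute[of "mu j i"] tr_mult_mu)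

definition idm :: "'i set \<Rightarrow> ('i, 'a :: field) fmat" where
  "idm I = Fmat (\<lambda>i j. if i = j \<and> i \<in> I then 1 else 0)"

lemma ent_idm: "finite I \<Longrightarrow> ent (idm I) i j = (if i = j \<and> i \<in> I then 1 else 0)"
  unfolding idm_def by (subst ent_Fmat[of I]) (auto split: if_splits)

lemma ent_idm_mult: "finite I \<Longrightarrow> ent (idm I * x) i j = (if i \<in> I then ent x i j else 0)"
  by (subst ent_mult_over[of "{i}"]) (auto simp: ent_idm split: if_splits)

lemma ent_mult_idm: "finite I \<Longrightarrow> ent (x * idm I) i j = (if j \<in> I then ent x i j else 0)"
  by (subst ent_mult_over[of "{j}"]) (auto simp: ent_idm split: if_splits)

lemma idm_mult_idm: "finite I \<Longrightarrow> finite J \<Longrightarrow> idm I * idm J = idm (I \<inter> J)"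
  by (intro fmat_eqI) (auto simp: ent_idm_mult ent_idm)

lemma idm_Un: "finite I \<Longrightarrow> finite J \<Longrightarrow> I \<inter> J = {} \<Longrightarrow> idm (I \<union> J) = idm I + idm J"
  by (intro fmat_eqI) (auto simp: ent_idm)

text \<open>The Peirce component of a pair of idempotents. For coordinate idempotents it consists of
  the matrices with rows in one index set and columns in the other, so \<open>e\<close> and
  \<open>f\<close> take over the task of dimensions.\<close>

definition corner :: "('i, 'a :: field) fmat \<Rightarrow> ('i, 'a) fmat \<Rightarrow> ('i, 'a) fmat set" where
  "corner e f = {x. e * x = x \<and> x * f = x}"

lemma cornerD: "x \<in> corner e f \<Longrightarrow> e * x = x" "x \<in> corner e f \<Longrightarrow> x * f = x"
  by (auto simp: corner_def)

lemma corner_idm_iff: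
  assumes "finite I" "finite J"
  shows "x \<in> corner (idm I) (idm J) \<longleftrightarrow> (\<forall>i j. ent x i j \<noteq> 0 \<longrightarrow> i \<in> I \<and> j \<in> J)"
proof
  assume "x \<in> corner (idm I) (idm J)"
  then have x: "idm I * x = x" "x * idm J = x" by (auto simp: corner_def)
  show "\<forall>i j. ent x i j \<noteq> 0 \<longrightarrow> i \<in> I \<and> j \<in> J"
    using ent_idm_mult[OF assms(1), of x, unfolded x] ent_mult_idm[OF assms(2), of x, unfolded x] by metis
next
  assume "\<forall>i j. ent x i j \<noteq> 0 \<longrightarrow> i \<in> I \<and> j \<in> J"
  then have "ent x i j = 0" if "i \<notin> I \<or> j \<notin> J" for i j using that by blast
  then show "x \<in> corner (idm I) (idm J)"
    unfolding corner_def using assms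
    by (auto simp: ent_idm_mult ent_mult_idm intro!: fmat_eqI)
qed

lemma fmat_expand:
  assumes "finite I" "finite J" "x \<in> corner (idm I) (idm J)"
  shows "x = (\<Sum>i\<in>I. \<Sum>j\<in>J. sc (ent x i j) (mu i j))"
proof (intro fmat_eqI)
  fix k l
  have "ent (\<Sum>i\<in>I. \<Sum>j\<in>J. sc (ent x i j) (mu i j)) k l = (\<Sum>i\<in>I. \<Sum>j\<in>J. if i = k \<and> j = l then ent x i j else 0)"
    by (auto simp: ent_sum ent_mu intro!: sum.cong)
  also have "\<dots> = (\<Sum>i\<in>I. if i = k then \<Sum>j\<in>J. if j = l then ent x i j else 0 else 0)"
    by (intro sum.cong) auto
  also have "\<dots> = ent x k l"
    using assms by (auto simp: corner_idm_iff sum.delta)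
  finally show "ent x k l = ent (\<Sum>i\<in>I. \<Sum>j\<in>J. sc (ent x i j) (mu i j)) k l" ..
qed

text \<open>The matrix space is infinite dimensional when the index type is infinite, and
  \<open>fm.dim\<close> of an infinite dimensional space is 0. Dimension estimates therefore carry a
  finite spanning set along.\<close>

definition fin_span :: "('i, 'a :: field) fmat set \<Rightarrow> bool" where
  "fin_span V \<longleftrightarrow> (\<exists>F. finite F \<and> V \<subseteq> fm.span F)"

lemma fin_span_subset: "fin_span W \<Longrightarrow> V \<subseteq> W \<Longrightarrow> fin_span V"
  by (auto simp: fin_span_def)

lemma fin_span_corner:
  assumes I: "finite I" and J: "finite J"
  shows "fin_span (corner (idm I) (idm J) :: ('i, 'a :: field) fmat set)"
proof -
  define F where "F = (\<lambda>(i, j). mu i j :: ('i, 'a) fmat) ` (I \<times> J)"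
  have "finite F" using I J by (simp add: F_def)
  have F: "mu i j \<in> F" if "i \<in> I" "j \<in> J" for i j using that by (force simp: F_def)
  have "x \<in> fm.span F" if x: "x \<in> corner (idm I) (idm J)" for x
  proof -
    have "(\<Sum>i\<in>I. \<Sum>j\<in>J. sc (c i j) (mu i j)) \<in> fm.span F" for c
      by (intro fm.span_sum fm.span_scale fm.span_base F)
    from this[of "ent x"] show ?thesis by (simp only: fmat_expand[OF I J x, symmetric])
  qed
  with \<open>finite F\<close> show ?thesis by (auto simp: fin_span_def)
qed

lemma subspace_corner: "fm.subspace (corner e f)"
  by (rule fm.subspaceI) (simp_all add: corner_def distrib_left distrib_right)

lemma fin_span_basis:
  assumes "fin_span V"
  obtains B where "finite B" "B \<subseteq> V" "fm.independent B" "V \<subseteq> fm.span B" "card B = fm.dim V"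
proof -
  from fm.basis_exists obtain B where B: "B \<subseteq> V" "fm.independent B" "V \<subseteq> fm.span B" "card B = fm.dim V"
    by blast
  from assms obtain F where F: "finite F" "V \<subseteq> fm.span F" by (auto simp: fin_span_def)
  have "finite B" using fm.independent_span_bound[OF F(1) B(2)] B(1) F(2) by blast
  with B that show ?thesis by blast
qed

lemma independent_card_le:
  assumes "fin_span V" "fm.independent B" "B \<subseteq> V"
  shows "finite B" "card B \<le> fm.dim V"
proof -
  from fin_span_basis[OF assms(1)] obtain C where
    C: "finite C" "V \<subseteq> fm.span C" "card C = fm.dim V" by metis
  then show "finite B" "card B \<le> fm.dim V"
    using fm.independent_span_bound[OF C(1) assms(2)] assms(3) by auto
qed

abbreviation lin :: "(('i, 'a :: field) fmat \<Rightarrow> ('j, 'a) fmat) \<Rightarrow> bool" where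
  "lin \<equiv> Vector_Spaces.linear sc sc"

lemma linI: "(\<And>x y. f (x + y) = f x + f y) \<Longrightarrow> (\<And>c x. f (sc c x) = sc c (f x)) \<Longrightarrow> lin f"
  by (simp add: Vector_Spaces.linear_iff fm.vector_space_axioms)

text \<open>A basis of \<open>V\<close> is sent to an independent subset of \<open>W\<close>.
  Injectivity is asked on \<open>V\<close> only, since the maps used later are defined on the whole
  matrix space and usually have a kernel there.\<close>

lemma dim_le_of_inj:
  assumes f: "lin f" and V: "fm.subspace V" and W: "fin_span W"
    and im: "\<And>x. x \<in> V \<Longrightarrow> f x \<in> W" and inj: "\<And>x. x \<in> V \<Longrightarrow> f x = 0 \<Longrightarrow> x = 0"
  shows "fm.dim V \<le> fm.dim W"
proof -
  from fm.basis_exists obtain B where B: "B \<subseteq> V" "fm.independent B" "V \<subseteq> fm.span B" "card B = fm.dim V"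
    by blast
  have VB: "fm.span B = V" using B V fm.span_minimal by blast
  have injV: "inj_on f (fm.span B)"
    unfolding VB using fmfm.linear_inj_on_iff_eq_0[OF f V] inj by blast
  have "fm.independent (f ` B)"
    using fmfm.linear_independent_injective_image[OF f B(2) injV] .
  moreover have "f ` B \<subseteq> W" using B(1) im by blast
  ultimately have "card (f ` B) \<le> fm.dim W" using independent_card_le[OF W] by blast
  moreover have "inj_on f B" using injV by (rule inj_on_subset) (auto intro: fm.span_base)
  ultimately show ?thesis using B(4) card_image by metis
qed

text \<open>A single column is the model space of known dimension: in the base cases stabilisers are
  compared with it through their values at a cyclic vector.\<close>

lemma dim_corner_column:
  assumes "finite I"
  shows "fm.dim (corner (idm I) (idm {j}) :: ('i, 'a :: field) fmat set) = card I"
proof -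
  let ?B = "(\<lambda>i. mu i j) ` I :: ('i, 'a) fmat set"
  let ?V = "corner (idm I) (idm {j}) :: ('i, 'a) fmat set"
  have inj: "inj (\<lambda>i. mu i j :: ('i, 'a) fmat)"
    by (rule injI) (metis ent_mu zero_neq_one)
  have ind: "fm.independent ?B"
  proof (rule fm.independent_if_scalars_zero)
    show "finite ?B" using assms by simp
    fix g x assume sum: "(\<Sum>x\<in>?B. sc (g x) x) = 0" and x: "x \<in> ?B"
    then obtain i where i: "i \<in> I" "x = mu i j" by auto
    have "0 = ent (\<Sum>x\<in>?B. sc (g x) x) i j" by (simp add: sum)
    also have "(\<Sum>x\<in>?B. sc (g x) x) = (\<Sum>k\<in>I. sc (g (mu k j)) (mu k j))"
      by (subst sum.reindex) (auto intro: inj_on_subset[OF inj])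
    also have "ent \<dots> i j = (\<Sum>k\<in>I. if k = i then g (mu k j) else 0)"
      by (auto simp: ent_sum ent_mu intro!: sum.cong)
    also have "\<dots> = g x" using i assms by simp
    finally show "g x = 0" ..
  qed
  have "?B \<subseteq> ?V" using assms by (auto simp: corner_idm_iff ent_mu)
  moreover have "?V \<subseteq> fm.span ?B"
  proof
    fix x :: "('i, 'a) fmat"
    assume "x \<in> ?V"
    from fmat_expand[OF assms _ this] have "x = (\<Sum>i\<in>I. sc (ent x i j) (mu i j))" by simp
    moreover have "(\<Sum>i\<in>I. sc (ent x i j) (mu i j)) \<in> fm.span ?B"
      by (intro fm.span_sum fm.span_scale fm.span_base) auto
    ultimately show "x \<in> fm.span ?B" by (rule ssubst[of _ _ "\<lambda>x. x \<in> fm.span ?B"])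
  qed
  moreover have "card ?B = card I" by (intro card_image inj_on_subset[OF inj]) auto
  ultimately show ?thesis using fm.basis_card_eq_dim[of ?B ?V] ind by simp
qed

text \<open>Extend \<open>g\<close> from \<open>V\<close> to a linear functional \<open>h\<close> on
  all matrices. Since \<open>tr (mu j i * x)\<close> is the entry of \<open>x\<close> at
  \<open>(i, j)\<close>, the matrix with entry \<open>h (mu i j)\<close> at \<open>(j, i)\<close>
  represents \<open>h\<close> on the block over \<open>I\<close>.\<close>

lemma tr_functional:
  fixes g :: "('i, 'a :: field) fmat \<Rightarrow> 'a"
  assumes V: "fm.subspace V" "V \<subseteq> corner (idm I) (idm I)" and I: "finite I"
    and g: "\<And>x y. x \<in> V \<Longrightarrow> y \<in> V \<Longrightarrow> g (x + y) = g x + g y"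
      "\<And>c x. x \<in> V \<Longrightarrow> g (sc c x) = c * g x"
  shows "\<exists>\<gamma>. \<forall>x\<in>V. g x = tr (\<gamma> * x)"
proof -
  have "\<exists>h. Vector_Spaces.linear sc (*) h \<and> (\<forall>x\<in>V. h x = g x)"
  proof -
    obtain B where B: "B \<subseteq> V" "fm.independent B" "V \<subseteq> fm.span B" by (metis fm.basis_exists)
    have VB: "fm.span B = V" using B V(1) fm.span_minimal by blast
    obtain h where h: "Vector_Spaces.linear sc (*) h" "\<forall>x\<in>B. h x = g x"
      using fmff.linear_independent_extend[OF B(2)] by blast
    have "h x = g x \<and> x \<in> V" if "x \<in> fm.span B" for x
      using that
    proof (induction rule: fm.span_induct_alt)
      case base
      have "g (sc 0 0) = 0" using g(2)[of 0 0] V(1) by (simp add: fm.subspace_0)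
      then show ?case using fmff.linear_0[OF h(1)] V(1) by (simp add: fm.subspace_0)
    next
      case (step c x y)
      then have "x \<in> V" using B by blast
      then show ?case using step h V(1)
        by (auto simp: fmff.linear_add[OF h(1)] fmff.linear_scale[OF h(1)] g fm.subspace_scale fm.subspace_add)
    qed
    with h(1) show ?thesis using VB by blast
  qed
  then obtain h where h: "Vector_Spaces.linear sc (*) h" "\<And>x. x \<in> V \<Longrightarrow> h x = g x" by blast
  define \<gamma> where "\<gamma> = (\<Sum>i\<in>I. \<Sum>j\<in>I. sc (h (mu i j)) (mu j i))"
  have "g x = tr (\<gamma> * x)" if x: "x \<in> V" for x
  proof -
    have xc: "x \<in> corner (idm I) (idm I)" using x V by blast
    have "h x = h (\<Sum>i\<in>I. \<Sum>j\<in>I. sc (ent x i j) (mu i j))" using fmat_expand[OF I I xc] by simp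
    also have "\<dots> = (\<Sum>i\<in>I. \<Sum>j\<in>I. ent x i j * h (mu i j))"
      by (simp add: fmff.linear_sum[OF h(1)] fmff.linear_scale[OF h(1)])
    also have "\<dots> = tr (\<gamma> * x)"
    proof -
      show ?thesis
        by (simp add: \<gamma>_def sum_distrib_right tr_sum tr_mu_mult mult.commute)
    qed
    finally show ?thesis using h(2)[OF x] by simp
  qed
  then show ?thesis by blast
qed

text \<open>A matrix unit compressed to \<open>f * mu j i * e\<close> still reads off the entry of
  \<open>x\<close> at \<open>(i, j)\<close>, because \<open>x\<close> absorbs \<open>e\<close> and
  \<open>f\<close> under the trace.\<close>

lemma corner_nondegenerate:
  assumes x: "x \<in> corner e f" and ef: "e * e = e" "f * f = f"
    and z: "\<And>y. y \<in> corner f e \<Longrightarrow> tr (x * y) = 0"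
  shows "x = 0"
proof (intro fmat_eqI)
  fix i j
  have "tr (x * mu j i) = tr (x * (f * mu j i * e))"
  proof -
    have "tr (x * (f * mu j i * e)) = tr ((x * f) * mu j i * e)" by (simp add: mult.assoc)
    also have "\<dots> = tr ((e * x) * mu j i)"
      unfolding cornerD[OF x] using tr_commute[of "x * mu j i" e] cornerD[OF x]
      by (simp add: mult.assoc[symmetric])
    finally show ?thesis using cornerD[OF x] by simp
  qed
  also have "\<dots> = 0" using ef
    by (intro z) (simp_all add: corner_def mult.assoc[symmetric], simp_all add: mult.assoc)
  finally have "tr (x * mu j i) = 0" .
  then show "ent x i j = ent 0 i j" by (simp add: tr_mult_mu)
qed

section \<open>Semicontinuity of stabiliser dimensions\<close>

definition polyfun :: "('a :: field \<Rightarrow> 'a) \<Rightarrow> bool" where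
  "polyfun f \<longleftrightarrow> (\<exists>p. \<forall>t. f t = poly p t)"

lemma polyfun_const [intro!]: "polyfun (\<lambda>t. c)"
  unfolding polyfun_def by (rule exI[of _ "[:c:]"]) simp

lemma polyfun_id [intro!]: "polyfun (\<lambda>t. t)"
  unfolding polyfun_def by (rule exI[of _ "[:0, 1:]"]) simp

lemma polyfun_add [intro!]: "polyfun f \<Longrightarrow> polyfun g \<Longrightarrow> polyfun (\<lambda>t. f t + g t)"
  unfolding polyfun_def by (metis poly_add)

lemma polyfun_mult [intro!]: "polyfun f \<Longrightarrow> polyfun g \<Longrightarrow> polyfun (\<lambda>t. f t * g t)"
  unfolding polyfun_def by (metis poly_mult)

lemma polyfun_diff [intro!]: "polyfun f \<Longrightarrow> polyfun g \<Longrightarrow> polyfun (\<lambda>t. f t - g t)"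
  unfolding polyfun_def by (metis poly_diff)

lemma polyfun_sum [intro!]: "(\<And>a. a \<in> A \<Longrightarrow> polyfun (f a)) \<Longrightarrow> polyfun (\<lambda>t. \<Sum>a\<in>A. f a t)"
  by (induction A rule: infinite_finite_induct) auto

lemma polyfun_prod [intro!]: "(\<And>a. a \<in> A \<Longrightarrow> polyfun (f a)) \<Longrightarrow> polyfun (\<lambda>t. \<Prod>a\<in>A. f a t)"
  by (induction A rule: infinite_finite_induct) auto

lemma polyfun_det:
  assumes "\<And>i j. i < n \<Longrightarrow> j < n \<Longrightarrow> polyfun (f i j)"
  shows "polyfun (\<lambda>t. det (mat n n (\<lambda>(i, j). f i j t)))"
proof -
  have "det (mat n n (\<lambda>(i, j). f i j t)) =
      (\<Sum>p\<in>{p. p permutes {0..<n}}. signof p * (\<Prod>i\<in>{0..<n}. f i (p i) t))" for t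
    by (subst det_def'[of _ n]) (auto intro!: sum.cong prod.cong simp: permutes_in_image)
  moreover have "polyfun (f i (p i))" if "i \<in> {0..<n}" "p permutes {0..<n}" for i p
    using assms[of i "p i"] permutes_in_image[OF that(2), of i] that by auto
  ultimately show ?thesis by auto
qed

lemma polyfun_zeros:
  assumes "polyfun f" "f t \<noteq> 0"
  shows "finite {t. f t = 0}"
proof -
  from assms(1) obtain p where p: "f t = poly p t" for t by (auto simp: polyfun_def)
  with assms(2) have "p \<noteq> 0" by auto
  then show ?thesis unfolding p by (rule poly_roots_finite)
qed

definition line :: "('i, 'a :: field) fmat \<Rightarrow> ('i, 'a) fmat \<Rightarrow> 'a \<Rightarrow> ('i, 'a) fmat" where
  "line x y t = x + sc t (y - x)"

lemma line_0 [simp]: "line x y 0 = x" and line_1 [simp]: "line x y 1 = y"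
  by (simp_all add: line_def)

lemma mat_mult_vec_index:
  "i < n \<Longrightarrow> v \<in> carrier_vec n \<Longrightarrow> (mat n n f *\<^sub>v v) $ i = (\<Sum>j<n. f (i, j) * v $ j)"
  by (auto simp: scalar_prod_def lessThan_atLeast0 intro!: sum.cong)

text \<open>
  The stabiliser of the functional \<open>x \<mapsto> tr (\<gamma> x)\<close> on \<open>A\<close> for the commutator bracket; by
  \<open>tr_functional\<close> every functional arises in this way.
\<close>
definition st :: "('i, 'a :: field) fmat set \<Rightarrow> ('i, 'a) fmat \<Rightarrow> ('i, 'a) fmat set" where
  "st A \<gamma> = {x \<in> A. \<forall>y\<in>A. tr (\<gamma> * (x * y - y * x)) = 0}"

lemma tr_bracket_add: "tr (\<gamma> * ((x + y) * z - z * (x + y))) = tr (\<gamma> * (x * z - z * x)) + tr (\<gamma> * (y * z - z * y))"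
  by (simp add: distrib_left distrib_right right_diff_distrib)

lemma tr_bracket_sc: "tr (\<gamma> * (sc c x * z - z * sc c x)) = c * tr (\<gamma> * (x * z - z * x))"
  by (simp add: right_diff_distrib)

lemma subspace_st:
  assumes "fm.subspace A"
  shows "fm.subspace (st A \<gamma>)"
  using assms
  by (intro fm.subspaceI)
     (simp_all add: st_def fm.subspace_0 fm.subspace_add fm.subspace_scale tr_bracket_add tr_bracket_sc
       del: sc_mult_left sc_mult_right)

lemma st_dim_le:
  assumes "lin \<phi>" and A: "fm.subspace A" "fin_span A'"
    and "\<And>x. x \<in> st A \<gamma> \<Longrightarrow> \<phi> x \<in> st A' \<gamma>'" "\<And>x. x \<in> st A \<gamma> \<Longrightarrow> \<phi> x = 0 \<Longrightarrow> x = 0"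
  shows "fm.dim (st A \<gamma>) \<le> fm.dim (st A' \<gamma>')"
proof (rule dim_le_of_inj[OF assms(1) subspace_st[OF A(1)]])
  show "fin_span (st A' \<gamma>')" using A(2) by (rule fin_span_subset) (auto simp: st_def)
qed (use assms in auto)

text \<open>In the semicontinuity argument \<open>B0\<close> spans the stabiliser at the base point,
  and this projection is the map shown to be injective on the other stabilisers.\<close>

lemma basis_projection:
  assumes B: "fm.independent B" "B0 \<subseteq> B"
  obtains \<pi> :: "('i, 'a :: field) fmat \<Rightarrow> ('i, 'a) fmat" where "lin \<pi>"
    "\<And>x. x \<in> fm.span B0 \<Longrightarrow> \<pi> x = x" "\<And>x. x \<in> fm.span (B - B0) \<Longrightarrow> \<pi> x = 0"
    "\<And>x. x \<in> fm.span B \<Longrightarrow> \<pi> x \<in> fm.span B0 \<and> x - \<pi> x \<in> fm.span (B - B0)"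
proof -
  obtain \<pi> where \<pi>: "lin \<pi>" "\<forall>x\<in>B. \<pi> x = (if x \<in> B0 then x else 0)"
    using fmfm.linear_independent_extend[OF B(1), of "\<lambda>x. if x \<in> B0 then x else 0"] by blast
  show ?thesis
  proof (rule that[OF \<pi>(1)])
    show "\<pi> x = x" if "x \<in> fm.span B0" for x
      by (rule fmfm.linear_eq_on[OF \<pi>(1) fm.linear_ident that]) (use \<pi>(2) B(2) in auto)
    show "\<pi> x = 0" if "x \<in> fm.span (B - B0)" for x
      by (rule fmfm.linear_eq_on[OF \<pi>(1) fmfm.linear_zero that]) (use \<pi>(2) in auto)
    show "\<pi> x \<in> fm.span B0 \<and> x - \<pi> x \<in> fm.span (B - B0)" if "x \<in> fm.span B" for x
      using that
    proof (induction rule: fm.span_induct_alt)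
      case base
      then show ?case by (simp add: fmfm.linear_0[OF \<pi>(1)] fm.span_zero)
    next
      case (step c x y)
      have "\<pi> x \<in> fm.span B0 \<and> x - \<pi> x \<in> fm.span (B - B0)"
        using step(1) \<pi>(2) by (auto intro: fm.span_base fm.span_zero)
      moreover have "\<pi> (sc c x + y) = sc c (\<pi> x) + \<pi> y"
        by (simp add: fmfm.linear_add[OF \<pi>(1)] fmfm.linear_scale[OF \<pi>(1)])
      moreover have "sc c x + y - (sc c (\<pi> x) + \<pi> y) = sc c (x - \<pi> x) + (y - \<pi> y)"
        by (simp add: algebra_simps)
      ultimately show ?case using step(2) by (metis fm.span_add fm.span_scale)
    qed
  qed
qed

text \<open>The stabiliser is the radical of the alternating form \<open>F t\<close>. On a
  complement of the radical at \<open>t = 0\<close> the form is nondegenerate, so the determinant of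
  its Gram matrix is a nonzero polynomial in \<open>t\<close>. Where it does not vanish, the radical
  at \<open>t\<close> meets the complement trivially and projects injectively to the radical at
  0.\<close>

lemma st_dim_semicontinuous:
  fixes \<gamma>0 \<gamma>1 :: "('i, 'a :: field) fmat"
  assumes A: "fm.subspace A" "fin_span A"
  shows "finite {t. fm.dim (st A \<gamma>0) < fm.dim (st A (line \<gamma>0 \<gamma>1 t))}"
proof -
  define F where "F t x y = tr (line \<gamma>0 \<gamma>1 t * (x * y - y * x))" for t x y
  define K where "K t = st A (line \<gamma>0 \<gamma>1 t)" for t
  have KA: "K t \<subseteq> A" for t by (auto simp: K_def st_def)
  have K_iff: "x \<in> K t \<longleftrightarrow> x \<in> A \<and> (\<forall>y\<in>A. F t x y = 0)" for x t
    by (auto simp: K_def st_def F_def)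
  have subK: "fm.subspace (K t)" for t unfolding K_def using A(1) by (rule subspace_st)
  have skew: "F t y x = - F t x y" for t x y
    unfolding F_def by (metis minus_diff_eq mult_minus_right tr_uminus)
  have F_add: "F t x (y + z) = F t x y + F t x z" for t x y z
    by (simp add: F_def distrib_left distrib_right right_diff_distrib)
  have F_sc: "F t x (sc c y) = c * F t x y" for t x c y
    by (simp add: F_def right_diff_distrib)
  have F_0: "F t x 0 = 0" for t x by (simp add: F_def)
  have F_sum: "F t x (sum f I) = (\<Sum>i\<in>I. F t x (f i))" for t x f and I :: "nat set"
    by (induction I rule: infinite_finite_induct) (auto simp: F_0 F_add)
  have pF: "polyfun (\<lambda>t. F t x y)" for x y
    unfolding F_def line_def by (auto simp: distrib_right)
  \<comment> \<open>\<open>B0\<close> is a basis of the radical at \<open>t = 0\<close>. It is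
    extended to a basis \<open>B\<close> of \<open>A\<close>, and \<open>B - B0\<close> spans the
    complement.\<close>
  obtain B0 where B0: "finite B0" "B0 \<subseteq> K 0" "fm.independent B0" "K 0 \<subseteq> fm.span B0"
    by (metis fin_span_basis fin_span_subset[OF A(2) KA])
  obtain B where B: "B0 \<subseteq> B" "B \<subseteq> A" "fm.independent B" "A \<subseteq> fm.span B"
    using fm.maximal_independent_subset_extend[of B0 A] B0 KA by blast
  have finB: "finite B" using independent_card_le[OF A(2) B(3) B(2)] by blast
  have spB: "fm.span B = A" using B A(1) fm.span_minimal by blast
  have spB0: "fm.span B0 = K 0" using B0 subK fm.span_minimal by blast
  obtain \<pi> where \<pi>: "lin \<pi>" "\<And>x. x \<in> K 0 \<Longrightarrow> \<pi> x = x"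
    "\<And>x. x \<in> fm.span (B - B0) \<Longrightarrow> \<pi> x = 0"
    "\<And>x. x \<in> A \<Longrightarrow> \<pi> x \<in> K 0 \<and> x - \<pi> x \<in> fm.span (B - B0)"
    using basis_projection[OF B(3,1)] unfolding spB0 spB by metis
  obtain cs where cs: "distinct cs" "set cs = B - B0" using finite_distinct_list[of "B - B0"] finB by blast
  define n where "n = length cs"
  have bij: "bij_betw (\<lambda>i. cs ! i) {..<n} (B - B0)"
    using bij_betw_nth[OF cs(1) _ cs(2)[symmetric], of "{..<n}"] by (simp add: n_def)
  define G where "G t = mat n n (\<lambda>(i, j). F t (cs ! i) (cs ! j))" for t
  have csC: "cs ! i \<in> B - B0" if "i < n" for i
    using that nth_mem[of i cs] unfolding cs(2) n_def by blast
  have csA: "cs ! i \<in> A" if "i < n" for i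
    using csC[OF that] B(2) by blast
  have Gv: "(G t *\<^sub>v v) $ i = F t (cs ! i) (\<Sum>j<n. sc (v $ j) (cs ! j))" if "i < n" "v \<in> carrier_vec n" for t v i
    unfolding G_def using that by (subst mat_mult_vec_index) (auto simp: F_sum F_sc mult.commute)
  have zero: "v = 0\<^sub>v n" if "v \<in> carrier_vec n" "(\<Sum>j<n. sc (v $ j) (cs ! j)) = 0" for v
  proof (rule eq_vecI)
    fix i assume "i < dim_vec (0\<^sub>v n :: 'a vec)"
    then have i: "i < n" by simp
    define ix where "ix = the_inv_into {..<n} (\<lambda>i. cs ! i)"
    have ix: "ix (cs ! i) = i" if "i < n" for i
      unfolding ix_def using bij that by (intro the_inv_into_f_f) (auto simp: bij_betw_def)
    have "(\<Sum>b\<in>B - B0. sc (v $ ix b) b) = (\<Sum>j<n. sc (v $ j) (cs ! j))"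
      by (subst sum.reindex_bij_betw[OF bij, symmetric]) (auto simp: ix)
    then have "v $ ix (cs ! i) = 0"
      using that(2) finB B(3) bij i
      by (intro fm.independentD[of B "B - B0" "\<lambda>b. v $ ix b"]) (auto simp: bij_betw_def)
    then show "v $ i = 0\<^sub>v n $ i" using i by (simp add: ix)
  qed (use that in auto)
  have spC: "\<exists>v\<in>carrier_vec n. x = (\<Sum>j<n. sc (v $ j) (cs ! j))" if "x \<in> fm.span (B - B0)" for x
  proof -
    from that obtain u where u: "x = (\<Sum>b\<in>B - B0. sc (u b) b)"
      using finB by (auto simp: fm.span_finite)
    have "x = (\<Sum>j<n. sc (vec n (\<lambda>j. u (cs ! j)) $ j) (cs ! j))"
      unfolding u by (subst sum.reindex_bij_betw[OF bij, symmetric]) auto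
    then show ?thesis by (intro bexI[of _ "vec n (\<lambda>j. u (cs ! j))"]) auto
  qed
  \<comment> \<open>A kernel vector gives an \<open>x\<close> in the complement that is orthogonal
    to the complement. Everything is orthogonal to the radical, so \<open>x\<close> lies in the
    radical as well and vanishes.\<close>
  have G0: "det (G 0) \<noteq> 0"
  proof
    assume "det (G 0) = 0"
    then obtain v where v: "v \<in> carrier_vec n" "v \<noteq> 0\<^sub>v n" "G 0 *\<^sub>v v = 0\<^sub>v n"
      using det_0_iff_vec_prod_zero_field[of "G 0" n] by (auto simp: G_def)
    define x where "x = (\<Sum>j<n. sc (v $ j) (cs ! j))"
    have xC: "x \<in> fm.span (B - B0)"
      unfolding x_def by (intro fm.span_sum fm.span_scale fm.span_base csC) simp
    have xA: "x \<in> A" using xC spB fm.span_mono[of "B - B0" B] by auto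
    have cx: "F 0 x c = 0" if "c \<in> B - B0" for c
    proof -
      from that cs(2) obtain i where i: "i < n" "c = cs ! i" by (metis in_set_conv_nth n_def)
      have "F 0 c x = (G 0 *\<^sub>v v) $ i" using Gv[OF i(1) v(1)] i by (simp add: x_def)
      then show ?thesis using v(3) i skew[of 0 x c] by simp
    qed
    have Fy: "F 0 x y = 0" if "y \<in> fm.span (B - B0)" for y
      using that by (induction rule: fm.span_induct_alt) (auto simp: F_0 F_add F_sc cx)
    have "F 0 x y = 0" if "y \<in> A" for y
    proof -
      have "F 0 x (\<pi> y) = 0"
        using \<pi>(4)[OF that] xA skew[of 0 x "\<pi> y"] by (auto simp: K_iff)
      moreover have "F 0 x (y - \<pi> y) = 0" using \<pi>(4)[OF that] Fy by blast
      ultimately show ?thesis using F_add[of 0 x "\<pi> y" "y - \<pi> y"] by simp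
    qed
    then have "x \<in> K 0" using xA by (simp add: K_iff)
    then have "x = 0" using \<pi>(2)[of x] \<pi>(3)[OF xC] by simp
    then show False using zero[OF v(1)] v(2) by (simp add: x_def)
  qed
  have "polyfun (\<lambda>t. det (G t))" unfolding G_def by (intro polyfun_det pF)
  then have "finite {t. det (G t) = 0}" using polyfun_zeros G0 by blast
  \<comment> \<open>If \<open>\<pi> x = 0\<close>, then \<open>x\<close> lies in the complement; its
    orthogonality to all \<open>cs ! i\<close> and the invertible Gram matrix force its coordinates
    to vanish.\<close>
  moreover have "fm.dim (K t) \<le> fm.dim (K 0)" if "det (G t) \<noteq> 0" for t
  proof (rule dim_le_of_inj[OF \<pi>(1) subK fin_span_subset[OF A(2) KA]])
    fix x assume x: "x \<in> K t"
    then have xA: "x \<in> A" using KA by blast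
    show "\<pi> x \<in> K 0" using \<pi>(4)[OF xA] by blast
    assume "\<pi> x = 0"
    then have "x \<in> fm.span (B - B0)" using \<pi>(4)[OF xA] by simp
    then obtain v where v: "v \<in> carrier_vec n" "x = (\<Sum>j<n. sc (v $ j) (cs ! j))" using spC by blast
    have "G t *\<^sub>v v = 0\<^sub>v n"
    proof (rule eq_vecI)
      fix i assume "i < dim_vec (0\<^sub>v n :: 'a vec)"
      then have i: "i < n" by simp
      then show "(G t *\<^sub>v v) $ i = 0\<^sub>v n $ i"
        using Gv[OF i v(1), of t] x csA[OF i] skew[of t x "cs ! i"] by (simp add: v(2)[symmetric] K_iff)
    qed (simp add: G_def)
    then have "v = 0\<^sub>v n"
      using det_0_iff_vec_prod_zero_field[of "G t" n] that v(1) by (auto simp: G_def)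
    then show "x = 0" using v(2) by simp
  qed
  then have "{t. fm.dim (K 0) < fm.dim (K t)} \<subseteq> {t. det (G t) = 0}" using leD by blast
  ultimately show ?thesis unfolding K_def by (auto intro: finite_subset)
qed

section \<open>Invertibility in a corner as a generic condition along lines\<close>

definition inv_in :: "('i, 'a :: field) fmat \<Rightarrow> ('i, 'a) fmat \<Rightarrow> bool" where
  "inv_in e x \<longleftrightarrow> x \<in> corner e e \<and> (\<exists>y\<in>corner e e. x * y = e \<and> y * x = e)"

definition poly_fam :: "'i set \<Rightarrow> 'i set \<Rightarrow> ('a :: field \<Rightarrow> ('i, 'a) fmat) \<Rightarrow> bool" where
  "poly_fam I J M \<longleftrightarrow> finite I \<and> finite J \<and> (\<forall>t. M t \<in> corner (idm I) (idm J)) \<and> (\<forall>i j. polyfun (\<lambda>t. ent (M t) i j))"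

lemma poly_fam_const: "finite I \<Longrightarrow> finite J \<Longrightarrow> x \<in> corner (idm I) (idm J) \<Longrightarrow> poly_fam I J (\<lambda>t. x)"
  by (auto simp: poly_fam_def)

lemma poly_fam_add:
  "poly_fam I J M \<Longrightarrow> poly_fam I J N \<Longrightarrow> poly_fam I J (\<lambda>t. M t + N t)"
  by (auto simp: poly_fam_def corner_def algebra_simps)

lemma poly_fam_mult:
  assumes "poly_fam I J M" "poly_fam J K N"
  shows "poly_fam I K (\<lambda>t. M t * N t)"
proof -
  have "ent (M t * N t) i k = (\<Sum>j\<in>J. ent (M t) i j * ent (N t) j k)" for t i k
    using assms by (intro ent_mult_over) (auto simp: poly_fam_def corner_idm_iff)
  moreover have "M t * N t \<in> corner (idm I) (idm K)" for t
    using assms by (simp add: poly_fam_def corner_def mult.assoc) (simp add: mult.assoc[symmetric])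
  ultimately show ?thesis using assms by (auto simp: poly_fam_def)
qed

lemma poly_fam_line:
  assumes "finite I" "finite J"
  shows "poly_fam I J (\<lambda>t. idm I * line x y t * idm J)"
  unfolding poly_fam_def
proof (intro conjI allI)
  fix t
  show "idm I * line x y t * idm J \<in> corner (idm I) (idm J)"
    using assms by (simp add: corner_def mult.assoc idm_mult_idm) (simp add: mult.assoc[symmetric] idm_mult_idm)
next
  fix i j
  show "polyfun (\<lambda>t. ent (idm I * line x y t * idm J) i j)"
    using assms by (cases "i \<in> I"; cases "j \<in> J") (auto simp: ent_mult_idm ent_idm_mult line_def)
qed (use assms in auto)

text \<open>Enumerating \<open>J\<close> identifies the corner with \<open>n\<close> by
  \<open>n\<close> matrices, where invertibility means a nonzero determinant. Along the family this
  determinant is a polynomial in \<open>t\<close> that is nonzero at \<open>t1\<close>.\<close>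

lemma finite_not_inv_in:
  fixes M :: "'a :: field \<Rightarrow> ('i, 'a) fmat"
  assumes M: "poly_fam J J M" and inv: "inv_in (idm J) (M t1)"
  shows "finite {t. \<not> inv_in (idm J) (M t)}"
proof -
  have J: "finite J" using M by (simp add: poly_fam_def)
  have Mc: "M t \<in> corner (idm J) (idm J)" for t using M by (simp add: poly_fam_def)
  obtain js where js: "distinct js" "set js = J" using finite_distinct_list[OF J] by blast
  define n where "n = length js"
  have bij: "bij_betw (\<lambda>i. js ! i) {..<n} J"
    using bij_betw_nth[OF js(1) _ js(2)[symmetric], of "{..<n}"] by (simp add: n_def)
  define ix where "ix = the_inv_into {..<n} (\<lambda>i. js ! i)"
  have ix: "ix (js ! i) = i" if "i < n" for i
    unfolding ix_def using bij that by (intro the_inv_into_f_f) (auto simp: bij_betw_def)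
  have ex: "\<exists>k<n. i = js ! k" if "i \<in> J" for i using that js by (metis in_set_conv_nth n_def)
  have inJ: "js ! i \<in> J" if "i < n" for i using that js by (auto simp: n_def)
  define mt where "mt x = mat n n (\<lambda>(i, j). ent x (js ! i) (js ! j))" for x :: "('i, 'a) fmat"
  have mtc: "mt x \<in> carrier_mat n n" for x by (simp add: mt_def)
  have mt_mult: "mt (x * y) = mt x * mt y" if x: "x \<in> corner (idm J) (idm J)" for x y
  proof (rule eq_matI)
    fix i j assume "i < dim_row (mt x * mt y)" "j < dim_col (mt x * mt y)"
    then have ij: "i < n" "j < n" by (auto simp: mt_def)
    have "ent (x * y) (js ! i) (js ! j) = (\<Sum>k\<in>J. ent x (js ! i) k * ent y k (js ! j))"
      using x J by (intro ent_mult_over) (auto simp: corner_idm_iff)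
    also have "\<dots> = (\<Sum>k<n. ent x (js ! i) (js ! k) * ent y (js ! k) (js ! j))"
      by (rule sum.reindex_bij_betw[OF bij, symmetric])
    finally show "mt (x * y) $$ (i, j) = (mt x * mt y) $$ (i, j)"
      using ij by (simp add: mt_def scalar_prod_def lessThan_atLeast0)
  qed (auto simp: mt_def)
  have mt_1: "mt (idm J) = 1\<^sub>m n"
    by (rule eq_matI) (auto simp: mt_def ent_idm J inJ dest: arg_cong[of _ _ ix], metis ix)
  have mt_inj: "x = y" if "x \<in> corner (idm J) (idm J)" "y \<in> corner (idm J) (idm J)" "mt x = mt y" for x y
  proof (rule fmat_eqI)
    fix i j
    show "ent x i j = ent y i j"
    proof (cases "i \<in> J \<and> j \<in> J")
      case True
      then obtain k l where "k < n" "l < n" "i = js ! k" "j = js ! l" using ex by metis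
      then show ?thesis using arg_cong[OF that(3), of "\<lambda>z. z $$ (k, l)"] by (simp add: mt_def)
    next
      case False
      then have "ent x i j = 0" "ent y i j = 0" using that(1,2) by (auto simp: corner_idm_iff J)
      then show ?thesis by simp
    qed
  qed
  have det_iff: "inv_in (idm J) x \<longleftrightarrow> det (mt x) \<noteq> 0" if x: "x \<in> corner (idm J) (idm J)" for x
  proof
    assume "inv_in (idm J) x"
    then obtain y where y: "y \<in> corner (idm J) (idm J)" "x * y = idm J" by (auto simp: inv_in_def)
    then have "mt x * mt y = 1\<^sub>m n" using mt_mult[OF x, of y] by (simp add: mt_1)
    then have "det (mt x) * det (mt y) = 1" using det_mult[OF mtc mtc, of x y] by simp
    then show "det (mt x) \<noteq> 0" by auto
  next
    assume "det (mt x) \<noteq> 0"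
    from det_non_zero_imp_unit[OF mtc this, of "()"] obtain C where
      C: "C \<in> carrier_mat n n" "mt x * C = 1\<^sub>m n" "C * mt x = 1\<^sub>m n"
      unfolding Units_def ring_mat_def by auto
    define y :: "('i, 'a) fmat" where "y = Fmat (\<lambda>i j. if i \<in> J \<and> j \<in> J then C $$ (ix i, ix j) else 0)"
    have ey: "ent y i j = (if i \<in> J \<and> j \<in> J then C $$ (ix i, ix j) else 0)" for i j
      unfolding y_def by (subst ent_Fmat[OF J]) (auto split: if_splits)
    have yc: "y \<in> corner (idm J) (idm J)" using J by (auto simp: corner_idm_iff ey split: if_splits)
    have mty: "mt y = C" using C(1) by (intro eq_matI) (auto simp: mt_def ey inJ ix)
    have cc: "u * v \<in> corner (idm J) (idm J)" if "u \<in> corner (idm J) (idm J)" "v \<in> corner (idm J) (idm J)"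
      for u v :: "('i, 'a) fmat"
      using that unfolding corner_def by (simp add: mult.assoc) (simp add: mult.assoc[symmetric])
    have c1: "idm J \<in> corner (idm J) (idm J)" using J by (simp add: corner_def idm_mult_idm)
    have "x * y = idm J" using mt_mult[OF x, of y] C mty
      by (intro mt_inj cc x yc c1) (simp add: mt_1)
    moreover have "y * x = idm J" using mt_mult[OF yc, of x] C mty
      by (intro mt_inj cc x yc c1) (simp add: mt_1)
    ultimately show "inv_in (idm J) x" using x yc by (auto simp: inv_in_def)
  qed
  have "polyfun (\<lambda>t. det (mt (M t)))"
    unfolding mt_def using M by (intro polyfun_det) (simp add: poly_fam_def)
  moreover have "det (mt (M t1)) \<noteq> 0" using det_iff[OF Mc] inv by blast
  ultimately have "finite {t. det (mt (M t)) = 0}" by (rule polyfun_zeros)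
  then show ?thesis using det_iff[OF Mc] by simp
qed

text \<open>Join \<open>\<gamma>0\<close> to the generic point \<open>\<gamma>1\<close>. All but
  finitely many points of the line are generic and have a stabiliser no larger than that of
  \<open>\<gamma>0\<close>. In characteristic 0 the field is infinite, so such a point exists, and
  the bound \<open>k\<close> found there passes to \<open>\<gamma>0\<close>.\<close>

lemma st_dim_ge_generic:
  fixes A :: "('i, 'a :: field_char_0) fmat set"
  assumes A: "fm.subspace A" "fin_span A"
    and M: "\<And>\<gamma>0. poly_fam J J (\<lambda>t. M (line \<gamma>0 \<gamma>1 t))" and inv: "inv_in (idm J) (M \<gamma>1)"
    and le: "\<And>\<gamma>. inv_in (idm J) (M \<gamma>) \<Longrightarrow> k \<le> fm.dim (st A \<gamma>)"
  shows "k \<le> fm.dim (st A \<gamma>0)"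
proof -
  have "finite ({t. fm.dim (st A \<gamma>0) < fm.dim (st A (line \<gamma>0 \<gamma>1 t))} \<union> {t. \<not> inv_in (idm J) (M (line \<gamma>0 \<gamma>1 t))})"
    using st_dim_semicontinuous[OF A] finite_not_inv_in[OF M, of \<gamma>0 1] inv by auto
  from ex_new_if_finite[OF infinite_UNIV_char_0 this] show ?thesis
    using le by (auto simp: not_less intro: le_trans)
qed

section \<open>Triangular algebras and reduction steps\<close>

text \<open>When products are nested to the right, a relation \<open>x * y = z\<close> no longer
  matches inside a longer word, but this form of it does. Block computations use a relation together
  with this companion.\<close>

lemma mult_assoc_eq: "x * y = z \<Longrightarrow> x * (y * w) = z * w" for x :: "'a :: semigroup_mult"
  by (simp add: mult.assoc[symmetric])

lemma corner_absorb:
  assumes "x \<in> corner e f"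
  shows "e * x = x" "x * f = x" "e * (x * y) = x * y" "x * (f * y) = x * y"
  using assms by (simp_all add: corner_def mult_assoc_eq)

lemma corner_mult: "x \<in> corner a b \<Longrightarrow> y \<in> corner b c \<Longrightarrow> x * y \<in> corner a c"
  unfolding corner_def by (simp add: mult.assoc) (simp add: mult.assoc[symmetric])

lemma corner_add: "x \<in> corner a b \<Longrightarrow> y \<in> corner a b \<Longrightarrow> x + y \<in> corner a b"
  by (simp add: corner_def distrib_left distrib_right)

lemma corner_diff: "x \<in> corner a b \<Longrightarrow> y \<in> corner a b \<Longrightarrow> x - y \<in> corner a b"
  by (simp add: corner_def left_diff_distrib right_diff_distrib)

lemma corner_uminus: "x \<in> corner a b \<Longrightarrow> - x \<in> corner a b"
  by (simp add: corner_def)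

lemma corner_0: "0 \<in> corner a b"
  by (simp add: corner_def)

lemma corner_cut: "a * a = a \<Longrightarrow> b * b = b \<Longrightarrow> a * x * b \<in> corner a b"
  by (simp add: corner_def mult.assoc) (simp add: mult.assoc[symmetric])

lemma corner_mult_0:
  assumes "x \<in> corner a b" "y \<in> corner c d" "b * c = 0"
  shows "x * y = 0"
proof -
  have "x * y = x * (b * c) * y" using assms(1,2) by (simp add: corner_def mult.assoc mult_assoc_eq)
  then show ?thesis using assms(3) by simp
qed

text \<open>On \<open>corner a b\<close> a functional is felt only through its block
  \<open>b * \<gamma> * a\<close>; this is how a functional gets its components.\<close>

lemma tr_corner: "z \<in> corner a b \<Longrightarrow> tr (\<gamma> * z) = tr (b * \<gamma> * a * z)"
  using tr_commute[of "\<gamma> * z" b] by (simp add: corner_def mult.assoc)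

text \<open>For orthogonal idempotents \<open>e\<close> and \<open>f\<close>: the block matrices \<open>[[A, u], [0, B]]\<close> with \<open>A \<in> S\<close>.\<close>
definition tri :: "('i, 'a :: field) fmat set \<Rightarrow> ('i, 'a) fmat \<Rightarrow> ('i, 'a) fmat \<Rightarrow> ('i, 'a) fmat set" where
  "tri S e f = {A + u + B | A u B. A \<in> S \<and> u \<in> corner e f \<and> B \<in> corner f f}"

locale triangular =
  fixes S :: "('i, 'a :: field) fmat set" and e f :: "('i, 'a) fmat"
  assumes ee: "e * e = e" and ff: "f * f = f" and ef: "e * f = 0" and fe: "f * e = 0"
    and S_sub: "fm.subspace S" and S_corner: "S \<subseteq> corner e e"
begin

lemma triE:
  assumes "x \<in> tri S e f"
  obtains A u B where "x = A + u + B" "A \<in> S" "A \<in> corner e e" "u \<in> corner e f" "B \<in> corner f f"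
  using assms S_corner by (auto simp: tri_def)

lemma components:
  assumes "A \<in> corner e e" "u \<in> corner e f" "p \<in> corner f e" "B \<in> corner f f"
  shows "e * (A + u + B) * e = A" "e * (A + u + B) * f = u" "f * (A + u + B) * f = B"
    "e * (A + p + B) * e = A" "f * (A + p + B) * e = p" "f * (A + p + B) * f = B"
proof -
  have [simp]: "A * f = 0" "u * e = 0" "p * f = 0" "B * e = 0" "f * A = 0" "f * u = 0" "e * p = 0" "e * B = 0"
    using assms ee ff ef fe by (auto intro: corner_mult_0 simp: corner_def)
  show "e * (A + u + B) * e = A" "e * (A + u + B) * f = u" "f * (A + u + B) * f = B"
    "e * (A + p + B) * e = A" "f * (A + p + B) * e = p" "f * (A + p + B) * f = B"
    using assms by (simp_all add: distrib_left distrib_right cornerD)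
qed

lemma subspace_tri: "fm.subspace (tri S e f)"
proof (rule fm.subspaceI)
  show "0 \<in> tri S e f"
    using fm.subspace_0[OF S_sub] corner_0[of e f] corner_0[of f f] by (force simp: tri_def)
next
  fix x y assume "x \<in> tri S e f" "y \<in> tri S e f"
  then obtain A u B A' u' B' where "x = A + u + B" "A \<in> S" "u \<in> corner e f" "B \<in> corner f f"
    "y = A' + u' + B'" "A' \<in> S" "u' \<in> corner e f" "B' \<in> corner f f"
    by (auto simp: tri_def)
  then show "x + y \<in> tri S e f"
    using fm.subspace_add[OF S_sub] corner_add unfolding tri_def
    by (intro CollectI exI[of _ "A + A'"] exI[of _ "u + u'"] exI[of _ "B + B'"]) (auto simp: algebra_simps)
next
  fix c x assume "x \<in> tri S e f"
  then obtain A u B where "x = A + u + B" "A \<in> S" "u \<in> corner e f" "B \<in> corner f f"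
    by (auto simp: tri_def)
  then show "sc c x \<in> tri S e f"
    using fm.subspace_scale[OF S_sub] fm.subspace_scale[OF subspace_corner] unfolding tri_def
    by (intro CollectI exI[of _ "sc c A"] exI[of _ "sc c u"] exI[of _ "sc c B"]) (auto simp: fm.scale_right_distrib)
qed

lemma tri_subset: "tri S e f \<subseteq> corner (e + f) (e + f)"
proof
  fix x assume "x \<in> tri S e f"
  then obtain A u B where x: "x = A + u + B" "A \<in> corner e e" "u \<in> corner e f" "B \<in> corner f f"
    by (rule triE)
  have "f * A = 0" "f * u = 0" "e * B = 0" "A * f = 0" "u * e = 0" "B * e = 0"
    using x ee ff ef fe by (auto intro: corner_mult_0 simp: corner_def)
  then show "x \<in> corner (e + f) (e + f)"
    using x(2-4) by (simp add: x(1) corner_def distrib_left distrib_right)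
qed

text \<open>Cyclicity of the trace turns the condition into independent pairings with the test
  blocks \<open>A'\<close>, \<open>u'\<close> and \<open>B'\<close>. The blocks \<open>u'\<close>
  and \<open>B'\<close> run through full corners, where nondegeneracy yields equations;
  \<open>A'\<close> runs through \<open>S\<close> only, so there a trace condition remains.\<close>

lemma st_tri_iff:
  assumes A: "A \<in> S" and u: "u \<in> corner e f" and B: "B \<in> corner f f"
    and \<alpha>: "e * \<gamma> * e = \<alpha>" and p: "f * \<gamma> * e = p" and \<beta>: "f * \<gamma> * f = \<beta>"
  shows "A + u + B \<in> st (tri S e f) \<gamma> \<longleftrightarrow>
    p * A = B * p \<and> \<beta> * B - B * \<beta> + p * u = 0 \<and> (\<forall>A'\<in>S. tr ((\<alpha> * A - A * \<alpha> - u * p) * A') = 0)"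
proof -
  have A': "A \<in> corner e e" using A S_corner by blast
  have pc: "p \<in> corner f e" and \<beta>c: "\<beta> \<in> corner f f"
    unfolding p[symmetric] \<beta>[symmetric] by (auto intro: corner_cut ee ff)
  have form: "tr (\<gamma> * ((A + u + B) * (A' + u' + B') - (A' + u' + B') * (A + u + B))) =
      tr ((\<alpha> * A - A * \<alpha> - u * p) * A') + tr ((p * A - B * p) * u') + tr ((\<beta> * B - B * \<beta> + p * u) * B')"
    if y: "A' \<in> corner e e" "u' \<in> corner e f" "B' \<in> corner f f" for A' u' B'
  proof -
    have z: "A * B' = 0" "u * A' = 0" "u * u' = 0" "B * A' = 0" "B * u' = 0"
      "A' * B = 0" "u' * A = 0" "u' * u = 0" "B' * A = 0" "B' * u = 0"
      using y A' u B ef fe by (auto intro: corner_mult_0)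
    have br: "(A + u + B) * (A' + u' + B') - (A' + u' + B') * (A + u + B) =
        (A * A' - A' * A) + (A * u' + u * B' - A' * u - u' * B) + (B * B' - B' * B)"
      by (simp add: distrib_left distrib_right z)
    have 1: "tr (\<gamma> * (A * A' - A' * A)) = tr (\<alpha> * (A * A' - A' * A))"
      using y A' unfolding \<alpha>[symmetric] by (intro tr_corner corner_diff corner_mult)
    have 2: "tr (\<gamma> * (A * u' + u * B' - A' * u - u' * B)) = tr (p * (A * u' + u * B' - A' * u - u' * B))"
      unfolding p[symmetric] by (intro tr_corner corner_diff corner_add) (use y A' u B in \<open>auto intro: corner_mult\<close>)
    have 3: "tr (\<gamma> * (B * B' - B' * B)) = tr (\<beta> * (B * B' - B' * B))"
      using y B unfolding \<beta>[symmetric] by (intro tr_corner corner_diff corner_mult)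
    have rot: "tr (\<alpha> * (A' * A)) = tr (A * (\<alpha> * A'))" "tr (\<beta> * (B' * B)) = tr (B * (\<beta> * B'))"
      "tr (p * (A' * u)) = tr (u * (p * A'))" "tr (p * (u' * B)) = tr (B * (p * u'))"
      by (metis mult.assoc tr_commute)+
    show ?thesis
      unfolding br distrib_left[of \<gamma>] tr_add 1 2 3 by (simp add: rot algebra_simps)
  qed
  have S0: "0 \<in> S" by (rule fm.subspace_0[OF S_sub])
  have inA: "A + u + B \<in> tri S e f" using A u B by (auto simp: tri_def)
  show ?thesis
  proof
    assume l: "A + u + B \<in> st (tri S e f) \<gamma>"
    have l': "tr ((\<alpha> * A - A * \<alpha> - u * p) * A') + tr ((p * A - B * p) * u') + tr ((\<beta> * B - B * \<beta> + p * u) * B') = 0"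
      if y: "A' \<in> S" "u' \<in> corner e f" "B' \<in> corner f f" for A' u' B'
    proof -
      have "A' + u' + B' \<in> tri S e f" using y by (auto simp: tri_def)
      then have "tr (\<gamma> * ((A + u + B) * (A' + u' + B') - (A' + u' + B') * (A + u + B))) = 0"
        using l by (simp add: st_def)
      then show ?thesis using form[of A' u' B'] y S_corner by auto
    qed
    have "p * A - B * p = 0"
      using l'[OF S0 _ corner_0]
      by (intro corner_nondegenerate[of _ f e, OF _ ff ee] corner_diff) (use pc A' B in \<open>auto intro: corner_mult\<close>)
    moreover have "\<beta> * B - B * \<beta> + p * u = 0"
      using l'[OF S0 corner_0]
      by (intro corner_nondegenerate[of _ f f, OF _ ff ff] corner_diff corner_add)
         (use pc u \<beta>c B in \<open>auto intro: corner_mult\<close>)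
    moreover have "\<forall>A'\<in>S. tr ((\<alpha> * A - A * \<alpha> - u * p) * A') = 0"
      using l'[OF _ corner_0 corner_0] by simp
    ultimately show "p * A = B * p \<and> \<beta> * B - B * \<beta> + p * u = 0 \<and> (\<forall>A'\<in>S. tr ((\<alpha> * A - A * \<alpha> - u * p) * A') = 0)"
      by simp
  next
    assume r: "p * A = B * p \<and> \<beta> * B - B * \<beta> + p * u = 0 \<and> (\<forall>A'\<in>S. tr ((\<alpha> * A - A * \<alpha> - u * p) * A') = 0)"
    have "tr (\<gamma> * ((A + u + B) * y - y * (A + u + B))) = 0" if y: "y \<in> tri S e f" for y
    proof -
      from y obtain A' u' B' where y': "y = A' + u' + B'" "A' \<in> S" "A' \<in> corner e e" "u' \<in> corner e f" "B' \<in> corner f f"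
        by (rule triE)
      have "p * A - B * p = 0" using r by simp
      then show ?thesis using form[OF y'(3-5)] r y'(2) unfolding y'(1) by simp
    qed
    then show "A + u + B \<in> st (tri S e f) \<gamma>" using inA by (simp add: st_def)
  qed
qed

lemma st_triE:
  assumes "x \<in> st (tri S e f) \<gamma>"
  obtains A u B where "x = A + u + B" "A \<in> S" "A \<in> corner e e" "u \<in> corner e f" "B \<in> corner f f"
  using triE[of x] assms that by (auto simp: st_def)

end

text \<open>Comparison maps between stabilisers are written as sums of terms
  \<open>a * x * b\<close>, even where the blocks of \<open>x\<close> already have names, so that
  their linearity reduces to this rule and \<open>lin_add\<close>.\<close>

lemma linear_sandwich [intro]: "lin (\<lambda>x. a * x * b)"
  by (rule linI) (simp_all add: distrib_left distrib_right)

lemma lin_add: "lin f \<Longrightarrow> lin g \<Longrightarrow> lin (\<lambda>x. f x + g x)"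
  by (rule fmfm.linear_compose_add)

text \<open>
  If \<open>p\<close> has a left inverse \<open>r\<close> and cokernel \<open>k\<close>, then \<open>p A = B p\<close> determines \<open>B\<close> on the image of \<open>p\<close> and
  \<open>[\<beta>, B] + p u = 0\<close> determines \<open>u\<close>. What remains are \<open>A\<close>, \<open>r B h\<close> and \<open>k B h\<close>, subject to the stabiliser
  equations of the functional with components \<open>\<alpha> + r \<beta> p\<close>, \<open>k \<beta> p\<close>, \<open>k \<beta> h\<close>.
\<close>
lemma st_embedding_injective:
  assumes T1: "triangular S e f" and T2: "triangular S e f'"
    and fin: "fin_span (tri S e f)" "fin_span (tri S e f')"
    and pc: "p \<in> corner f e" and rc: "r \<in> corner e f" and hc: "h \<in> corner f f'" and kc: "k \<in> corner f' f"
    and rp: "r * p = e" and kh: "k * h = f'" and kp: "k * p = 0" and rh: "r * h = 0" and prhk: "p * r + h * k = f"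
    and comp: "e * \<gamma> * e = \<alpha>" "f * \<gamma> * e = p" "f * \<gamma> * f = \<beta>"
    and comp': "e * \<gamma>' * e = \<alpha> + r * \<beta> * p" "f' * \<gamma>' * e = k * \<beta> * p" "f' * \<gamma>' * f' = k * \<beta> * h"
  shows "fm.dim (st (tri S e f) \<gamma>) = fm.dim (st (tri S e f') \<gamma>')"
proof (rule antisym)
  interpret T1: triangular S e f by (rule T1)
  interpret T2: triangular S e f' by (rule T2)
  have \<beta>c: "\<beta> \<in> corner f f" and \<alpha>c: "\<alpha> \<in> corner e e"
    unfolding comp[symmetric] by (auto intro: corner_cut T1.ee T1.ff)
  note basic = mult_assoc_eq[OF rp] mult_assoc_eq[OF kh] mult_assoc_eq[OF kp] mult_assoc_eq[OF rh] rp kh kp rh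
  have hk: "h * k = f - p * r" using prhk by (simp add: algebra_simps)
  define p' where "p' = k * \<beta> * p"
  define \<beta>' where "\<beta>' = k * \<beta> * h"
  define \<alpha>' where "\<alpha>' = \<alpha> + r * \<beta> * p"
  \<comment> \<open>Inserting \<open>p * r + h * k = f\<close> to the right of
    \<open>\<beta>\<close> shows \<open>p'\<close> and \<open>\<beta>'\<close> as the two blocks of
    \<open>k * \<beta>\<close>, along the image of \<open>p\<close> and along
    \<open>h\<close>.\<close>
  have kb: "k * \<beta> = p' * r + \<beta>' * k"
  proof -
    have "k * \<beta> = k * \<beta> * (p * r + h * k)" using corner_absorb[OF \<beta>c] by (simp add: prhk mult.assoc)
    also have "\<dots> = p' * r + \<beta>' * k" by (simp add: p'_def \<beta>'_def distrib_left mult.assoc)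
    finally show ?thesis .
  qed
  \<comment> \<open>\<open>B\<close> is rebuilt from its forced action on the image of
    \<open>p\<close> and the free blocks \<open>v\<close> and \<open>D\<close>. What
    \<open>k\<close> sees of \<open>[\<beta>, B]\<close> is made of the first two equations for
    \<open>A + v + D\<close>; what \<open>r\<close> sees of it turns \<open>\<alpha>\<close> into
    \<open>\<alpha>'\<close>.\<close>
  have key: "k * (\<beta> * B - B * \<beta>) = (p' * A - D * p') * r + (\<beta>' * D - D * \<beta>' + p' * v) * k"
      "\<alpha> * A - A * \<alpha> - r * (B * \<beta> - \<beta> * B) * p = \<alpha>' * A - A * \<alpha>' - v * p'" "p * A = B * p"
    if A: "A \<in> corner e e" and D: "D \<in> corner f' f'" and v: "v \<in> corner e f'"
      and B: "B = p * A * r + p * v * k + h * D * k" for A B D v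
  proof -
    have kB: "k * B = D * k"
      using corner_absorb[OF D] by (simp add: B distrib_left mult.assoc basic)
    have rB: "r * B = A * r + v * k"
      using corner_absorb[OF A] corner_absorb[OF v] by (simp add: B distrib_left mult.assoc basic)
    show Bp: "p * A = B * p"
      using corner_absorb[OF A] by (simp add: B distrib_right mult.assoc basic)
    have "k * (\<beta> * B - B * \<beta>) = (k * \<beta>) * B - (k * B) * \<beta>" by (simp add: algebra_simps)
    also have "\<dots> = p' * (r * B) + \<beta>' * (k * B) - D * (k * \<beta>)"
      by (simp only: kb kB distrib_left distrib_right mult.assoc)
    also have "\<dots> = (p' * A - D * p') * r + (\<beta>' * D - D * \<beta>' + p' * v) * k"
      by (simp add: kB rB kb algebra_simps)
    finally show "k * (\<beta> * B - B * \<beta>) = (p' * A - D * p') * r + (\<beta>' * D - D * \<beta>' + p' * v) * k" .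
    have "r * (B * \<beta> - \<beta> * B) * p = (r * B) * \<beta> * p - r * \<beta> * (B * p)" by (simp add: algebra_simps)
    also have "\<dots> = A * r * \<beta> * p + v * p' - r * \<beta> * p * A"
      by (simp add: rB Bp[symmetric] p'_def algebra_simps)
    finally show "\<alpha> * A - A * \<alpha> - r * (B * \<beta> - \<beta> * B) * p = \<alpha>' * A - A * \<alpha>' - v * p'"
      by (simp add: \<alpha>'_def algebra_simps)
  qed
  note comp'' = comp'[folded p'_def \<beta>'_def \<alpha>'_def]
  have p'c: "p' \<in> corner f' e" unfolding p'_def by (rule corner_mult[OF corner_mult[OF kc \<beta>c] pc])
  have \<beta>'c: "\<beta>' \<in> corner f' f'" unfolding \<beta>'_def by (rule corner_mult[OF corner_mult[OF kc \<beta>c] hc])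
  show "fm.dim (st (tri S e f) \<gamma>) \<le> fm.dim (st (tri S e f') \<gamma>')"
  proof (rule st_dim_le[of "\<lambda>x. e * x * e + r * x * h + k * x * h", OF _ T1.subspace_tri fin(2)])
    show "lin (\<lambda>x. e * x * e + r * x * h + k * x * h)" by (intro lin_add linear_sandwich)
    fix x assume x: "x \<in> st (tri S e f) \<gamma>"
    then obtain A u B where xe: "x = A + u + B" and A: "A \<in> S" "A \<in> corner e e" and u: "u \<in> corner e f" and B: "B \<in> corner f f"
      by (rule T1.st_triE)
    have eqs: "p * A = B * p" "\<beta> * B - B * \<beta> + p * u = 0" "\<forall>A'\<in>S. tr ((\<alpha> * A - A * \<alpha> - u * p) * A') = 0"
      using T1.st_tri_iff[OF A(1) u B comp] x by (auto simp: xe)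
    have z: "A * h = 0" "r * A = 0" "r * u = 0" "k * A = 0" "k * u = 0"
      using A u rc hc kc T1.ef T1.fe by (auto intro: corner_mult_0)
    have exe: "e * x * e = A" using T1.components(1)[OF A(2) u corner_0 B] xe by simp
    have \<phi>: "e * x * e + r * x * h + k * x * h = A + r * B * h + k * B * h"
      unfolding exe by (simp add: xe distrib_left distrib_right z)
    have B': "B = p * A * r + p * (r * B * h) * k + h * (k * B * h) * k"
    proof -
      have "B = B * (p * r + h * k)" unfolding prhk using corner_absorb[OF B] by simp
      also have "\<dots> = (B * p) * r + (f * B) * h * k" by (simp add: corner_absorb[OF B] distrib_left mult.assoc)
      also have "\<dots> = p * A * r + (p * r + h * k) * B * h * k" by (simp only: eqs(1)[symmetric] prhk)
      finally show ?thesis by (simp add: algebra_simps)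
    qed
    have vc: "r * B * h \<in> corner e f'" and Dc: "k * B * h \<in> corner f' f'"
      by (rule corner_mult[OF corner_mult[OF rc B] hc], rule corner_mult[OF corner_mult[OF kc B] hc])
    note K = key[OF A(2) Dc vc B']
    \<comment> \<open>The left inverse \<open>r\<close> of \<open>p\<close> solves the second
      equation for \<open>u\<close>.\<close>
    have ru: "u = r * (B * \<beta> - \<beta> * B)"
    proof -
      have "u = r * (p * u)" using u by (simp add: basic corner_absorb)
      also have "p * u = B * \<beta> - \<beta> * B" using eqs(2) by (simp add: algebra_simps eq_neg_iff_add_eq_0)
      finally show ?thesis .
    qed
    have "k * (\<beta> * B - B * \<beta>) = k * (\<beta> * B - B * \<beta> + p * u)" by (simp add: algebra_simps basic)
    then have "k * (\<beta> * B - B * \<beta>) = 0" using eqs(2) by simp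
    then have K0: "(p' * A - k * B * h * p') * r + (\<beta>' * (k * B * h) - k * B * h * \<beta>' + p' * (r * B * h)) * k = 0"
      using K(1) by simp
    let ?a = "p' * A - k * B * h * p'" and ?b = "\<beta>' * (k * B * h) - k * B * h * \<beta>' + p' * (r * B * h)"
    \<comment> \<open>Right multiplication by \<open>p\<close>, and below by \<open>h\<close>,
      isolates the coefficients of \<open>r\<close> and \<open>k\<close>, since
      \<open>r * p = e\<close> and \<open>k * h = f'\<close> while the mixed products
      vanish.\<close>
    have "(?a * r + ?b * k) * p = ?a * e"
      by (simp only: distrib_right mult.assoc basic) simp
    then have "?a * e = 0" using K0 by simp
    then have a: "p' * A = k * B * h * p'" using A(2) p'c by (simp add: left_diff_distrib mult.assoc corner_absorb)
    have "(?a * r + ?b * k) * h = ?b * f'"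
      by (simp only: distrib_right mult.assoc basic) simp
    then have "?b * f' = 0" using K0 by simp
    then have b: "?b = 0" using \<beta>'c Dc vc by (simp add: left_diff_distrib distrib_right mult.assoc corner_absorb[OF hc] corner_absorb[OF \<beta>'c])
    show "e * x * e + r * x * h + k * x * h \<in> st (tri S e f') \<gamma>'"
      unfolding \<phi> using a b eqs(3) K(2)
      by (subst T2.st_tri_iff[OF A(1) vc Dc comp'']) (simp add: ru[symmetric])
    assume "e * x * e + r * x * h + k * x * h = 0"
    then have "A + r * B * h + k * B * h = 0" unfolding \<phi> .
    then have "A = 0" "r * B * h = 0" "k * B * h = 0"
      using T2.components[OF A(2) vc corner_0 Dc] by auto
    then have "B = 0" using B' by (simp add: mult.assoc)
    then show "x = 0" using ru \<open>A = 0\<close> xe by simp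
  qed
  show "fm.dim (st (tri S e f') \<gamma>') \<le> fm.dim (st (tri S e f) \<gamma>)"
  proof -
    \<comment> \<open>The opposite map: \<open>\<phi>B\<close> assembles \<open>B\<close> from the
      blocks \<open>A\<close>, \<open>v\<close>, \<open>D\<close> of \<open>x\<close>, and
      \<open>\<phi>\<close> adds \<open>A\<close> and the forced block
      \<open>u = r * (B * \<beta> - \<beta> * B)\<close>.\<close>
    define \<phi>B where "\<phi>B x = (p * e) * x * (e * r) + (p * e) * x * (f' * k) + (h * f') * x * (f' * k)" for x
    define \<phi> where "\<phi> x = e * x * e + r * \<phi>B x * \<beta> + (- (r * \<beta>)) * \<phi>B x * f + f * \<phi>B x * f" for x
    have linB: "lin \<phi>B" unfolding \<phi>B_def by (intro lin_add linear_sandwich)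
    have lin: "lin \<phi>" unfolding \<phi>_def
      by (intro lin_add linear_sandwich)
         (auto intro!: linear_sandwich linI simp: fmfm.linear_add[OF linB] fmfm.linear_scale[OF linB] algebra_simps)
    show ?thesis
    proof (rule st_dim_le[OF lin T2.subspace_tri fin(1)])
      fix x assume x: "x \<in> st (tri S e f') \<gamma>'"
      then obtain A v D where xe: "x = A + v + D" and A: "A \<in> S" "A \<in> corner e e" and v: "v \<in> corner e f'" and D: "D \<in> corner f' f'"
        by (rule T2.st_triE)
      have eqs: "p' * A = D * p'" "\<beta>' * D - D * \<beta>' + p' * v = 0" "\<forall>A'\<in>S. tr ((\<alpha>' * A - A * \<alpha>' - v * p') * A') = 0"
        using T2.st_tri_iff[OF A(1) v D comp''] x by (auto simp: xe)
      define B where "B = p * A * r + p * v * k + h * D * k"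
      have Bc: "B \<in> corner f f"
        unfolding B_def
        by (intro corner_add corner_mult[OF corner_mult[OF pc A(2)] rc] corner_mult[OF corner_mult[OF pc v] kc]
            corner_mult[OF corner_mult[OF hc D] kc])
      note K = key[OF A(2) D v B_def]
      have comps: "e * x * e = A" "e * x * f' = v" "f' * x * f' = D"
        using T2.components[OF A(2) v corner_0 D] by (simp_all add: xe)
      have "\<phi>B x = p * (e * x * e) * r + p * (e * x * f') * k + h * (f' * x * f') * k"
        by (simp add: \<phi>B_def mult.assoc)
      then have \<phi>B: "\<phi>B x = B" by (simp add: comps B_def)
      define u where "u = r * (B * \<beta> - \<beta> * B)"
      have uc: "u \<in> corner e f" unfolding u_def by (intro corner_mult[OF rc] corner_diff corner_mult[OF Bc \<beta>c] corner_mult[OF \<beta>c Bc])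
      have \<phi>: "\<phi> x = A + u + B"
        using Bc unfolding \<phi>_def \<phi>B comps u_def
        by (simp add: corner_absorb mult.assoc right_diff_distrib)
      \<comment> \<open>As \<open>p * r\<close> is \<open>f - h * k\<close> and not
        \<open>f\<close>, the second equation could fail by a multiple of \<open>h * k\<close>. The
        equations of the smaller stabiliser say that this error is zero.\<close>
      have "p * u = (f - h * k) * (B * \<beta> - \<beta> * B)"
        by (simp add: u_def hk mult.assoc[symmetric])
      also have "\<dots> = B * \<beta> - \<beta> * B + h * (k * (\<beta> * B - B * \<beta>))"
        using corner_absorb[OF Bc] corner_absorb[OF \<beta>c] by (simp add: algebra_simps)
      also have "k * (\<beta> * B - B * \<beta>) = 0" using K(1) eqs(1,2) by simp
      finally have pu: "\<beta> * B - B * \<beta> + p * u = 0" by simp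
      show "\<phi> x \<in> st (tri S e f) \<gamma>"
        unfolding \<phi> using K eqs(3) pu
        by (subst T1.st_tri_iff[OF A(1) uc Bc comp]) (simp add: u_def)
      assume "\<phi> x = 0"
      then have 0: "A = 0" "B = 0" using T1.components[OF A(2) uc corner_0 Bc] unfolding \<phi> by auto
      have "r * B = A * r + v * k" "k * B = D * k"
        using corner_absorb[OF A(2)] corner_absorb[OF v] corner_absorb[OF D]
        by (simp_all add: B_def distrib_left mult.assoc basic)
      then have "v * k = 0" "D * k = 0" using 0 by auto
      then have "v * (k * h) = 0" "D * (k * h) = 0" by (simp_all add: mult.assoc[symmetric])
      then show "x = 0" using v D 0 by (simp add: xe kh corner_absorb)
    qed
  qed
qed

text \<open>
  For surjective \<open>p\<close> with kernel \<open>n\<close>, the equation \<open>p A = B p\<close> says that \<open>A\<close> preserves the kernel, equivalently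
  that the transpose \<open>\<sigma> A\<close> preserves its annihilator, which is the kernel of \<open>\<sigma> n\<close>, of complementary size.
\<close>
lemma st_dual_embedding:
  fixes \<sigma> :: "('i, 'a :: field) fmat \<Rightarrow> ('i, 'a) fmat"
  assumes T1: "triangular S e f" and T2: "triangular S e g"
    and fin: "fin_span (tri S e f)"
    and \<sigma>: "lin \<sigma>" "\<And>x y. \<sigma> (x * y) = \<sigma> y * \<sigma> x" "\<And>x. \<sigma> (\<sigma> x) = x" "\<And>x. tr (\<sigma> x) = tr x"
      "\<sigma> e = e" "\<sigma> g = g" "\<And>x. x \<in> S \<Longrightarrow> \<sigma> x \<in> S"
    and pc: "p \<in> corner f e" and sc: "s \<in> corner e f" and nc: "n \<in> corner e g" and rc: "r \<in> corner g e"
    and ps: "p * s = f" and pn: "p * n = 0" and rn: "r * n = g" and rs: "r * s = 0" and spnr: "s * p + n * r = e"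
    and comp: "e * \<gamma> * e = \<alpha>" "f * \<gamma> * e = p" "f * \<gamma> * f = \<beta>"
    and comp': "e * \<gamma>' * e = - \<sigma> (\<alpha> + s * \<beta> * p)" "g * \<gamma>' * e = \<sigma> n" "g * \<gamma>' * g = 0"
  shows "fm.dim (st (tri S e g) \<gamma>') \<le> fm.dim (st (tri S e f) \<gamma>)"
proof -
  interpret T1: triangular S e f by (rule T1)
  interpret T2: triangular S e g by (rule T2)
  have \<beta>c: "\<beta> \<in> corner f f" and \<alpha>c: "\<alpha> \<in> corner e e"
    unfolding comp[symmetric] by (auto intro: corner_cut T1.ee T1.ff)
  note basic = mult_assoc_eq[OF ps] mult_assoc_eq[OF pn] mult_assoc_eq[OF rn] mult_assoc_eq[OF rs] ps pn rn rs
  have \<sigma>_add: "\<sigma> (x + y) = \<sigma> x + \<sigma> y" and \<sigma>_sc: "\<sigma> (sc c x) = sc c (\<sigma> x)" and \<sigma>_0: "\<sigma> 0 = 0"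
    and \<sigma>_diff: "\<sigma> (x - y) = \<sigma> x - \<sigma> y" and \<sigma>_neg: "\<sigma> (- x) = - \<sigma> x" for x y c
    using fmfm.linear_add[OF \<sigma>(1)] fmfm.linear_scale[OF \<sigma>(1)] fmfm.linear_0[OF \<sigma>(1)]
      fmfm.linear_diff[OF \<sigma>(1)] fmfm.linear_neg[OF \<sigma>(1)] by auto
  define \<alpha>t where "\<alpha>t = \<alpha> + s * \<beta> * p"
  define \<phi> where "\<phi> y = e * y * e + (p * e) * y * (e * s) + (s * p * e) * y * (e * s * \<beta>)
    + (- (s * \<beta> * p * e)) * y * (e * s) + (n * g) * y * (e * s) + (n * r * e) * y * (e * s * \<beta>)" for y
  have "lin \<phi>" unfolding \<phi>_def by (intro lin_add linear_sandwich)
  then have lin: "lin (\<lambda>x. \<phi> (\<sigma> x))"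
    by (intro linI) (simp_all add: \<sigma>_add \<sigma>_sc fmfm.linear_add fmfm.linear_scale)
  show ?thesis
  proof (rule st_dim_le[OF lin T2.subspace_tri fin(1)])
    fix x assume x: "x \<in> st (tri S e g) \<gamma>'"
    then obtain A' u' C' where xe: "x = A' + u' + C'" and A': "A' \<in> S" "A' \<in> corner e e"
      and u': "u' \<in> corner e g" and C': "C' \<in> corner g g"
      by (rule T2.st_triE)
    have eqs: "\<sigma> n * A' = C' * \<sigma> n" "\<sigma> n * u' = 0"
      "\<forall>A''\<in>S. tr ((- \<sigma> \<alpha>t * A' - A' * (- \<sigma> \<alpha>t) - u' * \<sigma> n) * A'') = 0"
      using T2.st_tri_iff[OF A'(1) u' C' comp'] x by (auto simp: xe \<alpha>t_def)
    define A where "A = \<sigma> A'"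
    define w' where "w' = \<sigma> u'"
    define C where "C = \<sigma> C'"
    have A: "A \<in> S" "A \<in> corner e e"
      using \<sigma>(7)[OF A'(1)] T1.S_corner by (auto simp: A_def)
    have w'c: "w' \<in> corner g e"
      using u' \<sigma>(2)[of e u'] \<sigma>(2)[of u' g] by (simp add: w'_def corner_def \<sigma>(5,6))
    have Cc: "C \<in> corner g g"
      using C' \<sigma>(2)[of g C'] \<sigma>(2)[of C' g] by (simp add: C_def corner_def \<sigma>(5,6))
    \<comment> \<open>Transposed, the first equation says that \<open>A\<close> preserves the image
      of \<open>n\<close>, which is the kernel of \<open>p\<close>. The second one, where the zero
      component of \<open>\<gamma>'\<close> leaves only one term, says that \<open>w'\<close>
      vanishes on this kernel and so factors through \<open>p\<close>.\<close>
    have An: "A * n = n * C"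
      using arg_cong[OF eqs(1), of \<sigma>] by (simp add: \<sigma>(2,3) A_def C_def)
    have w'n: "w' * n = 0"
      using arg_cong[OF eqs(2), of \<sigma>] by (simp add: \<sigma>(2,3) \<sigma>_0 w'_def)
    \<comment> \<open>The anti-automorphism \<open>\<sigma>\<close> reverses commutators; the minus
      sign in the first component of \<open>\<gamma>'\<close> compensates for this.\<close>
    have S0: "tr ((\<alpha>t * A - A * \<alpha>t - n * w') * A'') = 0" if "A'' \<in> S" for A''
    proof -
      have "0 = tr (\<sigma> ((- \<sigma> \<alpha>t * A' - A' * (- \<sigma> \<alpha>t) - u' * \<sigma> n) * \<sigma> A''))"
        using eqs(3) \<sigma>(7)[OF that] by (simp only: \<sigma>(4))
      also have "\<dots> = tr (A'' * (\<alpha>t * A - A * \<alpha>t - n * w'))"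
        by (simp add: \<sigma>(2,3) \<sigma>_diff \<sigma>_neg \<sigma>_add A_def w'_def algebra_simps)
      finally show ?thesis by (simp add: tr_commute[of A''])
    qed
    define B where "B = p * A * s"
    define w where "w = w' * s"
    \<comment> \<open>The part along \<open>s\<close> is forced by the equation with
      \<open>\<beta>\<close>. The part along \<open>n\<close> is the free block \<open>w\<close>
      plus \<open>r * A * s * \<beta>\<close>, which compensates for the component of
      \<open>A * s\<close> along \<open>n\<close> when \<open>\<alpha>t\<close> is replaced by
      \<open>\<alpha>\<close>.\<close>
    define u where "u = s * (B * \<beta> - \<beta> * B) + n * (w + r * A * s * \<beta>)"
    have w': "w' = w * p"
    proof -
      have "w' = w' * (s * p + n * r)" unfolding spnr using corner_absorb[OF w'c] by simp
      also have "\<dots> = w * p" by (simp add: w_def distrib_left mult.assoc mult_assoc_eq[OF w'n])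
      finally show ?thesis .
    qed
    have wc: "w \<in> corner g f" unfolding w_def by (rule corner_mult[OF w'c sc])
    have Bc: "B \<in> corner f f" unfolding B_def by (rule corner_mult[OF corner_mult[OF pc A(2)] sc])
    have uc: "u \<in> corner e f" unfolding u_def
      by (intro corner_add corner_mult[OF sc] corner_mult[OF nc] corner_diff corner_mult[OF Bc \<beta>c] corner_mult[OF \<beta>c Bc]
          wc corner_mult[OF corner_mult[OF corner_mult[OF rc A(2)] sc] \<beta>c])
    have pA: "p * A = B * p"
    proof -
      have "p * A = p * A * (s * p + n * r)" unfolding spnr using corner_absorb[OF A(2)] by (simp add: mult.assoc)
      also have "\<dots> = B * p" by (simp add: B_def distrib_left mult.assoc mult_assoc_eq[OF An] basic)
      finally show ?thesis .
    qed
    have pu: "\<beta> * B - B * \<beta> + p * u = 0"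
      using corner_absorb[OF Bc] corner_absorb[OF \<beta>c]
      by (simp add: u_def distrib_left right_diff_distrib mult.assoc basic)
    have As: "A * s = s * B + n * (r * A * s)"
    proof -
      have "A * s = (s * p + n * r) * (A * s)" unfolding spnr using corner_absorb[OF A(2)] by simp
      also have "\<dots> = s * B + n * (r * A * s)" by (simp add: B_def distrib_right mult.assoc)
      finally show ?thesis .
    qed
    have "\<alpha> * A - A * \<alpha> - u * p = \<alpha>t * A - A * \<alpha>t - n * w'"
    proof -
      have "A * s * \<beta> * p = s * B * \<beta> * p + n * r * A * s * \<beta> * p"
        by (subst As) (simp add: algebra_simps)
      moreover have "s * \<beta> * p * A = s * \<beta> * B * p" by (simp add: mult.assoc pA)
      ultimately show ?thesis
        by (simp add: u_def \<alpha>t_def w' algebra_simps)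
    qed
    then have \<phi>st: "A + u + B \<in> st (tri S e f) \<gamma>"
      using S0 pA pu by (subst T1.st_tri_iff[OF A(1) uc Bc comp]) simp
    have comps: "e * \<sigma> x * e = A" "g * \<sigma> x * e = w'"
    proof -
      have \<sigma>x: "\<sigma> x = A + w' + C" by (simp add: xe \<sigma>_add A_def w'_def C_def)
      show "e * \<sigma> x * e = A" "g * \<sigma> x * e = w'"
        unfolding \<sigma>x using T2.components(4,5)[OF A(2) corner_0 w'c Cc] by simp_all
    qed
    have "\<phi> (\<sigma> x) = e * \<sigma> x * e + p * (e * \<sigma> x * e) * s + s * (p * (e * \<sigma> x * e) * s) * \<beta>
        - s * \<beta> * (p * (e * \<sigma> x * e) * s) + n * (g * \<sigma> x * e) * s + n * r * (e * \<sigma> x * e) * s * \<beta>"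
      by (simp add: \<phi>_def mult.assoc)
    then have \<phi>: "\<phi> (\<sigma> x) = A + u + B"
      unfolding comps by (simp add: B_def u_def w_def algebra_simps)
    show "\<phi> (\<sigma> x) \<in> st (tri S e f) \<gamma>" unfolding \<phi> by (rule \<phi>st)
    assume "\<phi> (\<sigma> x) = 0"
    then have 0: "A = 0" "u = 0" "B = 0" using T1.components[OF A(2) uc corner_0 Bc] unfolding \<phi> by auto
    \<comment> \<open>For injectivity, \<open>r\<close> recovers \<open>w\<close> from
      \<open>u\<close>, and below it recovers \<open>C\<close> from
      \<open>A * n = n * C\<close>.\<close>
    have "w = r * u" using corner_absorb[OF wc] 0(1,3) by (simp add: u_def basic)
    then have "w' = 0" using 0 w' by simp
    have "C = r * (n * C)" using corner_absorb[OF Cc] by (simp add: basic)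
    then have "C = 0" using An 0 by simp
    have "A' = \<sigma> A" "u' = \<sigma> w'" "C' = \<sigma> C" by (simp_all add: A_def w'_def C_def \<sigma>(3))
    then show "x = 0" using 0 \<open>w' = 0\<close> \<open>C = 0\<close> by (simp add: xe \<sigma>_0)
  qed
qed

section \<open>Centralisers and the reduction over the dual numbers\<close>

definition cent :: "('i, 'a :: field) fmat \<Rightarrow> ('i, 'a) fmat \<Rightarrow> ('i, 'a) fmat set" where
  "cent e N = {A \<in> corner e e. A * N = N * A}"

lemma subspace_cent: "fm.subspace (cent e N)"
  using subspace_corner[of e e] unfolding fm.subspace_def cent_def by (auto simp: distrib_left distrib_right)

text \<open>
  \<open>N\<close> is multiplication by \<open>\<epsilon>\<close>, and \<open>v \<mapsto> p (N v) + \<epsilon> p v\<close> is the \<open>K[\<epsilon>]\<close>-linear map induced by \<open>p\<close>, with kernel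
  \<open>n\<close> and splitting \<open>s1\<close>, \<open>s2\<close>. The functional \<open>tr (\<alpha> \<cdot>)\<close> on the centraliser of \<open>N\<close> depends only on
  \<open>N \<alpha> + \<alpha> N\<close>, whence the shape of the new component \<open>p'\<close>.
\<close>
lemma st_dual_numbers:
  fixes N :: "('i, 'a :: field) fmat"
  assumes T1: "triangular (cent e N) e f" and T2: "triangular (cent e' N) e' f"
    and fin: "fin_span (tri (cent e N) e f)" "fin_span (tri (cent e' N) e' f)"
    and Nc: "N \<in> corner e e" and NN: "N * N = 0" and Ne': "N * e' = e' * N" and e'c: "e' \<in> corner e e"
    and pc: "p \<in> corner f e" and s1c: "s1 \<in> corner e f" and s2c: "s2 \<in> corner e f"
    and nc: "n \<in> corner e e'" and rc: "r \<in> corner e' e"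
    and Ns2: "N * s2 = s1" and ps1: "p * s1 = f" and ps2: "p * s2 = 0"
    and Nn: "N * n = n * N" and rN: "r * N = N * r" and pn: "p * n = 0"
    and rs1: "r * s1 = 0" and rs2: "r * s2 = 0" and rn: "r * n = e'"
    and sum: "s1 * p + s2 * p * N + n * r = e"
    and comp: "e * \<gamma> * e = \<alpha>" "f * \<gamma> * e = p" "f * \<gamma> * f = \<beta>"
    and comp': "e' * \<gamma>' * e' = r * \<alpha> * n" "f * \<gamma>' * e' = p * (N * \<alpha> + \<alpha> * N) * n"
      "f * \<gamma>' * f = \<beta> + p * \<alpha> * s1 + p * N * \<alpha> * s2"
  shows "fm.dim (st (tri (cent e N) e f) \<gamma>) = fm.dim (st (tri (cent e' N) e' f) \<gamma>')"
proof -
  interpret T1: triangular "cent e N" e f by (rule T1)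
  interpret T2: triangular "cent e' N" e' f by (rule T2)
  have Ns1: "N * s1 = 0" using NN by (simp add: Ns2[symmetric] mult_assoc_eq)
  have \<beta>c: "\<beta> \<in> corner f f" and \<alpha>c: "\<alpha> \<in> corner e e"
    unfolding comp[symmetric] by (auto intro: corner_cut T1.ee T1.ff)
  define p' where "p' = p * (N * \<alpha> + \<alpha> * N) * n"
  define \<alpha>' where "\<alpha>' = r * \<alpha> * n"
  define \<beta>' where "\<beta>' = \<beta> + p * \<alpha> * s1 + p * N * \<alpha> * s2"
  note comp'' = comp'[folded p'_def \<alpha>'_def \<beta>'_def]
  have p'c: "p' \<in> corner f e'" unfolding p'_def
    by (intro corner_mult[OF corner_mult[OF pc] nc] corner_add corner_mult[OF Nc \<alpha>c] corner_mult[OF \<alpha>c Nc])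
  have pNn: "p * (N * n) = 0" using pn by (simp add: Nn mult.assoc[symmetric])
  note basic = Ns2 Ns1 ps1 ps2 pn rs1 rs2 rn NN pNn rN Nn
    mult_assoc_eq[OF Ns2] mult_assoc_eq[OF Ns1] mult_assoc_eq[OF ps1] mult_assoc_eq[OF ps2]
    mult_assoc_eq[OF pn] mult_assoc_eq[OF rs1] mult_assoc_eq[OF rs2] mult_assoc_eq[OF rn] mult_assoc_eq[OF NN]
  have move: "N * (n * x) = n * (N * x)" "r * (N * x) = N * (r * x)" for x
    using mult_assoc_eq[OF Nn] mult_assoc_eq[OF rN] by (simp_all add: mult.assoc)
  \<comment> \<open>This is the off-diagonal block forced by \<open>A\<close>: pairing
    \<open>[\<alpha>, A] - v * p\<close> with the elements \<open>s1 * y + s2 * y * N\<close> of the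
    centraliser, \<open>y\<close> arbitrary in \<open>corner f e\<close>, leaves no other choice for
    \<open>v\<close>.\<close>
  define u where "u A = (\<alpha> * A - A * \<alpha>) * s1 + N * (\<alpha> * A - A * \<alpha>) * s2" for A
  have centD: "A \<in> corner e e" "A * N = N * A" "A * (N * x) = N * (A * x)" if "A \<in> cent e N" for A x
    using that mult_assoc_eq[of A N] by (auto simp: cent_def mult.assoc)
  have centD': "D \<in> corner e' e'" "D * N = N * D" "D * (N * x) = N * (D * x)" if "D \<in> cent e' N" for D x
    using that mult_assoc_eq[of D N] by (auto simp: cent_def mult.assoc)
  \<comment> \<open>Coordinates of a centralising \<open>A\<close>: \<open>r * A * n\<close> on the
    kernel and \<open>r * A * s2\<close> from its complement into the kernel. The block
    \<open>r * A * s1\<close> is no further datum, being \<open>N * (r * A * s2)\<close> since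
    \<open>A\<close> commutes with \<open>N\<close>.\<close>
  have cut: "r * A * n \<in> cent e' N" "r * A * s2 \<in> corner e' f"
    "r * A = r * A * s2 * p * N + N * (r * A * s2) * p + r * A * n * r" if A: "A \<in> cent e N" for A
  proof -
    have "r * A * n \<in> corner e' e'" by (rule corner_mult[OF corner_mult[OF rc centD(1)[OF A]] nc])
    moreover have "r * A * n * N = N * (r * A * n)"
      by (simp add: mult.assoc Nn[symmetric] centD(3)[OF A] move)
    ultimately show "r * A * n \<in> cent e' N" by (simp add: cent_def)
    show "r * A * s2 \<in> corner e' f" by (rule corner_mult[OF corner_mult[OF rc centD(1)[OF A]] s2c])
    have "r * A * s1 = N * (r * A * s2)"
      by (simp add: Ns2[symmetric] mult.assoc centD(3)[OF A] move)
    moreover have "r * A = r * A * (s1 * p + s2 * p * N + n * r)"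
      unfolding sum using corner_absorb[OF centD(1)[OF A]] by (simp add: mult.assoc)
    ultimately show "r * A = r * A * s2 * p * N + N * (r * A * s2) * p + r * A * n * r"
      by (simp add: distrib_left mult.assoc[symmetric] add.commute)
  qed
  \<comment> \<open>Conversely \<open>A\<close> is assembled from \<open>B\<close>, \<open>X\<close>
    and \<open>D\<close>, the first two being extended linearly over the dual numbers. The
    off-diagonal block \<open>X\<close> of the smaller algebra is thus a block of \<open>A\<close>,
    whereas the off-diagonal block of the larger algebra is the function \<open>u A\<close> of
    \<open>A\<close>.\<close>
  have key: "A \<in> cent e N" "p * A = B * p" "r * A * n = D" "r * A * s2 = X"
      "\<And>A'. A' \<in> cent e N \<Longrightarrow> tr ((\<alpha> * A - A * \<alpha> - u A * p) * A') =
        tr ((\<alpha>' * D - D * \<alpha>' - X * p') * (r * A' * n)) + tr ((p' * D - B * p') * (r * A' * s2))"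
      "\<beta> * B - B * \<beta> + p * u A = \<beta>' * B - B * \<beta>' + p' * X"
    if B: "B \<in> corner f f" and X: "X \<in> corner e' f" and D: "D \<in> cent e' N"
      and A: "A = s1 * B * p + s2 * B * p * N + n * X * p * N + n * N * X * p + n * D * r" for A B X D
  proof -
    note Dc = centD'[OF D]
    have Ac: "A \<in> corner e e" unfolding A
      by (intro corner_add corner_mult[OF corner_mult[OF s1c B] pc]
          corner_mult[OF corner_mult[OF corner_mult[OF s2c B] pc] Nc]
          corner_mult[OF corner_mult[OF corner_mult[OF nc X] pc] Nc]
          corner_mult[OF corner_mult[OF nc Dc(1)] rc])
         (simp only: Nn[symmetric], intro corner_mult[OF corner_mult[OF corner_mult[OF Nc nc] X] pc])
    have AN: "A * N = N * A"
      by (simp add: A distrib_left distrib_right mult.assoc basic move Dc)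
    show Acent: "A \<in> cent e N" using Ac AN by (simp add: cent_def)
    note AN' = centD(3)[OF Acent]
    show pA: "p * A = B * p"
      using corner_absorb[OF B] by (simp add: A distrib_left mult.assoc basic)
    have pNA: "p * (N * (A * x)) = B * (p * (N * x))" for x
      using mult_assoc_eq[OF pA] by (simp add: AN'[symmetric] mult.assoc)
    have pA': "p * (A * x) = B * (p * x)" for x
      using mult_assoc_eq[OF pA] by (simp add: mult.assoc)
    have An: "A * n = n * D"
      using corner_absorb[OF nc] corner_absorb[OF Dc(1)] by (simp add: A distrib_right mult.assoc basic move)
    have As1: "A * s1 = s1 * B + n * (N * X)"
      using corner_absorb[OF B] corner_absorb[OF X] by (simp add: A distrib_right mult.assoc basic move)
    have As2: "A * s2 = s2 * B + n * X"
      using corner_absorb[OF B] corner_absorb[OF X] by (simp add: A distrib_right mult.assoc basic move)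
    have rA: "r * A = X * p * N + N * X * p + D * r"
      using corner_absorb[OF X] corner_absorb[OF Dc(1)] mult_assoc_eq[OF Ne'[symmetric]]
      by (simp add: A distrib_left mult.assoc basic move)
    show "r * A * n = D" using corner_absorb[OF Dc(1)] by (simp add: mult.assoc An basic)
    show "r * A * s2 = X" using corner_absorb[OF X] by (simp add: mult.assoc As2 distrib_left basic)
    define \<zeta> where "\<zeta> = \<alpha> * A - A * \<alpha>"
    have \<zeta>c: "\<zeta> \<in> corner e e"
      unfolding \<zeta>_def by (intro corner_diff corner_mult[OF \<alpha>c Ac] corner_mult[OF Ac \<alpha>c])
    \<comment> \<open>The two summands are the pairings of \<open>\<zeta> * n\<close> with the two
      terms of \<open>r * A'\<close> that contain the block \<open>X'\<close>; together they give
      the first equation for \<open>p'\<close>.\<close>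
    have \<zeta>1: "p * N * \<zeta> * n + p * \<zeta> * n * N = p' * D - B * p'"
      by (simp add: \<zeta>_def p'_def distrib_left distrib_right left_diff_distrib right_diff_distrib mult.assoc
          pA' pNA An Dc Nn[symmetric] mult_assoc_eq[OF Nn[symmetric]] mult_assoc_eq[OF An] AN')
    show "tr ((\<alpha> * A - A * \<alpha> - u A * p) * A') =
        tr ((\<alpha>' * D - D * \<alpha>' - X * p') * (r * A' * n)) + tr ((p' * D - B * p') * (r * A' * s2))"
      if A': "A' \<in> cent e N" for A'
    proof -
      define D' where "D' = r * A' * n"
      define X' where "X' = r * A' * s2"
      note D'c = centD'[OF cut(1)[OF A', folded D'_def]]
      \<comment> \<open>\<open>A'\<close> commutes with \<open>N\<close>, so the second term of
        \<open>u A\<close> matches the summand \<open>s2 * p * N\<close> in the decomposition of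
        \<open>e\<close>. After cancellation only the summand \<open>n * r\<close> is left.\<close>
      have rot: "tr (N * \<zeta> * s2 * p * A') = tr (\<zeta> * (s2 * p * N) * A')"
        using tr_commute[of N "\<zeta> * s2 * p * A'"] by (simp add: mult.assoc centD(2)[OF A'])
      have "tr ((\<alpha> * A - A * \<alpha> - u A * p) * A') = tr (\<zeta> * e * A') - tr (\<zeta> * (s1 * p) * A') - tr (N * \<zeta> * s2 * p * A')"
        using corner_absorb[OF \<zeta>c] by (simp add: u_def \<zeta>_def[symmetric] left_diff_distrib distrib_right mult.assoc)
      also have "\<dots> = tr (\<zeta> * (n * r) * A')"
        unfolding rot sum[symmetric] by (simp add: distrib_left distrib_right)
      also have "\<dots> = tr (\<zeta> * n * (r * A'))" by (simp add: mult.assoc)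
      also have "\<dots> = tr (\<zeta> * n * (X' * p * N)) + tr (\<zeta> * n * (N * X' * p)) + tr (\<zeta> * n * (D' * r))"
        by (subst cut(3)[OF A']) (simp add: D'_def X'_def distrib_left)
      also have "tr (\<zeta> * n * (X' * p * N)) = tr (p * N * \<zeta> * n * X')"
        using tr_commute[of "\<zeta> * n * X'" "p * N"] by (simp add: mult.assoc)
      also have "tr (\<zeta> * n * (N * X' * p)) = tr (p * \<zeta> * n * N * X')"
        using tr_commute[of "\<zeta> * n * N * X'" p] by (simp add: mult.assoc)
      also have "tr (\<zeta> * n * (D' * r)) = tr (r * \<zeta> * n * D')"
        using tr_commute[of "\<zeta> * n * D'" r] by (simp add: mult.assoc)
      also have "tr (p * N * \<zeta> * n * X') + tr (p * \<zeta> * n * N * X') = tr ((p' * D - B * p') * X')"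
        unfolding \<zeta>1[symmetric] by (simp add: distrib_right)
      also have "tr (r * \<zeta> * n * D') = tr ((\<alpha>' * D - D * \<alpha>' - X * p') * D')"
      proof -
        have "r * \<zeta> * n = r * \<alpha> * (A * n) - (r * A) * \<alpha> * n"
          by (simp add: \<zeta>_def left_diff_distrib right_diff_distrib mult.assoc)
        also have "\<dots> = \<alpha>' * D - D * \<alpha>' - X * p * N * \<alpha> * n - N * (X * p * \<alpha> * n)"
          by (simp add: An rA \<alpha>'_def distrib_right mult.assoc)
        finally have "tr (r * \<zeta> * n * D') = tr ((\<alpha>' * D - D * \<alpha>' - X * p * N * \<alpha> * n) * D') - tr (N * (X * p * \<alpha> * n * D'))"
          by (simp add: left_diff_distrib mult.assoc)
        also have "tr (N * (X * p * \<alpha> * n * D')) = tr (X * p * \<alpha> * N * n * D')"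
          by (subst tr_commute) (simp add: mult.assoc D'c mult_assoc_eq[OF Nn])
        finally show ?thesis
          by (simp add: p'_def left_diff_distrib distrib_left distrib_right mult.assoc)
      qed
      finally show ?thesis by (simp add: D'_def X'_def)
    qed
    have "p * u A = p * \<alpha> * (A * s1) - B * p * \<alpha> * s1 + (p * N * \<alpha> * (A * s2) - B * p * N * \<alpha> * s2)"
      by (simp add: u_def distrib_left left_diff_distrib right_diff_distrib mult.assoc pA' pNA)
    also have "\<dots> = (p * \<alpha> * s1 + p * N * \<alpha> * s2) * B - B * (p * \<alpha> * s1 + p * N * \<alpha> * s2) + p' * X"
      by (simp add: As1 As2 p'_def distrib_left distrib_right mult.assoc move(1)[symmetric])
    finally show "\<beta> * B - B * \<beta> + p * u A = \<beta>' * B - B * \<beta>' + p' * X"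
      by (simp add: \<beta>'_def distrib_left distrib_right)
  qed
  have uc: "u A \<in> corner e f" if "A \<in> corner e e" for A
    unfolding u_def
    by (intro corner_add corner_mult[OF _ s1c] corner_mult[OF corner_mult[OF Nc] s2c] corner_diff
        corner_mult[OF \<alpha>c that] corner_mult[OF that \<alpha>c])
  show ?thesis
  proof (rule antisym)
    show "fm.dim (st (tri (cent e N) e f) \<gamma>) \<le> fm.dim (st (tri (cent e' N) e' f) \<gamma>')"
    proof (rule st_dim_le[of "\<lambda>x. (r * e) * x * (e * n) + (r * e) * x * (e * s2) + f * x * f", OF _ T1.subspace_tri fin(2)])
      show "lin (\<lambda>x. (r * e) * x * (e * n) + (r * e) * x * (e * s2) + f * x * f)" by (intro lin_add linear_sandwich)
      fix x assume x: "x \<in> st (tri (cent e N) e f) \<gamma>"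
      then obtain A v B where xe: "x = A + v + B" and A: "A \<in> cent e N" "A \<in> corner e e"
        and v: "v \<in> corner e f" and B: "B \<in> corner f f"
        by (rule T1.st_triE)
      have eqs: "p * A = B * p" "\<beta> * B - B * \<beta> + p * v = 0"
        "\<And>A'. A' \<in> cent e N \<Longrightarrow> tr ((\<alpha> * A - A * \<alpha> - v * p) * A') = 0"
        using T1.st_tri_iff[OF A(1) v B comp] x by (auto simp: xe)
      define D where "D = r * A * n"
      define X where "X = r * A * s2"
      note AD = cut[OF A(1), folded D_def X_def]
      have Ae: "A = s1 * B * p + s2 * B * p * N + n * X * p * N + n * N * X * p + n * D * r"
      proof -
        have "A = (s1 * p + s2 * p * N + n * r) * A" unfolding sum using corner_absorb[OF A(2)] by simp
        also have "\<dots> = s1 * (p * A) + s2 * (p * A) * N + n * (r * A)"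
          by (simp add: distrib_right mult.assoc centD(2)[OF A(1)])
        also have "\<dots> = s1 * B * p + s2 * B * p * N + n * X * p * N + n * N * X * p + n * D * r"
          by (subst AD(3)) (simp add: eqs(1) distrib_left mult.assoc)
        finally show ?thesis .
      qed
      note K = key[OF B AD(2,1) Ae]
      have v_eq: "v = u A"
      proof -
        have "u A - v = 0"
        proof (rule corner_nondegenerate[of _ e f, OF corner_diff[OF uc[OF A(2)] v] T1.ee T1.ff])
          fix y assume y: "y \<in> corner f e"
          have c: "s1 * y + s2 * y * N \<in> cent e N"
            unfolding cent_def
            by (intro CollectI conjI corner_add corner_mult[OF s1c y] corner_mult[OF corner_mult[OF s2c y] Nc])
               (simp add: distrib_left distrib_right mult.assoc basic)
          define \<zeta> where "\<zeta> = \<alpha> * A - A * \<alpha>"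
          have "0 = tr ((\<zeta> - v * p) * (s1 * y + s2 * y * N))"
            using eqs(3)[OF c] by (simp add: \<zeta>_def)
          also have "\<dots> = tr (\<zeta> * s1 * y) + tr (\<zeta> * s2 * y * N) - tr (v * y)"
            using corner_absorb[OF y] by (simp add: left_diff_distrib distrib_left mult.assoc basic)
          also have "tr (\<zeta> * s2 * y * N) = tr (N * \<zeta> * s2 * y)"
            by (subst tr_commute) (simp add: mult.assoc)
          finally show "tr ((u A - v) * y) = 0"
            by (simp add: u_def \<zeta>_def[symmetric] left_diff_distrib distrib_right)
        qed
        then show ?thesis by simp
      qed
      \<comment> \<open>Using \<open>key\<close> with \<open>B = 0\<close>, every pair
        \<open>D'\<close>, \<open>X'\<close> is realised by a test element of the larger
        centraliser.\<close>
      have red: "tr ((\<alpha>' * D - D * \<alpha>' - X * p') * D') + tr ((p' * D - B * p') * X') = 0"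
        if D': "D' \<in> cent e' N" and X': "X' \<in> corner e' f" for D' X'
      proof -
        note K' = key[OF corner_0[of f f] X' D' refl]
        show ?thesis using K(5)[OF K'(1)] eqs(3)[OF K'(1)] unfolding K'(3,4) v_eq by simp
      qed
      have D0: "0 \<in> cent e' N" by (rule fm.subspace_0[OF subspace_cent])
      have "p' * D - B * p' = 0"
        using red[OF D0] centD'(1)[OF AD(1)]
        by (intro corner_nondegenerate[of _ f e', OF _ T2.ff T2.ee] corner_diff corner_mult[OF p'c] corner_mult[OF B p'c]) auto
      moreover have "tr ((\<alpha>' * D - D * \<alpha>' - X * p') * D') = 0" if "D' \<in> cent e' N" for D'
        using red[OF that corner_0] by simp
      ultimately have "D + X + B \<in> st (tri (cent e' N) e' f) \<gamma>'"
        using K(6) eqs(2) v_eq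
        by (subst T2.st_tri_iff[OF AD(1,2) B comp'']) simp
      moreover have \<phi>: "(r * e) * x * (e * n) + (r * e) * x * (e * s2) + f * x * f = D + X + B"
      proof -
        have "(r * e) * x * (e * n) + (r * e) * x * (e * s2) + f * x * f = r * (e * x * e) * n + r * (e * x * e) * s2 + f * x * f"
          by (simp add: mult.assoc)
        then show ?thesis
          using T1.components[OF A(2) v corner_0 B] by (simp add: xe D_def X_def)
      qed
      ultimately show "(r * e) * x * (e * n) + (r * e) * x * (e * s2) + f * x * f \<in> st (tri (cent e' N) e' f) \<gamma>'"
        by simp
      assume "(r * e) * x * (e * n) + (r * e) * x * (e * s2) + f * x * f = 0"
      then have 0: "D = 0" "X = 0" "B = 0"
        using T2.components[OF centD'(1)[OF AD(1)] AD(2) corner_0 B] unfolding \<phi> by auto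
      then have "A = 0" using Ae by simp
      then show "x = 0" using 0 v_eq by (simp add: xe u_def)
    qed
    show "fm.dim (st (tri (cent e' N) e' f) \<gamma>') \<le> fm.dim (st (tri (cent e N) e f) \<gamma>)"
    proof -
      define \<phi>A where "\<phi>A x = (s1 * f) * x * (f * p) + (s2 * f) * x * (f * p * N) + (n * e') * x * (f * p * N)
        + (n * N * e') * x * (f * p) + (n * e') * x * (e' * r)" for x
      define \<phi> where "\<phi> x = e * \<phi>A x * e + \<alpha> * \<phi>A x * s1 + (- e) * \<phi>A x * (\<alpha> * s1)
        + (N * \<alpha>) * \<phi>A x * s2 + (- N) * \<phi>A x * (\<alpha> * s2) + f * x * f" for x
      have linA: "lin \<phi>A" unfolding \<phi>A_def by (intro lin_add linear_sandwich)
      have "lin (\<lambda>x. a * \<phi>A x * b)" for a b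
        by (rule linI)
           (simp_all add: fmfm.linear_add[OF linA] fmfm.linear_scale[OF linA] distrib_left distrib_right)
      then have lin: "lin \<phi>" unfolding \<phi>_def by (intro lin_add linear_sandwich)
      show ?thesis
      proof (rule st_dim_le[OF lin T2.subspace_tri fin(1)])
        fix x assume x: "x \<in> st (tri (cent e' N) e' f) \<gamma>'"
        then obtain D X B where xe: "x = D + X + B" and D: "D \<in> cent e' N" "D \<in> corner e' e'"
          and X: "X \<in> corner e' f" and B: "B \<in> corner f f"
          by (rule T2.st_triE)
        have eqs: "p' * D = B * p'" "\<beta>' * B - B * \<beta>' + p' * X = 0"
          "\<And>D'. D' \<in> cent e' N \<Longrightarrow> tr ((\<alpha>' * D - D * \<alpha>' - X * p') * D') = 0"
          using T2.st_tri_iff[OF D(1) X B comp''] x by (auto simp: xe)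
        define A where "A = s1 * B * p + s2 * B * p * N + n * X * p * N + n * N * X * p + n * D * r"
        note K = key[OF B X D(1) A_def]
        note Ac = centD(1)[OF K(1)]
        have comps: "e' * x * e' = D" "e' * x * f = X" "f * x * f = B"
          using T2.components[OF D(2) X corner_0 B] by (simp_all add: xe)
        have "\<phi>A x = s1 * (f * x * f) * p + s2 * (f * x * f) * p * N + n * (e' * x * f) * p * N
          + n * N * (e' * x * f) * p + n * (e' * x * e') * r"
          by (simp add: \<phi>A_def mult.assoc)
        then have \<phi>A: "\<phi>A x = A" unfolding comps A_def .
        have \<phi>: "\<phi> x = A + u A + B"
          unfolding \<phi>_def \<phi>A comps using corner_absorb[OF Ac]
          by (simp add: u_def left_diff_distrib right_diff_distrib mult.assoc)
        show "\<phi> x \<in> st (tri (cent e N) e f) \<gamma>"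
          unfolding \<phi> using K(2,5,6) eqs cut(1)
          by (subst T1.st_tri_iff[OF K(1) uc[OF Ac] B comp]) simp
        assume "\<phi> x = 0"
        then have 0: "A = 0" "B = 0" using T1.components[OF Ac uc[OF Ac] corner_0 B] unfolding \<phi> by auto
        then show "x = 0" using K(3,4) by (simp add: xe)
      qed
    qed
  qed
qed

section \<open>Cyclic vectors\<close>

text \<open>Matrix units along a matching of indices. These matrices supply the coordinate
  inclusions, projections and identifications between blocks, and they compose like partial
  bijections.\<close>

definition pm :: "'k set \<Rightarrow> ('k \<Rightarrow> 'i) \<Rightarrow> ('k \<Rightarrow> 'i) \<Rightarrow> ('i, 'a :: field) fmat" where
  "pm K \<phi> \<psi> = (\<Sum>k\<in>K. mu (\<phi> k) (\<psi> k))"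

lemma pm_mult:
  assumes "finite K" "inj_on \<psi> K"
  shows "pm K \<phi> \<psi> * pm K \<psi> \<chi> = pm K \<phi> \<chi>"
proof -
  have "pm K \<phi> \<psi> * pm K \<psi> \<chi> = (\<Sum>k\<in>K. \<Sum>l\<in>K. mu (\<phi> k) (\<psi> k) * mu (\<psi> l) (\<chi> l))"
    by (simp add: pm_def sum_product)
  also have "\<dots> = (\<Sum>k\<in>K. \<Sum>l\<in>K. if l = k then mu (\<phi> k) (\<chi> l) else 0)"
    using assms(2) by (intro sum.cong refl) (auto simp: mu_mult inj_on_def)
  also have "\<dots> = pm K \<phi> \<chi>" using assms(1) by (simp add: pm_def)
  finally show ?thesis .
qed

lemma pm_mult_0:
  assumes "\<psi> ` K \<inter> \<psi>' ` L = {}"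
  shows "pm K \<phi> \<psi> * pm L \<psi>' \<chi> = 0"
  using assms unfolding pm_def sum_product
  by (intro sum.neutral ballI) (auto simp: mu_mult)

lemma idm_eq_pm:
  assumes "finite K" "inj_on \<phi> K"
  shows "idm (\<phi> ` K) = (pm K \<phi> \<phi> :: ('i, 'a :: field) fmat)"
proof (rule fmat_eqI)
  fix i j
  have "ent (pm K \<phi> \<phi> :: ('i, 'a) fmat) i j = (\<Sum>k\<in>K. if i = \<phi> k \<and> j = \<phi> k then 1 else (0 :: 'a))"
    by (simp add: pm_def ent_sum ent_mu)
  also have "\<dots> = (\<Sum>k\<in>\<phi> ` K. if i = k \<and> j = k then 1 else 0)"
    using assms(2) by (simp add: sum.reindex)
  also have "\<dots> = (\<Sum>k\<in>\<phi> ` K. if k = i then if i = j then 1 else 0 else 0)"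
    by (intro sum.cong) auto
  also have "\<dots> = ent (idm (\<phi> ` K)) i j"
    using assms(1) by (simp add: ent_idm)
  finally show "ent (idm (\<phi> ` K)) i j = ent (pm K \<phi> \<phi> :: ('i, 'a) fmat) i j" ..
qed

lemma pm_in_corner:
  assumes "finite I" "finite J" "\<phi> ` K \<subseteq> I" "\<psi> ` K \<subseteq> J"
  shows "(pm K \<phi> \<psi> :: ('i, 'a :: field) fmat) \<in> corner (idm I) (idm J)"
  unfolding corner_idm_iff[OF assms(1,2)]
proof (intro allI impI, rule ccontr)
  fix i j assume nz: "ent (pm K \<phi> \<psi> :: ('i, 'a) fmat) i j \<noteq> 0" and "\<not> (i \<in> I \<and> j \<in> J)"
  then have "ent (mu (\<phi> k) (\<psi> k) :: ('i, 'a) fmat) i j = 0" if "k \<in> K" for k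
    using that assms(3,4) by (auto simp: ent_mu)
  with nz show False by (simp add: pm_def ent_sum)
qed

text \<open>Powers inside a corner: the zeroth power is the local unit \<open>e\<close>.\<close>

primrec zp :: "('i, 'a :: field) fmat \<Rightarrow> ('i, 'a) fmat \<Rightarrow> nat \<Rightarrow> ('i, 'a) fmat" where
  "zp e z 0 = e"
| "zp e z (Suc i) = z * zp e z i"

lemma zp_commute:
  assumes "e * z = z * e" "x * z = z * x" "x * e = e * x"
  shows "x * zp e z i = zp e z i * x"
  using assms by (induction i) (simp_all add: mult.assoc mult_assoc_eq[of x z])

lemma zp_corner: "e * e = e \<Longrightarrow> z \<in> corner e e \<Longrightarrow> zp e z i \<in> corner e e"
  by (induction i) (auto intro: corner_mult simp: corner_def[of e e] mult.assoc mult_assoc_eq[of e z])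

text \<open>The Krylov matrix of \<open>z\<close>: column \<open>y i\<close> is the \<open>i\<close>-th power of \<open>z\<close> applied to the basis vector \<open>y 0\<close>.\<close>
definition kry :: "(nat \<Rightarrow> 'i) \<Rightarrow> nat \<Rightarrow> ('i, 'a :: field) fmat \<Rightarrow> ('i, 'a) fmat \<Rightarrow> ('i, 'a) fmat" where
  "kry y n e z = (\<Sum>i<n. zp e z i * mu (y 0) (y i))"

text \<open>The nilpotent Jordan block that moves the basis vector \<open>y i\<close> to
  \<open>y (Suc i)\<close>. Its cyclic vector is \<open>y 0\<close> and its Krylov matrix is the
  identity \<open>f\<close>, which makes it the reference point for genericity and the source of
  optimal functionals.\<close>

definition shift :: "(nat \<Rightarrow> 'i) \<Rightarrow> nat \<Rightarrow> ('i, 'a :: field) fmat" where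
  "shift y n = (\<Sum>i<n - 1. mu (y (Suc i)) (y i))"

locale enumerated =
  fixes y :: "nat \<Rightarrow> 'i" and n :: nat and J :: "'i set" and f :: "('i, 'a :: field) fmat"
  assumes bij: "bij_betw y {..<n} J" and n_pos: "0 < n" and f_def: "f = idm J"
begin

lemma finJ: "finite J"
  using bij bij_betw_finite by blast

lemma cardJ: "card J = n"
  using bij bij_betw_same_card by fastforce

lemma inj: "inj_on y {..<n}" and image: "y ` {..<n} = J"
  using bij by (auto simp: bij_betw_def)

lemma y_in: "i < n \<Longrightarrow> y i \<in> J"
  using image by auto

lemma y_eq: "i < n \<Longrightarrow> j < n \<Longrightarrow> y i = y j \<longleftrightarrow> i = j"
  using inj by (auto simp: inj_on_def)

lemma ff: "f * f = f"
  using finJ by (simp add: f_def idm_mult_idm)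

lemma mu_in: "i < n \<Longrightarrow> j < n \<Longrightarrow> mu (y i) (y j) \<in> corner f f"
  using finJ y_in by (auto simp: f_def corner_idm_iff ent_mu split: if_splits)

lemma column_unit: "mu (y 0) (y 0) \<in> corner (idm J) (idm {y 0})"
  using finJ y_in[OF n_pos] by (auto simp: corner_idm_iff ent_mu split: if_splits)

lemma f_eq: "f = (\<Sum>i<n. mu (y i) (y i))"
  using idm_eq_pm[of "{..<n}" y] inj image by (simp add: f_def pm_def)

lemma kry_mult: "i < n \<Longrightarrow> kry y n f z * mu (y i) (y 0) = zp f z i * mu (y 0) (y 0)"
proof -
  assume i: "i < n"
  have "kry y n f z * mu (y i) (y 0) = (\<Sum>j<n. zp f z j * (mu (y 0) (y j) * mu (y i) (y 0)))"
    by (simp add: kry_def sum_distrib_right mult.assoc)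
  also have "\<dots> = (\<Sum>j<n. if j = i then zp f z j * mu (y 0) (y 0) else 0)"
    using i by (intro sum.cong refl) (auto simp: mu_mult y_eq)
  finally show ?thesis using i by simp
qed

text \<open>A linear relation among the powers, evaluated at \<open>y 0\<close>, says that the
  Krylov matrix kills the column of coefficients.\<close>

lemma powers_independent:
  assumes inv: "inv_in f (kry y n f z)" and sum: "(\<Sum>i<n. sc (c i) (zp f z i)) = 0" and i: "i < n"
  shows "c i = 0"
proof -
  define v where "v = (\<Sum>i<n. sc (c i) (mu (y i) (y 0)))"
  have vc: "v \<in> corner f f"
    unfolding v_def using n_pos
    by (intro fm.subspace_sum[OF subspace_corner] fm.subspace_scale[OF subspace_corner] mu_in) auto
  have "kry y n f z * v = (\<Sum>i<n. sc (c i) (zp f z i)) * mu (y 0) (y 0)"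
    by (simp add: v_def sum_distrib_left sum_distrib_right kry_mult)
  then have "kry y n f z * v = 0" by (simp add: sum)
  moreover obtain k where k: "k * kry y n f z = f" using inv by (auto simp: inv_in_def)
  ultimately have "v = 0" using mult_assoc_eq[OF k, of v] corner_absorb(1)[OF vc] by simp
  have "0 = ent v (y i) (y 0)" by (simp add: \<open>v = 0\<close>)
  also have "\<dots> = (\<Sum>j<n. if j = i then c j else 0)"
    unfolding v_def ent_sum using i by (intro sum.cong refl) (auto simp: ent_mu y_eq)
  finally show ?thesis using i by simp
qed

text \<open>An element commuting with \<open>z\<close> commutes with its powers; if it kills the
  cyclic vector, it kills every column of the Krylov matrix, which is invertible.\<close>

lemma commutant_determined:
  assumes inv: "inv_in f (kry y n f z)" and z: "z \<in> corner f f" and x: "x \<in> corner f f"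
    and comm: "x * z = z * x" and x0: "x * mu (y 0) (y 0) = 0"
  shows "x = 0"
proof -
  have "x * (zp f z i * mu (y 0) (y i)) = 0" for i
  proof -
    have "x * (zp f z i * mu (y 0) (y i)) = zp f z i * (x * mu (y 0) (y 0)) * mu (y 0) (y i)"
      using zp_commute[of f z x i] comm corner_absorb[OF z] corner_absorb[OF x]
      by (simp add: mult.assoc mu_mult mult_assoc_eq[of x "zp f z i"])
    then show ?thesis by (simp add: x0)
  qed
  then have "x * kry y n f z = 0" by (simp add: kry_def sum_distrib_left)
  then have "x * (kry y n f z * k) = 0" for k by (simp add: mult.assoc[symmetric])
  moreover obtain k where "kry y n f z * k = f" using inv by (auto simp: inv_in_def)
  ultimately show "x = 0" using corner_absorb(2)[OF x] by metis
qed

lemma shift_in: "shift y n \<in> corner f f"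
  unfolding shift_def by (intro fm.subspace_sum[OF subspace_corner] mu_in) auto

lemma kry_shift: "kry y n f (shift y n) = f"
proof -
  have step: "shift y n * mu (y i) j = mu (y (Suc i)) j" if "Suc i < n" for i j
  proof -
    have "shift y n * mu (y i) j = (\<Sum>k<n - 1. mu (y (Suc k)) (y k) * mu (y i) j)"
      by (simp add: shift_def sum_distrib_right)
    also have "\<dots> = (\<Sum>k<n - 1. if k = i then mu (y (Suc k)) j else 0)"
      using that by (intro sum.cong refl) (auto simp: mu_mult y_eq)
    finally show ?thesis using that by (simp add: less_diff_conv)
  qed
  have "zp f (shift y n) i * mu (y 0) j = mu (y i) j" if "i < n" for i j
    using that
  proof (induction i)
    case 0
    then show ?case using finJ y_in[OF n_pos]
      by (intro fmat_eqI) (auto simp: f_def ent_idm_mult ent_mu)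
  next
    case (Suc i)
    then show ?case using step[of i j] by (simp add: mult.assoc)
  qed
  then show ?thesis unfolding kry_def by (subst f_eq) (intro sum.cong, auto)
qed

lemma inv_shift: "inv_in f (kry y n f (shift y n))"
  unfolding kry_shift inv_in_def using ff by (auto simp: corner_def)

lemma poly_fam_kry:
  assumes "poly_fam J J z"
  shows "poly_fam J J (\<lambda>t. kry y n f (z t))"
proof -
  have c: "poly_fam J J (\<lambda>t. x)" if "x \<in> corner f f" for x
    using that finJ by (intro poly_fam_const) (auto simp: f_def)
  have zp: "poly_fam J J (\<lambda>t. zp f (z t) i)" for i
  proof (induction i)
    case 0
    show ?case using ff by (auto intro!: c simp: corner_def)
  next
    case (Suc i)
    then show ?case using poly_fam_mult[OF assms] by simp
  qed
  have "poly_fam J J (\<lambda>t. \<Sum>i<m. zp f (z t) i * mu (y 0) (y i))" if "m \<le> n" for m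
    using that
  proof (induction m)
    case 0
    show ?case by (auto intro!: c simp: corner_0)
  next
    case (Suc m)
    then show ?case
      by (simp, intro poly_fam_add poly_fam_mult[OF zp] c mu_in) (use n_pos in auto)
  qed
  then show ?thesis unfolding kry_def by simp
qed

text \<open>The polynomials in \<open>z\<close> of degree below \<open>n\<close> commute with
  \<open>z\<close>, hence stabilise the functional, and they are independent. The column
  \<open>w\<close> supplies their coefficients.\<close>

lemma st_gl_lower:
  assumes inv: "inv_in f (kry y n f (f * \<gamma> * f))"
  shows "n \<le> fm.dim (st (corner f f) \<gamma>)"
proof -
  define z where "z = f * \<gamma> * f"
  have zc: "z \<in> corner f f" unfolding z_def by (intro corner_cut ff)
  define \<psi> where "\<psi> w = (\<Sum>i<n. sc (ent w (y i) (y 0)) (zp f z i))" for w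
  have "n = fm.dim (corner (idm J) (idm {y 0}) :: ('i, 'a) fmat set)"
    using dim_corner_column[OF finJ] cardJ by metis
  also have "\<dots> \<le> fm.dim (st (corner f f) \<gamma>)"
  proof (rule dim_le_of_inj)
    show "lin \<psi>" unfolding \<psi>_def
      by (intro linI) (simp_all add: fm.scale_left_distrib sum.distrib fm.scale_sum_right)
    show "fm.subspace (corner (idm J) (idm {y 0}) :: ('i, 'a) fmat set)" by (rule subspace_corner)
    have "fin_span (corner f f)" unfolding f_def by (intro fin_span_corner finJ)
    then show "fin_span (st (corner f f) \<gamma>)" by (rule fin_span_subset) (auto simp: st_def)
    fix w :: "('i, 'a) fmat"
    assume w: "w \<in> corner (idm J) (idm {y 0})"
    have \<psi>c: "\<psi> w \<in> corner f f"
      unfolding \<psi>_def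
      by (intro fm.subspace_sum[OF subspace_corner] fm.subspace_scale[OF subspace_corner] zp_corner ff zc)
    have comm: "z * \<psi> w = \<psi> w * z"
      unfolding \<psi>_def sum_distrib_left sum_distrib_right
      using zp_commute[of f z z] corner_absorb[OF zc] by simp
    show "\<psi> w \<in> st (corner f f) \<gamma>"
      unfolding st_def
    proof (intro CollectI conjI ballI \<psi>c)
      fix x assume x: "x \<in> corner f f"
      have "tr (\<gamma> * (\<psi> w * x - x * \<psi> w)) = tr (z * (\<psi> w * x - x * \<psi> w))"
        unfolding z_def by (intro tr_corner corner_diff corner_mult[OF \<psi>c x] corner_mult[OF x \<psi>c])
      also have "\<dots> = tr ((z * \<psi> w) * x) - tr (\<psi> w * z * x)"
        using tr_commute[of "z * x" "\<psi> w"] by (simp add: right_diff_distrib mult.assoc)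
      finally show "tr (\<gamma> * (\<psi> w * x - x * \<psi> w)) = 0" by (simp add: comm)
    qed
    assume "\<psi> w = 0"
    then have "ent w (y i) (y 0) = 0" if "i < n" for i
      using powers_independent[OF inv[folded z_def] _ that, of "\<lambda>i. ent w (y i) (y 0)"] by (simp add: \<psi>_def)
    then have "ent w j (y 0) = 0" if "j \<in> J" for j using that image by (metis imageE lessThan_iff)
    then show "w = 0" using w finJ by (intro fmat_eqI) (auto simp: corner_idm_iff)
  qed
  finally show ?thesis .
qed

text \<open>At the shift, nondegeneracy of the trace makes the stabiliser a commutant of a matrix
  with cyclic vector, so its elements are determined by their column at \<open>y 0\<close>.\<close>

lemma st_gl_upper: "fm.dim (st (corner f f) (shift y n)) \<le> n"
proof -
  have "fm.dim (st (corner f f) (shift y n)) \<le> fm.dim (corner (idm J) (idm {y 0}) :: ('i, 'a) fmat set)"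
  proof (rule dim_le_of_inj[of "\<lambda>x. f * x * mu (y 0) (y 0)"])
    show "lin (\<lambda>x. f * x * mu (y 0) (y 0))" by (rule linear_sandwich)
    show "fm.subspace (st (corner f f) (shift y n))" by (rule subspace_st[OF subspace_corner])
    show "fin_span (corner (idm J) (idm {y 0}) :: ('i, 'a) fmat set)" by (intro fin_span_corner finJ) simp
    fix x assume "x \<in> st (corner f f) (shift y n)"
    then have x: "x \<in> corner f f" and st: "\<And>z. z \<in> corner f f \<Longrightarrow> tr (shift y n * (x * z - z * x)) = 0"
      by (auto simp: st_def)
    show "f * x * mu (y 0) (y 0) \<in> corner (idm J) (idm {y 0})"
      unfolding corner_absorb(1)[OF x] using x[unfolded f_def] column_unit by (rule corner_mult)
    have "shift y n * x - x * shift y n = 0"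
    proof (rule corner_nondegenerate[of _ f f, OF _ ff ff])
      show "shift y n * x - x * shift y n \<in> corner f f"
        by (intro corner_diff corner_mult[OF x shift_in] corner_mult[OF shift_in x])
      fix z assume "z \<in> corner f f"
      then show "tr ((shift y n * x - x * shift y n) * z) = 0"
        using st[of z] tr_commute[of "shift y n * z" x] by (simp add: left_diff_distrib right_diff_distrib mult.assoc)
    qed
    then have comm: "x * shift y n = shift y n * x" by simp
    assume "f * x * mu (y 0) (y 0) = 0"
    then show "x = 0" using corner_absorb[OF x] commutant_determined[OF inv_shift shift_in x comm] by simp
  qed
  then show ?thesis using dim_corner_column[OF finJ] cardJ by metis
qed

end

section \<open>The base cases\<close>

text \<open>The minimum appears as a bound for all functionals together with a functional reaching
  it, since the two halves usually have separate proofs.\<close>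

definition has_index :: "('i, 'a :: field) fmat set \<Rightarrow> nat \<Rightarrow> bool" where
  "has_index A k \<longleftrightarrow> (\<forall>\<gamma>. k \<le> fm.dim (st A \<gamma>)) \<and> (\<exists>\<gamma>. fm.dim (st A \<gamma>) \<le> k)"

lemma has_index_gl:
  fixes f :: "('i, 'a :: field_char_0) fmat"
  assumes "enumerated y n J f"
  shows "has_index (corner f f) n"
proof -
  interpret enumerated y n J f by (rule assms)
  have "n \<le> fm.dim (st (corner f f) \<gamma>)" for \<gamma>
  proof (rule st_dim_ge_generic[where M = "\<lambda>\<gamma>. kry y n f (f * \<gamma> * f)" and J = J and ?\<gamma>1.0 = "shift y n"])
    show "fm.subspace (corner f f)" by (rule subspace_corner)
    show "fin_span (corner f f)" unfolding f_def by (intro fin_span_corner finJ)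
    show "poly_fam J J (\<lambda>t. kry y n f (f * line \<gamma>0 (shift y n) t * f))" for \<gamma>0
      by (rule poly_fam_kry) (simp add: f_def poly_fam_line finJ)
    show "inv_in (idm J) (kry y n f (f * shift y n * f))"
      using inv_shift corner_absorb[OF shift_in] by (simp add: f_def)
    show "n \<le> fm.dim (st (corner f f) \<gamma>)" if "inv_in (idm J) (kry y n f (f * \<gamma> * f))" for \<gamma>
      using st_gl_lower[of \<gamma>] that by (simp add: f_def)
  qed
  with st_gl_upper show ?thesis by (auto simp: has_index_def)
qed

text \<open>The maps \<open>\<iota>0\<close> and \<open>\<iota>1\<close> give the two copies of
  \<open>K^n\<close> that form \<open>K[\<epsilon>]^n\<close>, with \<epsilon> sending the second
  copy to the first. The third copy \<open>\<phi>\<close> carries the corner of \<open>f\<close> in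
  which all block entries are written; for \<open>q(n, n)\<close> it is at the same time the block
  of \<open>gl_b\<close>.\<close>

locale doubled = enumerated y n "\<phi> ` K" f
  for y :: "nat \<Rightarrow> 'i" and n :: nat and \<phi> :: "'k \<Rightarrow> 'i" and K :: "'k set" and f :: "('i, 'a :: field) fmat" +
  fixes \<iota>0 \<iota>1 :: "'k \<Rightarrow> 'i"
  assumes finK: "finite K" and inj\<phi>: "inj_on \<phi> K" and inj0: "inj_on \<iota>0 K" and inj1: "inj_on \<iota>1 K"
    and disj01: "\<iota>0 ` K \<inter> \<iota>1 ` K = {}" and disj: "(\<iota>0 ` K \<union> \<iota>1 ` K) \<inter> \<phi> ` K = {}"
begin

definition "I = \<iota>0 ` K \<union> \<iota>1 ` K"
definition e :: "('i, 'a) fmat" where "e = idm I"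
definition N :: "('i, 'a) fmat" where "N = pm K \<iota>0 \<iota>1"
definition N' :: "('i, 'a) fmat" where "N' = pm K \<iota>1 \<iota>0"
definition i0 :: "('i, 'a) fmat" where "i0 = pm K \<iota>0 \<phi>"
definition i1 :: "('i, 'a) fmat" where "i1 = pm K \<iota>1 \<phi>"
definition l0 :: "('i, 'a) fmat" where "l0 = pm K \<phi> \<iota>0"
definition l1 :: "('i, 'a) fmat" where "l1 = pm K \<phi> \<iota>1"

lemma finI: "finite I" using finK by (simp add: I_def)

lemma cardI: "card I = 2 * n"
  using cardJ disj01 finK card_image[OF inj0] card_image[OF inj1] card_image[OF inj\<phi>]
  by (simp add: I_def card_Un_disjoint)

lemma products:
  "l0 * i0 = f" "l1 * i1 = f" "l0 * i1 = 0" "l1 * i0 = 0" "i0 * l1 = N" "i1 * l0 = N'" "i0 * l0 + i1 * l1 = e"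
  "N * i1 = i0" "N * i0 = 0" "l0 * N = l1" "l1 * N = 0" "N' * i0 = i1" "N' * i1 = 0" "l1 * N' = l0" "l0 * N' = 0" "N * N = 0"
proof -
  note pm = pm_mult[OF finK] inj0 inj1 inj\<phi>
  have d: "\<iota>1 ` K \<inter> \<iota>0 ` K = {}" using disj01 by blast
  show "l0 * i0 = f" "l1 * i1 = f"
    unfolding l0_def l1_def i0_def i1_def f_def idm_eq_pm[OF finK inj\<phi>] by (simp_all add: pm)
  show "l0 * i1 = 0" "l1 * i0 = 0" "N * i0 = 0" "l1 * N = 0" "N' * i1 = 0" "l0 * N' = 0" "N * N = 0"
    unfolding l0_def l1_def i0_def i1_def N_def N'_def by (simp_all add: pm_mult_0 disj01 d)
  show "i0 * l1 = N" "i1 * l0 = N'" "N * i1 = i0" "l0 * N = l1" "N' * i0 = i1" "l1 * N' = l0"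
    unfolding l0_def l1_def i0_def i1_def N_def N'_def by (simp_all add: pm)
  have "e = idm (\<iota>0 ` K) + idm (\<iota>1 ` K)"
    unfolding e_def I_def using finK disj01 by (intro idm_Un) auto
  then show "i0 * l0 + i1 * l1 = e"
    unfolding l0_def l1_def i0_def i1_def by (simp add: pm idm_eq_pm[OF finK inj0] idm_eq_pm[OF finK inj1])
qed

lemma corners:
  "i0 \<in> corner e f" "i1 \<in> corner e f" "l0 \<in> corner f e" "l1 \<in> corner f e" "N \<in> corner e e" "N' \<in> corner e e"
  unfolding l0_def l1_def i0_def i1_def N_def N'_def e_def f_def
  by (rule pm_in_corner; use finK in \<open>auto simp: I_def\<close>)+

lemma ee: "e * e = e" and ef: "e * f = 0" and fe: "f * e = 0"
proof -
  have "idm {} = (0 :: ('i, 'a) fmat)" by (intro fmat_eqI) (simp add: ent_idm)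
  then show "e * e = e" "e * f = 0" "f * e = 0"
    using finI finJ disj by (simp_all add: e_def f_def idm_mult_idm I_def Int_commute)
qed

lemmas absorb = corner_absorb[OF corners(1)] corner_absorb[OF corners(2)] corner_absorb[OF corners(3)]
  corner_absorb[OF corners(4)] corner_absorb[OF corners(5)] corner_absorb[OF corners(6)]

lemmas products' = products(1-4,8-16) products(1-4,8-16)[THEN mult_assoc_eq]

lemma expand: "x \<in> corner e e \<Longrightarrow> x = i0 * (l0 * x * i0) * l0 + i0 * (l0 * x * i1) * l1 + i1 * (l1 * x * i0) * l0 + i1 * (l1 * x * i1) * l1"
proof -
  assume x: "x \<in> corner e e"
  have "x = (i0 * l0 + i1 * l1) * x * (i0 * l0 + i1 * l1)"
    unfolding products using corner_absorb[OF x] by simp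
  then show ?thesis by (simp add: distrib_left distrib_right mult.assoc algebra_simps)
qed

text \<open>In block form the centraliser consists of the matrices \<open>[[b, c], [0, b]]\<close>,
  that is of the elements \<open>b + c \<epsilon>\<close>.\<close>

lemma cent_N_comps:
  assumes "x \<in> cent e N"
  shows "l1 * x * i0 = 0" "l1 * x * i1 = l0 * x * i0" "x = i0 * (l0 * x * i0) * l0 + i1 * (l0 * x * i0) * l1 + i0 * (l0 * x * i1) * l1"
proof -
  have x: "x \<in> corner e e" "x * N = N * x" using assms by (auto simp: cent_def)
  have "l1 * x * i0 = l1 * (x * N) * i1" by (simp add: mult.assoc products')
  also have "\<dots> = 0" unfolding x(2) by (simp add: mult.assoc products')
  finally show 1: "l1 * x * i0 = 0" .
  have "l1 * x * i1 = l0 * (N * x) * i1" by (simp add: mult.assoc products')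
  also have "\<dots> = l0 * x * i0" unfolding x(2)[symmetric] by (simp add: mult.assoc products')
  finally show 2: "l1 * x * i1 = l0 * x * i0" .
  show "x = i0 * (l0 * x * i0) * l0 + i1 * (l0 * x * i0) * l1 + i0 * (l0 * x * i1) * l1"
    using expand[OF x(1)] by (simp add: 1 2 add_ac)
qed

lemma cent_N_in:
  assumes "b \<in> corner f f" "c \<in> corner f f"
  shows "i0 * b * l0 + i1 * b * l1 + i0 * c * l1 \<in> cent e N"
  unfolding cent_def
proof (intro CollectI conjI)
  show "i0 * b * l0 + i1 * b * l1 + i0 * c * l1 \<in> corner e e"
    by (intro corner_add corner_mult[OF corner_mult[OF corners(1) assms(1)] corners(3)]
        corner_mult[OF corner_mult[OF corners(2) assms(1)] corners(4)]
        corner_mult[OF corner_mult[OF corners(1) assms(2)] corners(4)])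
  show "(i0 * b * l0 + i1 * b * l1 + i0 * c * l1) * N = N * (i0 * b * l0 + i1 * b * l1 + i0 * c * l1)"
    by (simp add: distrib_left distrib_right mult.assoc products')
qed

text \<open>The functional is \<open>b + c \<epsilon> \<mapsto> tr (Q * b) + tr (P * c)\<close>. The
  two conclusions are the coefficients of the statement that \<open>b + c \<epsilon>\<close>
  commutes with \<open>P + Q \<epsilon>\<close>.\<close>

lemma st_cent_N:
  assumes x: "x \<in> st (cent e N) (i0 * Q * l0 + i1 * P * l0)" and Q: "Q \<in> corner f f" and P: "P \<in> corner f f"
    and b_def: "b = l0 * x * i0" and c_def: "c = l0 * x * i1"
  shows "P * b = b * P" "Q * b - b * Q + (P * c - c * P) = 0"
proof -
  have xc: "x \<in> cent e N" using x by (simp add: st_def)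
  then have "x \<in> corner e e" by (simp add: cent_def)
  then have bc: "b \<in> corner f f" and cc: "c \<in> corner f f" unfolding b_def c_def
    by (auto intro: corner_mult[OF corner_mult[OF corners(3)] corners(1)] corner_mult[OF corner_mult[OF corners(3)] corners(2)])
  have xe: "x = i0 * b * l0 + i1 * b * l1 + i0 * c * l1"
    unfolding b_def c_def by (rule cent_N_comps(3)[OF xc])
  have form: "tr ((Q * b - b * Q + (P * c - c * P)) * b') + tr ((P * b - b * P) * c') = 0"
    if b': "b' \<in> corner f f" and c': "c' \<in> corner f f" for b' c'
  proof -
    let ?x' = "i0 * b' * l0 + i1 * b' * l1 + i0 * c' * l1"
    note ab = corner_absorb[OF bc] corner_absorb[OF cc] corner_absorb[OF b'] corner_absorb[OF c']
    have br: "x * ?x' - ?x' * x = i0 * (b * b' - b' * b) * l0 + i1 * (b * b' - b' * b) * l1 + i0 * (b * c' + c * b' - b' * c - c' * b) * l1"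
      unfolding xe by (simp add: distrib_left distrib_right left_diff_distrib right_diff_distrib mult.assoc products' ab algebra_simps)
    have trf: "tr ((i0 * Q * l0 + i1 * P * l0) * (i0 * u * l0 + i1 * u * l1 + i0 * v * l1)) = tr (Q * u) + tr (P * v)"
      if "u \<in> corner f f" "v \<in> corner f f" for u v
    proof -
      note uv = corner_absorb[OF that(1)] corner_absorb[OF that(2)]
      have "(i0 * Q * l0 + i1 * P * l0) * (i0 * u * l0 + i1 * u * l1 + i0 * v * l1) =
          i0 * (Q * u * l0) + i0 * (Q * v * l1) + i1 * (P * u * l0) + i1 * (P * v * l1)"
        by (simp add: distrib_left distrib_right mult.assoc products' uv)
      then show ?thesis
        using corner_absorb[OF P] corner_absorb[OF Q] corner_absorb[OF that(1)] corner_absorb[OF that(2)]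
        by (simp add: tr_commute[of i0] tr_commute[of i1] mult.assoc products')
    qed
    have mem: "b * b' - b' * b \<in> corner f f" "b * c' + c * b' - b' * c - c' * b \<in> corner f f"
      by (intro corner_diff corner_add corner_mult[of _ f f] bc b' cc c')+
    have "tr ((i0 * Q * l0 + i1 * P * l0) * (x * ?x' - ?x' * x)) = 0"
      using x cent_N_in[OF b' c'] by (simp add: st_def)
    then have "tr (Q * (b * b' - b' * b)) + tr (P * (b * c' + c * b' - b' * c - c' * b)) = 0"
      unfolding br trf[OF mem] .
    then show ?thesis
      using tr_commute[of "Q * b'" b] tr_commute[of "P * b'" c] tr_commute[of "P * c'" b]
      by (simp add: left_diff_distrib right_diff_distrib distrib_left distrib_right mult.assoc algebra_simps)
  qed
  have "P * b - b * P = 0"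
    using form[OF corner_0]
    by (intro corner_nondegenerate[of _ f f, OF _ ff ff] corner_diff corner_mult[OF P bc] corner_mult[OF bc P]) auto
  then show "P * b = b * P" by simp
  show "Q * b - b * Q + (P * c - c * P) = 0"
    using form[OF _ corner_0]
    by (intro corner_nondegenerate[of _ f f, OF _ ff ff] corner_diff corner_add corner_mult[of _ f f] P Q bc cc) auto
qed

lemma fin_span_cent: "fin_span (cent e N)"
  by (rule fin_span_subset[OF fin_span_corner[OF finI finI]]) (auto simp: cent_def e_def)

lemma column_space:
  "fm.dim (corner e (idm {y 0})) = 2 * n" "fin_span (corner e (idm {y 0}))"
  unfolding e_def using dim_corner_column[OF finI] cardI by (auto intro: fin_span_corner finI)

lemma columns_in:
  assumes "b \<in> corner f f" "c \<in> corner f f"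
  shows "i0 * b * mu (y 0) (y 0) + i1 * c * mu (y 0) (y 0) \<in> corner e (idm {y 0})"
  by (intro corner_add corner_mult[OF corner_mult[OF corners(1) assms(1)]]
      corner_mult[OF corner_mult[OF corners(2) assms(2)]]) (simp_all add: f_def column_unit)

lemma columns_zero:
  assumes "b \<in> corner f f" "c \<in> corner f f" "i0 * b * m + i1 * c * m = 0"
  shows "b * m = 0" "c * m = 0"
  using arg_cong[OF assms(3), of "\<lambda>x. l0 * x"] arg_cong[OF assms(3), of "\<lambda>x. l1 * x"]
    corner_absorb[OF assms(1)] corner_absorb[OF assms(2)]
  by (simp_all add: distrib_left mult.assoc products')

text \<open>With \<open>Q = 0\<close> and the shift as \<open>P\<close>, both \<open>b\<close> and
  \<open>c\<close> commute with the shift. Their columns at \<open>y 0\<close>, stacked into one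
  column of height \<open>2 * n\<close>, determine the element.\<close>

lemma st_cent_upper: "fm.dim (st (cent e N) (i1 * shift y n * l0)) \<le> 2 * n"
proof -
  define \<phi> where "\<phi> x = (i0 * l0) * x * (i0 * mu (y 0) (y 0)) + (i1 * l0) * x * (i1 * mu (y 0) (y 0))" for x
  have "lin \<phi>" unfolding \<phi>_def by (intro lin_add linear_sandwich)
  then show ?thesis
    unfolding column_space(1)[symmetric]
  proof (rule dim_le_of_inj)
    show "fm.subspace (st (cent e N) (i1 * shift y n * l0))" by (rule subspace_st[OF subspace_cent])
    show "fin_span (corner e (idm {y 0}))" by (rule column_space)
    fix x assume x: "x \<in> st (cent e N) (i1 * shift y n * l0)"
    then have xc: "x \<in> cent e N" by (simp add: st_def)
    define b where "b = l0 * x * i0"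
    define c where "c = l0 * x * i1"
    have "x \<in> corner e e" using xc by (simp add: cent_def)
    then have bc: "b \<in> corner f f" and cc: "c \<in> corner f f" unfolding b_def c_def
      by (auto intro: corner_mult[OF corner_mult[OF corners(3)] corners(1)] corner_mult[OF corner_mult[OF corners(3)] corners(2)])
    have eq: "\<phi> x = i0 * b * mu (y 0) (y 0) + i1 * c * mu (y 0) (y 0)"
      by (simp add: \<phi>_def b_def c_def mult.assoc)
    show "\<phi> x \<in> corner e (idm {y 0})"
      unfolding eq by (rule columns_in[OF bc cc])
    assume "\<phi> x = 0"
    then have 0: "b * mu (y 0) (y 0) = 0" "c * mu (y 0) (y 0) = 0"
      using columns_zero[OF bc cc] unfolding eq by auto
    have "shift y n * b = b * shift y n" "shift y n * c - c * shift y n = 0"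
      using st_cent_N[of x 0 "shift y n", OF _ corner_0 shift_in b_def c_def] x by simp_all
    then have "b = 0" "c = 0"
      using commutant_determined[OF inv_shift shift_in] bc cc 0 by auto
    then show "x = 0" using cent_N_comps(3)[OF xc] by (simp add: b_def[symmetric] c_def[symmetric])
  qed
qed

text \<open>The element \<open>z = N * \<alpha> + \<alpha> * N\<close> of the centraliser represents
  the functional, and modulo \<epsilon> it is \<open>z0\<close>. If \<open>y 0\<close> is cyclic for
  \<open>z0\<close>, the powers of \<open>z\<close> with exponents below \<open>n\<close> and their
  multiples by \<open>N\<close> are \<open>2 * n\<close> independent elements commuting with
  \<open>N\<close> and \<open>z\<close>.\<close>

lemma st_cent_lower:
  assumes inv: "inv_in f (kry y n f (l1 * \<gamma> * i0))"
  shows "2 * n \<le> fm.dim (st (cent e N) \<gamma>)"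
proof -
  define \<alpha> where "\<alpha> = e * \<gamma> * e"
  have \<alpha>c: "\<alpha> \<in> corner e e" unfolding \<alpha>_def by (intro corner_cut ee)
  define z0 where "z0 = l1 * \<gamma> * i0"
  define z where "z = N * \<alpha> + \<alpha> * N"
  have zc: "z \<in> corner e e" unfolding z_def
    by (intro corner_add corner_mult[OF corners(5) \<alpha>c] corner_mult[OF \<alpha>c corners(5)])
  have zN: "z * N = N * z" by (simp add: z_def distrib_left distrib_right mult.assoc products')
  have l1z: "l1 * z = z0 * l1"
    by (simp add: z_def z0_def \<alpha>_def distrib_left mult.assoc products' products(5) absorb)
  have l1zp: "l1 * zp e z i = zp f z0 i * l1" for i
    by (induction i) (simp_all add: absorb mult.assoc mult_assoc_eq[OF l1z])
  have zpc: "zp e z i \<in> corner e e" for i by (rule zp_corner[OF ee zc])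
  have zpN: "N * zp e z i = zp e z i * N" for i
    using zp_commute[of e z N i] corner_absorb[OF zc] absorb zN by simp
  have zpz: "z * zp e z i = zp e z i * z" for i
    using zp_commute[of e z z i] corner_absorb[OF zc] by simp
  define g where "g c = (\<Sum>i<n. sc (c i) (zp e z i))" for c
  have g0: "c i = 0" if "l1 * g c * i1 = 0" "i < n" for c i
  proof (rule powers_independent[OF inv[folded z0_def] _ that(2)])
    have "l1 * g c * i1 = (\<Sum>i<n. sc (c i) (zp f z0 i * f))"
      by (simp add: g_def sum_distrib_left sum_distrib_right l1zp mult.assoc products)
    moreover have "zp f z0 i * f = zp f z0 i" for i
    proof (rule corner_absorb(2)[OF zp_corner[OF ff]])
      have "z0 = l1 * \<alpha> * i0" by (simp add: z0_def \<alpha>_def mult.assoc absorb)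
      then show "z0 \<in> corner f f" using corner_mult[OF corner_mult[OF corners(4) \<alpha>c] corners(1)] by simp
    qed
    ultimately show "(\<Sum>i<n. sc (c i) (zp f z0 i)) = 0" using that(1) by simp
  qed
  have gc: "g c \<in> corner e e" for c
    unfolding g_def by (intro fm.subspace_sum[OF subspace_corner] fm.subspace_scale[OF subspace_corner] zpc)
  have gN: "N * g c = g c * N" and gz: "z * g c = g c * z" for c
    unfolding g_def sum_distrib_left sum_distrib_right by (simp_all add: zpN zpz)
  define \<psi> where "\<psi> w = g (\<lambda>i. ent (l1 * w) (y i) (y 0)) + N * g (\<lambda>i. ent (l0 * w) (y i) (y 0))" for w
  show ?thesis
    unfolding column_space(1)[symmetric]
  proof (rule dim_le_of_inj[of \<psi>])
    show "lin \<psi>"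
      unfolding \<psi>_def g_def
      by (intro linI)
         (simp_all add: distrib_left fm.scale_left_distrib sum.distrib fm.scale_sum_right sum_distrib_left fm.scale_right_distrib)
    show "fm.subspace (corner e (idm {y 0}))" by (rule subspace_corner)
    show "fin_span (st (cent e N) \<gamma>)" by (rule fin_span_subset[OF fin_span_cent]) (auto simp: st_def)
    fix w assume w: "w \<in> corner e (idm {y 0})"
    define x where "x = \<psi> w"
    have xc: "x \<in> corner e e"
      unfolding x_def \<psi>_def by (intro corner_add gc corner_mult[OF corners(5) gc])
    have xN: "x * N = N * x"
      unfolding x_def \<psi>_def by (simp add: distrib_left distrib_right gN mult_assoc_eq[OF gN] mult.assoc products')
    have xz: "z * x = x * z"
    proof -
      have "z * (N * g c) = N * g c * z" for c by (simp add: mult_assoc_eq[OF zN] mult.assoc gz)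
      then show ?thesis unfolding x_def \<psi>_def by (simp add: distrib_left distrib_right gz)
    qed
    show "\<psi> w \<in> st (cent e N) \<gamma>"
      unfolding st_def x_def[symmetric]
    proof (intro CollectI conjI ballI)
      show "x \<in> cent e N" using xc xN by (simp add: cent_def)
      fix A assume "A \<in> cent e N"
      then have A: "A \<in> corner e e" "A * N = N * A" by (auto simp: cent_def)
      define \<zeta> where "\<zeta> = \<alpha> * x - x * \<alpha>"
      \<comment> \<open>Every \<open>A\<close> in the centraliser has the form
        \<open>N * W + W * N\<close>. Rotating \<open>N\<close> under the trace replaces the pairing
        of \<open>[\<alpha>, x]\<close> with \<open>A\<close> by the pairing of
        \<open>[z, x]\<close> with \<open>W\<close>.\<close>
      define W where "W = i1 * l0 * A"
      have "N * W + W * N = (i0 * l0 + i1 * l1) * A"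
        by (simp add: W_def mult.assoc products' A(2) distrib_right)
      then have AW: "A = N * W + W * N" unfolding products using corner_absorb[OF A(1)] by simp
      have "tr (\<gamma> * (x * A - A * x)) = tr (\<alpha> * (x * A - A * x))"
        unfolding \<alpha>_def by (intro tr_corner corner_diff corner_mult[OF xc A(1)] corner_mult[OF A(1) xc])
      also have "\<dots> = tr (\<zeta> * A)"
        using tr_commute[of "\<alpha> * A" x] by (simp add: \<zeta>_def left_diff_distrib right_diff_distrib mult.assoc)
      also have "\<dots> = tr ((\<zeta> * N + N * \<zeta>) * W)"
        unfolding AW using tr_commute[of "\<zeta> * W" N] by (simp add: distrib_left distrib_right mult.assoc)
      also have "\<zeta> * N + N * \<zeta> = z * x - x * z"
        by (simp add: \<zeta>_def z_def distrib_left distrib_right left_diff_distrib right_diff_distrib mult.assoc xN mult_assoc_eq[OF xN])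
      finally show "tr (\<gamma> * (x * A - A * x)) = 0" by (simp add: xz)
    qed
    assume "\<psi> w = 0"
    define c where "c = (\<lambda>i. ent (l1 * w) (y i) (y 0))"
    define d where "d = (\<lambda>i. ent (l0 * w) (y i) (y 0))"
    have 0: "g c + N * g d = 0" using \<open>\<psi> w = 0\<close> by (simp add: \<psi>_def c_def d_def)
    \<comment> \<open>Because \<open>l1 * N = 0\<close>, this compression removes the multiple of
      \<open>N\<close> and shows that the coefficients \<open>c\<close> vanish. Then
      \<open>l0 * N = l1\<close> exposes the coefficients \<open>d\<close> in the same way.\<close>
    have "l1 * (g c + N * g d) * i1 = l1 * g c * i1"
      by (simp add: distrib_left distrib_right mult.assoc products')
    then have c0: "c i = 0" if "i < n" for i using g0[OF _ that] 0 by simp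
    then have "g c = 0" by (simp add: g_def)
    then have "l0 * (N * g d) * i1 = 0" using 0 by simp
    then have "l1 * g d * i1 = 0" by (simp add: products')
    then have d0: "d i = 0" if "i < n" for i using g0[OF _ that] by simp
    have z: "v = 0" if v: "v \<in> corner f (idm {y 0})" "\<And>i. i < n \<Longrightarrow> ent v (y i) (y 0) = 0" for v
    proof (rule fmat_eqI)
      fix i j
      show "ent v i j = ent 0 i j"
      proof (rule ccontr)
        assume a: "ent v i j \<noteq> ent 0 i j"
        then have "i \<in> \<phi> ` K" "j = y 0" using v(1) finJ by (auto simp: f_def corner_idm_iff)
        then obtain k where "k < n" "i = y k" unfolding image[symmetric] by auto
        then show False using a v(2)[of k] \<open>j = y 0\<close> by simp
      qed
    qed
    have "l1 * w = 0" "l0 * w = 0"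
      using z[OF corner_mult[OF corners(4) w]] z[OF corner_mult[OF corners(3) w]] c0 d0 by (auto simp: c_def d_def)
    then have "(i0 * l0 + i1 * l1) * w = 0" by (simp add: distrib_right mult.assoc)
    then show "w = 0" unfolding products using corner_absorb[OF w] by simp
  qed
qed

text \<open>\<open>N\<close> and \<open>N'\<close> generate the 2 by 2 matrices acting on the pair
  of copies, so commuting with both leaves one and the same block on each copy.\<close>

definition Sq :: "('i, 'a) fmat set" where "Sq = cent e N \<inter> cent e N'"

lemma Sq_iff: "x \<in> Sq \<longleftrightarrow> (\<exists>a\<in>corner f f. x = i0 * a * l0 + i1 * a * l1)"
proof
  assume x: "x \<in> Sq"
  then have xc: "x \<in> cent e N" "x \<in> corner e e" "x * N' = N' * x" by (auto simp: Sq_def cent_def)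
  have "l0 * x * i1 = l0 * (x * N') * i0" by (simp add: mult.assoc products')
  also have "\<dots> = 0" unfolding xc(3) by (simp add: mult.assoc products')
  finally have "x = i0 * (l0 * x * i0) * l0 + i1 * (l0 * x * i0) * l1"
    using cent_N_comps(3)[OF xc(1)] by simp
  moreover have "l0 * x * i0 \<in> corner f f" by (rule corner_mult[OF corner_mult[OF corners(3) xc(2)] corners(1)])
  ultimately show "\<exists>a\<in>corner f f. x = i0 * a * l0 + i1 * a * l1" by blast
next
  assume "\<exists>a\<in>corner f f. x = i0 * a * l0 + i1 * a * l1"
  then obtain a where a: "a \<in> corner f f" "x = i0 * a * l0 + i1 * a * l1" by blast
  then have 1: "x \<in> cent e N" using cent_N_in[OF a(1) corner_0] by simp
  then have "x \<in> corner e e" by (simp add: cent_def)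
  moreover have "x * N' = N' * x" by (simp add: a(2) distrib_left distrib_right mult.assoc products')
  ultimately show "x \<in> Sq" using 1 by (simp add: Sq_def cent_def)
qed

lemma triangular_Sq: "triangular Sq e f"
proof
  show "fm.subspace Sq" unfolding Sq_def by (intro fm.subspace_inter subspace_cent)
  show "Sq \<subseteq> corner e e" by (auto simp: Sq_def cent_def)
qed (rule ee ff ef fe)+

lemma fin_span_tri_Sq: "fin_span (tri Sq e f)"
proof -
  interpret triangular Sq e f by (rule triangular_Sq)
  have "e + f = idm (I \<union> \<phi> ` K)"
    using finI finJ disj by (subst idm_Un) (auto simp: e_def f_def I_def)
  then have "fin_span (corner (e + f) (e + f))"
    using finI finJ by (simp add: fin_span_corner)
  then show ?thesis by (rule fin_span_subset[OF _ tri_subset])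
qed

text \<open>Here \<open>p\<close> is the pair \<open>(1, P)\<close> with \<open>P\<close> the shift.
  The block \<open>A\<close> repeats \<open>B\<close> on both copies, \<open>B\<close> commutes with
  \<open>P\<close>, and \<open>u\<close> has parts \<open>u0 = - P * u1\<close> and
  \<open>u1\<close>, where \<open>u1\<close> commutes with \<open>P\<close>. Only the columns of
  \<open>B\<close> and \<open>u1\<close> at the cyclic vector are free.\<close>

lemma st_Sq_upper: "fm.dim (st (tri Sq e f) (l0 + shift y n * l1)) \<le> 2 * n"
proof -
  interpret T: triangular Sq e f by (rule triangular_Sq)
  let ?P = "shift y n"
  define \<phi> where "\<phi> x = (i0 * f) * x * (f * mu (y 0) (y 0)) + (i1 * l1) * x * (f * mu (y 0) (y 0))" for x
  have "lin \<phi>" unfolding \<phi>_def by (intro lin_add linear_sandwich)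
  then show ?thesis
    unfolding column_space(1)[symmetric]
  proof (rule dim_le_of_inj)
    show "fm.subspace (st (tri Sq e f) (l0 + ?P * l1))" by (rule subspace_st[OF T.subspace_tri])
    show "fin_span (corner e (idm {y 0}))" by (rule column_space)
    fix x assume x: "x \<in> st (tri Sq e f) (l0 + ?P * l1)"
    then obtain A u B where xe: "x = A + u + B" and A: "A \<in> Sq" "A \<in> corner e e" and u: "u \<in> corner e f" and B: "B \<in> corner f f"
      by (rule T.st_triE)
    define p where "p = l0 + ?P * l1"
    have pc: "p \<in> corner f e" unfolding p_def by (intro corner_add corners corner_mult[OF shift_in corners(4)])
    have comp: "e * p * e = 0" "f * p * e = p" "f * p * f = 0"
      using T.components(4-6)[OF corner_0 corner_0 pc corner_0] by simp_all
    have eqs: "p * A = B * p" "p * u = 0" "\<And>A'. A' \<in> Sq \<Longrightarrow> tr (u * p * A') = 0"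
      using T.st_tri_iff[OF A(1) u B comp] x by (simp_all add: xe p_def[symmetric])
    obtain a where a: "a \<in> corner f f" "A = i0 * a * l0 + i1 * a * l1" using A(1) Sq_iff by blast
    note ab = corner_absorb[OF a(1)] corner_absorb[OF B] corner_absorb[OF u] corner_absorb[OF shift_in]
    have aB: "a = B"
      using arg_cong[OF eqs(1), of "\<lambda>x. x * i0"]
      by (simp add: a(2) p_def distrib_left distrib_right mult.assoc products' ab)
    have PB: "B * ?P = ?P * B"
      using arg_cong[OF eqs(1), of "\<lambda>x. x * i1"]
      by (simp add: a(2) p_def distrib_left distrib_right mult.assoc products' ab aB)
    define u0 where "u0 = l0 * u"
    define u1 where "u1 = l1 * u"
    have u0c: "u0 \<in> corner f f" and u1c: "u1 \<in> corner f f"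
      unfolding u0_def u1_def by (rule corner_mult[OF corners(3) u], rule corner_mult[OF corners(4) u])
    have e1: "u0 + ?P * u1 = 0" using eqs(2) by (simp add: p_def u0_def u1_def distrib_right mult.assoc)
    have e2: "u0 + u1 * ?P = 0"
    proof (rule corner_nondegenerate[of _ f f, OF _ ff ff])
      show "u0 + u1 * ?P \<in> corner f f" by (intro corner_add u0c corner_mult[OF u1c shift_in])
      fix a' assume a': "a' \<in> corner f f"
      have "i0 * a' * l0 + i1 * a' * l1 \<in> Sq" using a' Sq_iff by blast
      then have "0 = tr (u * p * (i0 * a' * l0 + i1 * a' * l1))" using eqs(3) by simp
      also have "\<dots> = tr (u * (a' * l0)) + tr (u * (?P * (a' * l1)))"
        using corner_absorb[OF a'] by (simp add: p_def distrib_left distrib_right mult.assoc products' ab)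
      also have "tr (u * (a' * l0)) = tr (u0 * a')"
        using tr_commute[of "u * a'" l0] by (simp add: u0_def mult.assoc)
      also have "tr (u * (?P * (a' * l1))) = tr (u1 * ?P * a')"
        using tr_commute[of "u * ?P * a'" l1] by (simp add: u1_def mult.assoc)
      finally show "tr ((u0 + u1 * ?P) * a') = 0" by (simp add: distrib_right)
    qed
    have Pu: "u1 * ?P = ?P * u1" using e1 e2 by (metis add_left_cancel)
    have eq: "\<phi> x = i0 * B * mu (y 0) (y 0) + i1 * u1 * mu (y 0) (y 0)"
    proof -
      have "f * x * f = B" "e * x * f = u" using T.components[OF A(2) u corner_0 B] by (simp_all add: xe)
      moreover have "\<phi> x = i0 * (f * x * f) * mu (y 0) (y 0) + i1 * (l1 * (e * x * f)) * mu (y 0) (y 0)"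
        by (simp add: \<phi>_def mult.assoc absorb)
      ultimately show ?thesis by (simp add: u1_def)
    qed
    show "\<phi> x \<in> corner e (idm {y 0})"
      unfolding eq by (rule columns_in[OF B u1c])
    assume "\<phi> x = 0"
    then have 0: "B * mu (y 0) (y 0) = 0" "u1 * mu (y 0) (y 0) = 0"
      using columns_zero[OF B u1c] unfolding eq by auto
    then have "B = 0" "u1 = 0"
      using commutant_determined[OF inv_shift shift_in B PB] commutant_determined[OF inv_shift shift_in u1c Pu] by auto
    moreover have "u0 = 0" using e1 \<open>u1 = 0\<close> by simp
    moreover have "u = (i0 * l0 + i1 * l1) * u" unfolding products using ab by simp
    ultimately have "u = 0" by (simp add: distrib_right mult.assoc u0_def[symmetric] u1_def[symmetric])
    then show "x = 0" using \<open>B = 0\<close> aB by (simp add: xe a(2))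
  qed
qed

text \<open>Write \<open>p\<close> as a pair \<open>p1\<close>, \<open>p2\<close> with
  \<open>p1\<close> invertible and inverse \<open>g\<close>. The first equation makes
  \<open>A\<close> conjugate to \<open>B = b\<close> by \<open>p1\<close>, and requires
  \<open>b\<close> to commute with \<open>P = p2 * g\<close>. Eliminating \<open>u0\<close> by the
  second equation and putting \<open>c = p1 * u1\<close>, the trace condition becomes the other
  coefficient of the statement that \<open>b + c \<epsilon>\<close> commutes with
  \<open>P + Q \<epsilon>\<close>. So the lower bound for \<open>gl_n(K[\<epsilon>])\<close> carries
  over.\<close>

lemma st_cent_le_st_Sq:
  assumes comp: "e * \<gamma> * e = \<alpha>" "f * \<gamma> * e = p" "f * \<gamma> * f = \<beta>"
    and g: "g \<in> corner f f" "p * i0 * g = f" "g * (p * i0) = f"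
  defines "Q \<equiv> p * i0 * (l0 * \<alpha> * i0 + l1 * \<alpha> * i1) * g + \<beta>" and "P \<equiv> p * i1 * g"
  shows "fm.dim (st (cent e N) (i0 * Q * l0 + i1 * P * l0)) \<le> fm.dim (st (tri Sq e f) \<gamma>)"
proof -
  interpret T: triangular Sq e f by (rule triangular_Sq)
  have \<alpha>c: "\<alpha> \<in> corner e e" and pc: "p \<in> corner f e" and \<beta>c: "\<beta> \<in> corner f f"
    unfolding comp[symmetric] by (auto intro: corner_cut ee ff)
  define p1 where "p1 = p * i0"
  define p2 where "p2 = p * i1"
  define \<alpha>s where "\<alpha>s = l0 * \<alpha> * i0 + l1 * \<alpha> * i1"
  have p1c: "p1 \<in> corner f f" and p2c: "p2 \<in> corner f f"
    unfolding p1_def p2_def by (rule corner_mult[OF pc corners(1)], rule corner_mult[OF pc corners(2)])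
  have \<alpha>sc: "\<alpha>s \<in> corner f f" unfolding \<alpha>s_def
    by (intro corner_add corner_mult[OF corner_mult[OF corners(3) \<alpha>c] corners(1)] corner_mult[OF corner_mult[OF corners(4) \<alpha>c] corners(2)])
  have pe: "p = p1 * l0 + p2 * l1"
  proof -
    have "p = p * (i0 * l0 + i1 * l1)" unfolding products using corner_absorb[OF pc] by simp
    then show ?thesis by (simp add: p1_def p2_def distrib_left mult.assoc)
  qed
  note gp = g(2,3)[folded p1_def] g(2,3)[folded p1_def, THEN mult_assoc_eq]
  have Qe: "Q = p1 * \<alpha>s * g + \<beta>" and Pe: "P = p2 * g" by (simp_all add: Q_def P_def p1_def p2_def \<alpha>s_def)
  have Pp: "P * p1 = p2" using corner_absorb[OF p2c] by (simp add: Pe mult.assoc gp)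
  have Qc: "Q \<in> corner f f" and Pc: "P \<in> corner f f"
    unfolding Qe Pe by (intro corner_add corner_mult[of _ f f] p1c p2c \<alpha>sc \<beta>c g(1))+
  define \<phi> where "\<phi> x = (i0 * g * l0) * x * (i0 * p1 * l0) + (i1 * g * l0) * x * (i0 * p1 * l1)
    + (- (i0 * g * \<beta> * l0)) * x * i0 + (i0 * g * l0) * x * (i0 * \<beta>) + (- (i0 * g * P * l0)) * x * i1
    + (i1 * g * l0) * x * i1 + l0 * x * i0" for x
  show ?thesis
  proof (rule st_dim_le[of \<phi>, OF _ subspace_cent fin_span_tri_Sq])
    show "lin \<phi>" unfolding \<phi>_def by (intro lin_add linear_sandwich)
    fix x assume x: "x \<in> st (cent e N) (i0 * Q * l0 + i1 * P * l0)"
    then have xc: "x \<in> cent e N" by (simp add: st_def)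
    define b where "b = l0 * x * i0"
    define c where "c = l0 * x * i1"
    have "x \<in> corner e e" using xc by (simp add: cent_def)
    then have bc: "b \<in> corner f f" and cc: "c \<in> corner f f" unfolding b_def c_def
      by (auto intro: corner_mult[OF corner_mult[OF corners(3)] corners(1)] corner_mult[OF corner_mult[OF corners(3)] corners(2)])
    have Pb: "P * b = b * P" and Qb: "Q * b - b * Q + (P * c - c * P) = 0"
      using st_cent_N[OF x Qc Pc b_def c_def] by auto
    define a where "a = g * b * p1"
    define u0 where "u0 = g * (b * \<beta> - \<beta> * b - P * c)"
    define u1 where "u1 = g * c"
    have ac: "a \<in> corner f f" and u0c: "u0 \<in> corner f f" and u1c: "u1 \<in> corner f f"
      unfolding a_def u0_def u1_def by (intro corner_diff corner_mult[of _ f f] g(1) bc cc p1c \<beta>c Pc)+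
    define A where "A = i0 * a * l0 + i1 * a * l1"
    define u where "u = i0 * u0 + i1 * u1"
    have A: "A \<in> Sq" unfolding A_def using ac Sq_iff by blast
    then have Ac: "A \<in> corner e e" using T.S_corner by blast
    have uc: "u \<in> corner e f"
      unfolding u_def by (intro corner_add corner_mult[OF corners(1) u0c] corner_mult[OF corners(2) u1c])
    note ab = corner_absorb[OF ac] corner_absorb[OF u0c] corner_absorb[OF u1c] corner_absorb[OF bc] corner_absorb[OF cc]
      corner_absorb[OF \<beta>c] corner_absorb[OF Pc] corner_absorb[OF p1c]
    have E1: "p * A = b * p"
    proof -
      have "p * A = p1 * a * l0 + p2 * a * l1"
        by (simp add: pe A_def distrib_left distrib_right mult.assoc products' ab)
      also have "p1 * a = b * p1" by (simp add: a_def mult.assoc gp ab)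
      also have "p2 * a = b * p2"
      proof -
        have "p2 * a = P * b * p1" by (simp add: a_def Pe mult.assoc)
        also have "\<dots> = b * p2" unfolding Pb by (simp add: mult.assoc Pp)
        finally show ?thesis .
      qed
      finally show ?thesis by (simp add: pe distrib_left mult.assoc)
    qed
    have E2: "\<beta> * b - b * \<beta> + p * u = 0"
    proof -
      have "p * u = p1 * u0 + p2 * u1"
        by (simp add: pe u_def distrib_left distrib_right mult.assoc products' ab)
      also have "p1 * u0 = b * \<beta> - \<beta> * b - P * c"
        by (simp add: u0_def mult.assoc gp right_diff_distrib ab)
      also have "p2 * u1 = P * c" by (simp add: u1_def Pe mult.assoc)
      finally show ?thesis by simp
    qed
    have E3: "tr ((\<alpha> * A - A * \<alpha> - u * p) * A') = 0" if A': "A' \<in> Sq" for A'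
    proof -
      obtain a' where a': "a' \<in> corner f f" "A' = i0 * a' * l0 + i1 * a' * l1" using A' Sq_iff by blast
      have 1: "tr (Z * A') = tr ((l0 * Z * i0 + l1 * Z * i1) * a')" for Z
      proof -
        have "tr (Z * (i0 * a' * l0)) = tr (l0 * Z * i0 * a')" "tr (Z * (i1 * a' * l1)) = tr (l1 * Z * i1 * a')"
          using tr_commute[of "Z * i0 * a'" l0] tr_commute[of "Z * i1 * a'" l1] by (simp_all only: mult.assoc)
        then show ?thesis unfolding a'(2) distrib_left distrib_right tr_add by simp
      qed
      have 2: "l0 * (\<alpha> * A - A * \<alpha> - u * p) * i0 = l0 * \<alpha> * i0 * a - a * (l0 * \<alpha> * i0) - u0 * p1"
        "l1 * (\<alpha> * A - A * \<alpha> - u * p) * i1 = l1 * \<alpha> * i1 * a - a * (l1 * \<alpha> * i1) - u1 * p2"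
        by (simp_all add: A_def u_def p1_def p2_def distrib_left distrib_right left_diff_distrib right_diff_distrib
            mult.assoc products' ab)
      have 3: "\<alpha>s * a - a * \<alpha>s - (u0 * p1 + u1 * p2) = g * (Q * b - b * Q + (P * c - c * P)) * p1"
        using corner_absorb[OF \<alpha>sc]
        by (simp add: a_def u0_def u1_def Qe Pp[symmetric] distrib_left distrib_right left_diff_distrib right_diff_distrib
            mult.assoc gp ab)
      have "l0 * (\<alpha> * A - A * \<alpha> - u * p) * i0 + l1 * (\<alpha> * A - A * \<alpha> - u * p) * i1 = \<alpha>s * a - a * \<alpha>s - (u0 * p1 + u1 * p2)"
        unfolding 2 \<alpha>s_def by (simp add: distrib_left distrib_right)
      with 1[of "\<alpha> * A - A * \<alpha> - u * p"] show ?thesis by (simp add: 3 Qb)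
    qed
    have \<phi>: "\<phi> x = A + u + b"
    proof -
      have "\<phi> x = i0 * g * (l0 * x * i0) * p1 * l0 + i1 * g * (l0 * x * i0) * p1 * l1
          - i0 * g * \<beta> * (l0 * x * i0) + i0 * g * (l0 * x * i0) * \<beta> - i0 * g * P * (l0 * x * i1)
          + i1 * g * (l0 * x * i1) + l0 * x * i0"
        by (simp add: \<phi>_def mult.assoc)
      then show ?thesis unfolding b_def[symmetric] c_def[symmetric]
        by (simp add: A_def u_def a_def u0_def u1_def right_diff_distrib mult.assoc)
    qed
    show "\<phi> x \<in> st (tri Sq e f) \<gamma>"
      unfolding \<phi> using E1 E2 E3 by (subst T.st_tri_iff[OF A uc bc comp]) simp
    assume "\<phi> x = 0"
    then have 0: "u = 0" "b = 0" using T.components[OF Ac uc corner_0 bc] unfolding \<phi> by auto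
    have "u1 = l1 * u" by (simp add: u_def distrib_left products' ab)
    then have "p1 * u1 = 0" using 0 by simp
    then have "c = 0" by (simp add: u1_def gp ab)
    then show "x = 0" using cent_N_comps(3)[OF xc] 0 by (simp add: b_def[symmetric] c_def[symmetric])
  qed
qed

end

section \<open>Index relations\<close>

lemma idm_eq_pm_id: "finite I \<Longrightarrow> idm I = pm I id id"
  using idm_eq_pm[of I id] by simp

lemma has_indexD: "has_index A k \<Longrightarrow> k \<le> fm.dim (st A \<gamma>)"
  by (simp add: has_index_def)

lemma has_index_exists: "\<exists>k. has_index A k"
proof -
  define k where "k = (LEAST k. \<exists>\<gamma>. fm.dim (st A \<gamma>) = k)"
  have "\<exists>\<gamma>. fm.dim (st A \<gamma>) = k" unfolding k_def by (rule LeastI_ex) blast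
  moreover have "k \<le> fm.dim (st A \<gamma>)" for \<gamma> unfolding k_def by (rule Least_le) blast
  ultimately show ?thesis unfolding has_index_def by (metis order_refl)
qed

lemma triangularI_idm:
  assumes "finite I" "finite J" "I \<inter> J = {}" "fm.subspace S" "S \<subseteq> corner (idm I) (idm I)"
  shows "triangular S (idm I) (idm J)"
proof
  have "idm {} = (0 :: ('a, 'b) fmat)" by (intro fmat_eqI) (simp add: ent_idm)
  then show "idm I * idm J = (0 :: ('a, 'b) fmat)" "idm J * idm I = (0 :: ('a, 'b) fmat)"
    using assms(1-3) by (simp_all add: idm_mult_idm Int_commute)
qed (use assms in \<open>auto simp: idm_mult_idm\<close>)

lemma fin_span_tri:
  assumes "finite I" "finite J" "I \<inter> J = {}" "fm.subspace S" "S \<subseteq> corner (idm I) (idm I)"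
  shows "fin_span (tri S (idm I) (idm J))"
proof -
  interpret triangular S "idm I" "idm J" by (rule triangularI_idm[OF assms])
  have "fin_span (corner (idm I + idm J) (idm I + idm J))"
    using assms(1-3) by (simp add: fin_span_corner idm_Un[symmetric])
  then show ?thesis by (rule fin_span_subset[OF _ tri_subset])
qed

lemma inv_inE:
  assumes "inv_in e x"
  obtains g where "g \<in> corner e e" "x * g = e" "g * x = e"
  using assms by (auto simp: inv_in_def)

lemma inv_in_self: "e * e = e \<Longrightarrow> inv_in e e"
  by (auto simp: inv_in_def corner_def)

text \<open>Genericity is the invertibility of \<open>p * r0 + f'\<close>, that is of
  \<open>p\<close> completed by the basis vectors of \<open>J'\<close>. The inverse \<open>G\<close>
  supplies the left inverse \<open>r0 * G\<close> and the cokernel map \<open>f' * G\<close> of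
  \<open>p\<close>. At the coordinate map \<open>p0\<close> the completed matrix is the identity
  \<open>f\<close>.\<close>

lemma has_index_embedding:
  fixes S :: "('i, 'a :: field_char_0) fmat set"
  assumes fin: "finite I" "finite J" and IJ: "I \<inter> J = {}" and J': "J' \<subseteq> J" and card: "card (J - J') = card I"
    and S: "fm.subspace S" "S \<subseteq> corner (idm I) (idm I)"
    and idx: "has_index (tri S (idm I) (idm J')) k"
  shows "has_index (tri S (idm I) (idm J)) k"
proof -
  obtain h where h: "bij_betw h I (J - J')"
    using finite_same_card_bij[OF fin(1) _ card[symmetric]] fin(2) by blast
  define e where "e = (idm I :: ('i, 'a) fmat)"
  define f where "f = (idm J :: ('i, 'a) fmat)"
  define f' where "f' = (idm J' :: ('i, 'a) fmat)"
  have finJ': "finite J'" using J' fin(2) by (rule finite_subset)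
  have IJ': "I \<inter> J' = {}" using IJ J' by blast
  note T1 = triangularI_idm[OF fin IJ S, folded e_def f_def]
  note T2 = triangularI_idm[OF fin(1) finJ' IJ' S, folded e_def f'_def]
  interpret T1: triangular S e f by (rule T1)
  interpret T2: triangular S e f' by (rule T2)
  note F1 = fin_span_tri[OF fin IJ S, folded e_def f_def]
  note F2 = fin_span_tri[OF fin(1) finJ' IJ' S, folded e_def f'_def]
  note idx' = idx[folded e_def f'_def]
  define p0 where "p0 = (pm I h id :: ('i, 'a) fmat)"
  define r0 where "r0 = (pm I id h :: ('i, 'a) fmat)"
  have hinj: "inj_on h I" and him: "h ` I = J - J'" using h by (auto simp: bij_betw_def)
  have p0c: "p0 \<in> corner f e" and r0c: "r0 \<in> corner e f" unfolding p0_def r0_def e_def f_def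
    by (rule pm_in_corner; use fin him in auto)+
  have ff': "f * f' = f'" "f' * f = f'"
    using J' fin(2) finJ' by (simp_all add: f_def f'_def idm_mult_idm Int_absorb1 Int_absorb2)
  have f'c: "f' \<in> corner f f" "f' \<in> corner f f'" "f' \<in> corner f' f"
    using ff' T2.ff by (auto simp: corner_def)
  have r0p0: "r0 * p0 = e" unfolding r0_def p0_def e_def by (simp add: pm_mult[OF fin(1) hinj] idm_eq_pm_id[OF fin(1)])
  have p0r0: "p0 * r0 + f' = f"
  proof -
    have "p0 * r0 = idm (J - J')"
      unfolding r0_def p0_def by (simp add: pm_mult[OF fin(1)] idm_eq_pm[OF fin(1) hinj, unfolded him])
    then have "p0 * r0 + f' = idm ((J - J') \<union> J')"
      unfolding f'_def using fin(2) finJ' by (subst idm_Un) auto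
    then show ?thesis using J' by (simp add: f_def Un_absorb2)
  qed
  have f'p0: "f' * p0 = 0" and r0f': "r0 * f' = 0"
  proof -
    show "f' * p0 = 0" "r0 * f' = 0"
      unfolding f'_def p0_def r0_def idm_eq_pm_id[OF finJ'] using him by (auto intro!: pm_mult_0)
  qed
  have lower: "k \<le> fm.dim (st (tri S e f) \<gamma>)" for \<gamma>
  proof (rule st_dim_ge_generic[where M = "\<lambda>\<gamma>. f * \<gamma> * e * r0 + f'" and J = J and ?\<gamma>1.0 = p0])
    show "poly_fam J J (\<lambda>t. f * line \<gamma>0 p0 t * e * r0 + f')" for \<gamma>0
      using f'c(1) r0c unfolding f_def e_def
      by (intro poly_fam_add poly_fam_mult[OF poly_fam_line] poly_fam_const fin)
    show "inv_in (idm J) (f * p0 * e * r0 + f')"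
      using corner_absorb[OF p0c] inv_in_self[OF T1.ff] by (simp add: p0r0) (simp add: f_def)
  next
    fix \<gamma> assume "inv_in (idm J) (f * \<gamma> * e * r0 + f')"
    then obtain G where G: "G \<in> corner f f" "(f * \<gamma> * e * r0 + f') * G = f" "G * (f * \<gamma> * e * r0 + f') = f"
      unfolding f_def[symmetric] by (rule inv_inE)
    define p where "p = f * \<gamma> * e"
    define g where "g = p * r0 + f'"
    note Gg = G(2,3)[folded p_def, folded g_def]
    define \<beta> where "\<beta> = f * \<gamma> * f"
    define \<alpha> where "\<alpha> = e * \<gamma> * e"
    have pc: "p \<in> corner f e" unfolding p_def by (intro corner_cut T1.ee T1.ff)
    have \<alpha>c: "\<alpha> \<in> corner e e" unfolding \<alpha>_def by (intro corner_cut T1.ee)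
    have \<beta>c: "\<beta> \<in> corner f f" unfolding \<beta>_def by (intro corner_cut T1.ff)
    have gc: "g \<in> corner f f" unfolding g_def by (intro corner_add corner_mult[OF pc r0c] f'c)
    have gp0: "g * p0 = p" using corner_absorb[OF pc] by (simp add: g_def distrib_right mult.assoc r0p0 f'p0)
    have gf': "g * f' = f'" by (simp add: g_def distrib_right mult.assoc r0f' T2.ff)
    have Gp: "G * p = p0" unfolding gp0[symmetric] using corner_absorb[OF p0c] by (simp add: mult.assoc[symmetric] Gg)
    have Gf': "G * f' = f'"
    proof -
      have "G * f' = G * g * f'" by (simp add: mult.assoc gf')
      then show ?thesis by (simp add: Gg ff')
    qed
    define r where "r = r0 * G"
    define kk where "kk = f' * G"
    have rc: "r \<in> corner e f" unfolding r_def by (rule corner_mult[OF r0c G(1)])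
    have kc: "kk \<in> corner f' f" unfolding kk_def by (rule corner_mult[OF f'c(3) G(1)])
    have prhk: "p * r + f' * kk = f"
    proof -
      have "p * r + f' * kk = (p * r0 + f') * G"
        by (simp add: r_def kk_def distrib_right mult.assoc mult_assoc_eq[OF T2.ff])
      then show ?thesis using Gg(1) by (simp add: g_def)
    qed
    let ?\<gamma>' = "(\<alpha> + r * \<beta> * p) + (kk * \<beta> * p) + (kk * \<beta> * f')"
    have c: "\<alpha> + r * \<beta> * p \<in> corner e e" "kk * \<beta> * p \<in> corner f' e" "kk * \<beta> * f' \<in> corner f' f'"
      by (intro corner_add \<alpha>c corner_mult[OF corner_mult[OF rc \<beta>c] pc] corner_mult[OF corner_mult[OF kc \<beta>c] pc]
          corner_mult[OF corner_mult[OF kc \<beta>c] f'c(2)])+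
    have "fm.dim (st (tri S e f) \<gamma>) = fm.dim (st (tri S e f') ?\<gamma>')"
      by (rule st_embedding_injective[OF T1 T2 F1 F2 pc rc f'c(2) kc _ _ _ _ prhk \<alpha>_def[symmetric] p_def[symmetric] \<beta>_def[symmetric]])
         (simp_all add: r_def kk_def mult.assoc Gp Gf' r0p0 f'p0 r0f' T2.ff,
          simp_all add: T2.components[OF c(1) corner_0 c(2,3)] mult.assoc[symmetric] r_def[symmetric] kk_def[symmetric])
    then show "k \<le> fm.dim (st (tri S e f) \<gamma>)" using has_indexD[OF idx'] by simp
  qed (use T1.subspace_tri F1 in auto)
  obtain \<gamma>' where \<gamma>': "fm.dim (st (tri S e f') \<gamma>') \<le> k" using idx' by (auto simp: has_index_def)
  define \<alpha> where "\<alpha> = e * \<gamma>' * e"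
  define p' where "p' = f' * \<gamma>' * e"
  define \<beta>' where "\<beta>' = f' * \<gamma>' * f'"
  have \<alpha>c: "\<alpha> \<in> corner e e" unfolding \<alpha>_def by (intro corner_cut T1.ee)
  have p'c: "p' \<in> corner f' e" unfolding p'_def by (intro corner_cut T1.ee T2.ff)
  have \<beta>'c: "\<beta>' \<in> corner f' f'" unfolding \<beta>'_def by (intro corner_cut T2.ff)
  \<comment> \<open>This choice gives \<open>r0 * \<beta> * p0 = 0\<close>,
    \<open>f' * \<beta> * p0 = p'\<close> and \<open>f' * \<beta> * f' = \<beta>'\<close>, so the
    reduced functional has the components of the optimal \<open>\<gamma>'\<close>.\<close>
  define \<beta> where "\<beta> = \<beta>' + p' * r0"
  have \<beta>c: "\<beta> \<in> corner f f"
  proof -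
    have "f' * \<beta>' * f' + f' * (p' * r0) \<in> corner f f"
      by (intro corner_add corner_mult[OF corner_mult[OF f'c(2) \<beta>'c] f'c(3)] corner_mult[OF f'c(2)] corner_mult[OF p'c r0c])
    then show ?thesis using corner_absorb[OF \<beta>'c] corner_absorb[OF p'c] by (simp add: \<beta>_def)
  qed
  have z: "\<beta>' * p0 = 0" "\<beta>' * (p0 * x) = 0" "r0 * \<beta>' = 0" "r0 * (p' * x) = 0" "r0 * p' = 0" for x
  proof -
    have "\<beta>' * (f' * p0) = 0" "(r0 * f') * \<beta>' = 0" "(r0 * f') * p' = 0" by (simp_all add: f'p0 r0f')
    then show "\<beta>' * p0 = 0" "r0 * \<beta>' = 0" "r0 * p' = 0"
      using corner_absorb[OF \<beta>'c] corner_absorb[OF p'c] by (simp_all add: mult.assoc)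
    then show "\<beta>' * (p0 * x) = 0" "r0 * (p' * x) = 0" by (simp_all add: mult.assoc[symmetric])
  qed
  have b: "r0 * \<beta> * p0 = 0" "f' * \<beta> * p0 = p'" "f' * \<beta> * f' = \<beta>'"
    using corner_absorb[OF \<beta>'c] corner_absorb[OF p'c]
    by (simp_all add: \<beta>_def distrib_left distrib_right mult.assoc z r0p0 r0f')
  have "fm.dim (st (tri S e f) (\<alpha> + p0 + \<beta>)) = fm.dim (st (tri S e f') \<gamma>')"
    by (rule st_embedding_injective[OF T1 T2 F1 F2 p0c r0c f'c(2,3) r0p0 T2.ff f'p0 r0f' _
          T1.components(4-6)[OF \<alpha>c corner_0 p0c \<beta>c]])
       (simp_all add: b p0r0 T2.ff \<alpha>_def p'_def \<beta>'_def)
  then have "\<exists>\<gamma>. fm.dim (st (tri S e f) \<gamma>) \<le> k" using \<gamma>' by metis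
  with lower show ?thesis unfolding has_index_def e_def[symmetric] f_def[symmetric] by blast
qed

text \<open>Transposition combined with a permutation of indices. Plain transposition sends
  \<open>pm X a0 a1\<close> to \<open>pm X a1 a0\<close>; exchanging the two copies brings it back,
  so that the centraliser \<open>Sr X\<close> is preserved.\<close>

definition flip :: "('i \<Rightarrow> 'i) \<Rightarrow> ('i, 'a :: field) fmat \<Rightarrow> ('i, 'a) fmat" where
  "flip \<pi> x = Fmat (\<lambda>i j. ent x (\<pi> j) (\<pi> i))"

locale involution =
  fixes \<pi> :: "'i \<Rightarrow> 'i"
  assumes \<pi>\<pi>: "\<pi> (\<pi> i) = i"
begin

lemma ent_flip: "ent (flip \<pi> x) i j = ent x (\<pi> j) (\<pi> i)"
  unfolding flip_def
proof (subst ent_Fmat[of "\<pi> ` supp x"])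
  fix i j assume "ent x (\<pi> j) (\<pi> i) \<noteq> 0"
  then have "\<pi> i \<in> supp x" "\<pi> j \<in> supp x" using ent_nz_supp by metis+
  then show "i \<in> \<pi> ` supp x \<and> j \<in> \<pi> ` supp x" by (metis \<pi>\<pi> imageI)
qed auto

lemma inj_\<pi>: "inj_on \<pi> A"
  by (metis \<pi>\<pi> inj_onI)

lemma flip_mult: "flip \<pi> (x * y) = flip \<pi> y * flip \<pi> x" for x :: "('i, 'a :: field) fmat"
proof (rule fmat_eqI)
  fix i j
  have "ent (flip \<pi> y * flip \<pi> x) i j = (\<Sum>k\<in>\<pi> ` supp x. ent (flip \<pi> y) i k * ent (flip \<pi> x) k j)"
  proof (rule ent_mult_over)
    fix k assume "ent (flip \<pi> x) k j \<noteq> 0"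
    then have "\<pi> k \<in> supp x" unfolding ent_flip by (rule ent_nz_supp)
    then show "k \<in> \<pi> ` supp x" by (metis \<pi>\<pi> imageI)
  qed simp
  also have "\<dots> = (\<Sum>k\<in>supp x. ent x (\<pi> j) k * ent y k (\<pi> i))"
    by (subst sum.reindex[OF inj_\<pi>]) (simp add: ent_flip \<pi>\<pi> mult.commute)
  finally show "ent (flip \<pi> (x * y)) i j = ent (flip \<pi> y * flip \<pi> x) i j"
    by (simp add: ent_flip ent_mult[of x])
qed

lemma tr_flip: "tr (flip \<pi> x) = tr x"
proof -
  have "tr (flip \<pi> x) = (\<Sum>k\<in>\<pi> ` supp x. ent (flip \<pi> x) k k)"
  proof (rule tr_over)
    fix k assume "ent (flip \<pi> x) k k \<noteq> 0"
    then have "\<pi> k \<in> supp x" unfolding ent_flip by (rule ent_nz_supp)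
    then show "k \<in> \<pi> ` supp x" by (metis \<pi>\<pi> imageI)
  qed simp
  then show ?thesis by (simp add: sum.reindex[OF inj_\<pi>] ent_flip \<pi>\<pi> tr_def)
qed

lemma flip_flip: "flip \<pi> (flip \<pi> x) = x"
  by (intro fmat_eqI) (simp add: ent_flip \<pi>\<pi>)

lemma lin_flip: "lin (flip \<pi>)"
  by (intro linI fmat_eqI) (simp_all add: ent_flip)

lemma flip_pm: "flip \<pi> (pm K \<phi> \<psi>) = pm K (\<lambda>k. \<pi> (\<psi> k)) (\<lambda>k. \<pi> (\<phi> k))"
  unfolding pm_def by (intro fmat_eqI) (simp add: ent_flip ent_sum ent_mu, metis \<pi>\<pi>)

lemma flip_idm:
  assumes "finite I" "\<pi> ` I = I"
  shows "flip \<pi> (idm I) = idm I"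
proof (rule fmat_eqI)
  fix i j
  have "\<pi> i \<in> I \<longleftrightarrow> i \<in> I" using assms(2) by (metis \<pi>\<pi> imageI)
  moreover have "\<pi> j = \<pi> i \<longleftrightarrow> i = j" by (metis \<pi>\<pi>)
  ultimately show "ent (flip \<pi> (idm I)) i j = ent (idm I) i j"
    using assms(1) by (auto simp: ent_flip ent_idm)
qed

text \<open>Genericity means that \<open>p\<close> is onto, expressed as invertibility of
  \<open>s0 * p + n0 * r0\<close>. With the inverse \<open>G\<close>, the columns of
  \<open>G * n0\<close> span the kernel of \<open>p\<close> and \<open>G * s0\<close> is a right
  inverse; \<open>st_dual_embedding\<close> then compares with a functional over
  \<open>J2\<close>.\<close>

lemma index_dual_lower:
  fixes S :: "('i, 'a :: field_char_0) fmat set"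
  assumes fin: "finite I" "finite J" "finite J2" and disj: "I \<inter> J = {}" "I \<inter> J2 = {}"
    and card: "card J + card J2 = card I" and \<pi>: "\<pi> ` I = I" "\<pi> ` J2 = J2"
    and S: "fm.subspace S" "S \<subseteq> corner (idm I) (idm I)" "\<And>x. x \<in> S \<Longrightarrow> flip \<pi> x \<in> S"
    and le: "\<And>\<gamma>. k \<le> fm.dim (st (tri S (idm I) (idm J2)) \<gamma>)"
  shows "k \<le> fm.dim (st (tri S (idm I) (idm J)) \<gamma>)"
proof -
  define e where "e = (idm I :: ('i, 'a) fmat)"
  define f where "f = (idm J :: ('i, 'a) fmat)"
  define g where "g = (idm J2 :: ('i, 'a) fmat)"
  note T1 = triangularI_idm[OF fin(1,2) disj(1) S(1,2), folded e_def f_def]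
  note T2 = triangularI_idm[OF fin(1,3) disj(2) S(1,2), folded e_def g_def]
  interpret T1: triangular S e f by (rule T1)
  interpret T2: triangular S e g by (rule T2)
  note F1 = fin_span_tri[OF fin(1,2) disj(1) S(1,2), folded e_def f_def]
  note le' = le[folded e_def g_def]
  obtain I1 where I1: "I1 \<subseteq> I" "card I1 = card J"
    using obtain_subset_with_card_n[of "card J" I] card by (metis le_add1)
  have finI: "finite I1" "finite (I - I1)" using I1 fin(1) finite_subset by auto
  have "card (I - I1) = card J2" using I1 card fin(1) finI by (simp add: card_Diff_subset)
  then obtain h2 where h2: "bij_betw h2 J2 (I - I1)"
    using finite_same_card_bij[OF fin(3) finI(2)] by metis
  obtain h where h: "bij_betw h J I1" using finite_same_card_bij[OF fin(2) finI(1)] I1(2) by metis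
  have inj: "inj_on h J" "inj_on h2 J2" and im: "h ` J = I1" "h2 ` J2 = I - I1"
    using h h2 by (auto simp: bij_betw_def)
  define p0 where "p0 = (pm J id h :: ('i, 'a) fmat)"
  define s0 where "s0 = (pm J h id :: ('i, 'a) fmat)"
  define n0 where "n0 = (pm J2 h2 id :: ('i, 'a) fmat)"
  define r0 where "r0 = (pm J2 id h2 :: ('i, 'a) fmat)"
  have p0c: "p0 \<in> corner f e" and s0c: "s0 \<in> corner e f" and n0c: "n0 \<in> corner e g" and r0c: "r0 \<in> corner g e"
    unfolding p0_def s0_def n0_def r0_def e_def f_def g_def
    by (rule pm_in_corner; use fin im I1 in auto)+
  have pr: "p0 * s0 = f" "r0 * n0 = g" "p0 * n0 = 0" "r0 * s0 = 0" "s0 * p0 + n0 * r0 = e"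
  proof -
    show "p0 * s0 = f" "r0 * n0 = g"
      unfolding p0_def s0_def n0_def r0_def f_def g_def
      by (simp_all add: pm_mult[OF fin(2) inj(1)] pm_mult[OF fin(3) inj(2)] idm_eq_pm_id fin)
    show "p0 * n0 = 0" "r0 * s0 = 0"
      unfolding p0_def s0_def n0_def r0_def by (rule pm_mult_0; use im in auto)+
    have "s0 * p0 = idm I1" "n0 * r0 = idm (I - I1)"
      unfolding p0_def s0_def n0_def r0_def
      by (simp_all add: pm_mult[OF fin(2)] pm_mult[OF fin(3)] idm_eq_pm[OF fin(2) inj(1), unfolded im, symmetric]
          idm_eq_pm[OF fin(3) inj(2), unfolded im, symmetric])
    then have "s0 * p0 + n0 * r0 = idm (I1 \<union> (I - I1))"
      using finI by (subst idm_Un) auto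
    then show "s0 * p0 + n0 * r0 = e" using I1(1) by (simp add: e_def Un_absorb1)
  qed
  have "k \<le> fm.dim (st (tri S e f) \<gamma>)"
  proof (rule st_dim_ge_generic[where M = "\<lambda>\<gamma>. s0 * (f * \<gamma> * e) + n0 * r0" and J = I and ?\<gamma>1.0 = p0])
    show "poly_fam I I (\<lambda>t. s0 * (f * line \<gamma>0 p0 t * e) + n0 * r0)" for \<gamma>0
      using s0c corner_mult[OF n0c r0c] unfolding f_def e_def
      by (intro poly_fam_add poly_fam_mult[OF _ poly_fam_line] poly_fam_const fin)
    show "inv_in (idm I) (s0 * (f * p0 * e) + n0 * r0)"
      using corner_absorb[OF p0c] inv_in_self[OF T1.ee] by (simp add: pr) (simp add: e_def)
  next
    fix \<gamma> assume "inv_in (idm I) (s0 * (f * \<gamma> * e) + n0 * r0)"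
    then obtain G where G: "G \<in> corner e e" "(s0 * (f * \<gamma> * e) + n0 * r0) * G = e" "G * (s0 * (f * \<gamma> * e) + n0 * r0) = e"
      unfolding e_def[symmetric] by (rule inv_inE)
    define p where "p = f * \<gamma> * e"
    define H where "H = s0 * p + n0 * r0"
    note GH = G(2,3)[folded p_def, folded H_def]
    define \<beta> where "\<beta> = f * \<gamma> * f"
    define \<alpha> where "\<alpha> = e * \<gamma> * e"
    have pc: "p \<in> corner f e" unfolding p_def by (intro corner_cut T1.ee T1.ff)
    have \<alpha>c: "\<alpha> \<in> corner e e" unfolding \<alpha>_def by (intro corner_cut T1.ee)
    have \<beta>c: "\<beta> \<in> corner f f" unfolding \<beta>_def by (intro corner_cut T1.ff)
    have "p0 * H = p" "r0 * H = r0"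
      using corner_absorb[OF pc] corner_absorb[OF r0c]
      by (simp_all add: H_def distrib_left pr mult_assoc_eq[OF pr(1)] mult_assoc_eq[OF pr(2)] mult_assoc_eq[OF pr(3)] mult_assoc_eq[OF pr(4)])
    then have pG: "p * G = p0" and rG: "r0 * G = r0"
      using GH(1) corner_absorb[OF p0c] corner_absorb[OF r0c] by (metis mult.assoc)+
    define s where "s = G * s0"
    define n where "n = G * n0"
    have sc: "s \<in> corner e f" and nc: "n \<in> corner e g"
      unfolding s_def n_def by (rule corner_mult[OF G(1) s0c], rule corner_mult[OF G(1) n0c])
    have prods: "p * s = f" "p * n = 0" "r0 * n = g" "r0 * s = 0" "s * p + n * r0 = e"
    proof -
      show "p * s = f" "p * n = 0" "r0 * n = g" "r0 * s = 0"
        using pr by (simp_all add: s_def n_def mult.assoc[symmetric] pG rG)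
      have "s * p + n * r0 = G * H" by (simp add: s_def n_def H_def distrib_left mult.assoc)
      then show "s * p + n * r0 = e" by (simp add: GH)
    qed
    have fe: "flip \<pi> e = e" and fg: "flip \<pi> g = g"
      unfolding e_def g_def using fin \<pi> by (auto intro: flip_idm)
    have flc: "flip \<pi> x \<in> corner (flip \<pi> b) (flip \<pi> a)" if "x \<in> corner a b" for x a b :: "('i, 'a) fmat"
      using that flip_mult[of a x] flip_mult[of x b] by (auto simp: corner_def)
    have c: "- flip \<pi> (\<alpha> + s * \<beta> * p) \<in> corner e e" "flip \<pi> n \<in> corner g e"
      using flc[OF nc] flc[of "\<alpha> + s * \<beta> * p" e e] corner_add[OF \<alpha>c corner_mult[OF corner_mult[OF sc \<beta>c] pc]]
      by (auto simp: fe fg intro: corner_uminus)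
    have "fm.dim (st (tri S e g) (- flip \<pi> (\<alpha> + s * \<beta> * p) + flip \<pi> n + 0)) \<le> fm.dim (st (tri S e f) \<gamma>)"
      by (rule st_dual_embedding[OF T1 T2 F1 lin_flip flip_mult flip_flip tr_flip fe fg S(3) pc sc nc r0c prods
            \<alpha>_def[symmetric] p_def[symmetric] \<beta>_def[symmetric] T2.components(4-6)[OF c(1) corner_0 c(2) corner_0]])
    with le' show "k \<le> fm.dim (st (tri S e f) \<gamma>)" by (rule le_trans)
  qed (use T1.subspace_tri F1 in auto)
  then show ?thesis by (simp add: e_def f_def)
qed

text \<open>The relation between \<open>J\<close> and \<open>J2\<close> is symmetric, so the lower
  bound applies in both directions and identifies the two minima without an optimal functional being
  constructed.\<close>

lemma has_index_dual:
  fixes S :: "('i, 'a :: field_char_0) fmat set"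
  assumes fin: "finite I" "finite J" "finite J2" and disj: "I \<inter> J = {}" "I \<inter> J2 = {}"
    and card: "card J + card J2 = card I" and \<pi>: "\<pi> ` I = I" "\<pi> ` J = J" "\<pi> ` J2 = J2"
    and S: "fm.subspace S" "S \<subseteq> corner (idm I) (idm I)" "\<And>x. x \<in> S \<Longrightarrow> flip \<pi> x \<in> S"
    and idx: "has_index (tri S (idm I) (idm J2)) k"
  shows "has_index (tri S (idm I) (idm J)) k"
proof -
  obtain m where m: "has_index (tri S (idm I) (idm J)) m" using has_index_exists by blast
  have "k \<le> fm.dim (st (tri S (idm I) (idm J)) \<gamma>)" for \<gamma>
    by (rule index_dual_lower[OF fin disj card \<pi>(1,3) S has_indexD[OF idx]])
  then have "k \<le> m" using m by (auto simp: has_index_def intro: le_trans)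
  have "m \<le> fm.dim (st (tri S (idm I) (idm J2)) \<gamma>)" for \<gamma>
    by (rule index_dual_lower[OF fin(1,3,2) disj(2,1) _ \<pi>(1,2) S has_indexD[OF m]]) (simp add: card add.commute)
  then have "m \<le> k" using idx by (auto simp: has_index_def intro: le_trans)
  with \<open>k \<le> m\<close> m show ?thesis by simp
qed

end

section \<open>Indices of the triangular algebras\<close>

lemma has_index_cent:
  fixes f :: "('i, 'a :: field_char_0) fmat"
  assumes "doubled y n \<phi> K f \<iota>0 \<iota>1"
  shows "has_index (cent (idm (\<iota>0 ` K \<union> \<iota>1 ` K)) (pm K \<iota>0 \<iota>1) :: ('i, 'a) fmat set) (2 * n)"
proof -
  interpret doubled y n \<phi> K f \<iota>0 \<iota>1 by (rule assms)
  have "2 * n \<le> fm.dim (st (cent e N) \<gamma>)" for \<gamma>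
  proof (rule st_dim_ge_generic[where M = "\<lambda>\<gamma>. kry y n f (l1 * (e * \<gamma> * e) * i0)" and J = "\<phi> ` K"
        and ?\<gamma>1.0 = "i1 * shift y n * l0"])
    show "fm.subspace (cent e N)" by (rule subspace_cent)
    show "fin_span (cent e N)" by (rule fin_span_cent)
    show "poly_fam (\<phi> ` K) (\<phi> ` K) (\<lambda>t. kry y n f (l1 * (e * line \<gamma>0 (i1 * shift y n * l0) t * e) * i0))" for \<gamma>0
      using corners(1,4) unfolding e_def f_def
      by (intro poly_fam_kry[unfolded f_def] poly_fam_mult[OF poly_fam_mult[OF _ poly_fam_line]] poly_fam_const finI finJ)
    have "l1 * (e * (i1 * shift y n * l0) * e) * i0 = shift y n"
      using corner_absorb[OF shift_in] by (simp add: mult.assoc absorb products')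
    then show "inv_in (idm (\<phi> ` K)) (kry y n f (l1 * (e * (i1 * shift y n * l0) * e) * i0))"
      using inv_shift by (simp add: f_def)
    show "2 * n \<le> fm.dim (st (cent e N) \<gamma>)" if "inv_in (idm (\<phi> ` K)) (kry y n f (l1 * (e * \<gamma> * e) * i0))" for \<gamma>
      using st_cent_lower[of \<gamma>] that by (simp add: f_def[symmetric] mult.assoc absorb)
  qed
  with st_cent_upper show ?thesis unfolding has_index_def e_def I_def N_def by blast
qed

text \<open>Genericity is invertibility of the first half \<open>p * i0\<close>. The lower bound of
  \<open>has_index_cent\<close> holds for every functional, hence for whatever \<open>P\<close> and
  \<open>Q\<close> the normalisation produces.\<close>

lemma has_index_Sq:
  fixes f :: "('i, 'a :: field_char_0) fmat"
  assumes "doubled y n \<phi> K f \<iota>0 \<iota>1"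
  defines "e \<equiv> idm (\<iota>0 ` K \<union> \<iota>1 ` K) :: ('i, 'a) fmat"
  shows "has_index (tri (cent e (pm K \<iota>0 \<iota>1) \<inter> cent e (pm K \<iota>1 \<iota>0)) e f) (2 * n)"
proof -
  interpret D: doubled y n \<phi> K f \<iota>0 \<iota>1 by (rule assms)
  interpret T: triangular D.Sq D.e f by (rule D.triangular_Sq)
  have S: "cent e (pm K \<iota>0 \<iota>1) \<inter> cent e (pm K \<iota>1 \<iota>0) = D.Sq" and e: "e = D.e"
    by (simp_all add: e_def D.Sq_def D.e_def D.I_def D.N_def D.N'_def)
  have "2 * n \<le> fm.dim (st (tri D.Sq D.e f) \<gamma>)" for \<gamma>
  proof (rule st_dim_ge_generic[where M = "\<lambda>\<gamma>. f * \<gamma> * D.e * D.i0" and J = "\<phi> ` K" and ?\<gamma>1.0 = D.l0])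
    show "poly_fam (\<phi> ` K) (\<phi> ` K) (\<lambda>t. f * line \<gamma>0 D.l0 t * D.e * D.i0)" for \<gamma>0
      using D.corners(1) unfolding D.e_def D.f_def
      by (intro poly_fam_mult[OF poly_fam_line] poly_fam_const D.finI D.finJ)
    show "inv_in (idm (\<phi> ` K)) (f * D.l0 * D.e * D.i0)"
      using inv_in_self[OF D.ff] by (simp add: D.absorb D.products mult.assoc) (simp add: D.f_def)
    fix \<gamma> assume "inv_in (idm (\<phi> ` K)) (f * \<gamma> * D.e * D.i0)"
    then obtain g where "g \<in> corner f f" "f * \<gamma> * D.e * D.i0 * g = f" "g * (f * \<gamma> * D.e * D.i0) = f"
      unfolding D.f_def[symmetric] by (rule inv_inE)
    from D.st_cent_le_st_Sq[OF refl refl refl this]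
    show "2 * n \<le> fm.dim (st (tri D.Sq D.e f) \<gamma>)"
      using has_indexD[OF has_index_cent[OF assms(1), folded D.I_def, folded D.e_def D.N_def]] by (rule le_trans[rotated])
  qed (use T.subspace_tri D.fin_span_tri_Sq in auto)
  with D.st_Sq_upper show ?thesis unfolding has_index_def S unfolding e by blast
qed

section \<open>Concrete index sets for the two families\<close>

abbreviation a0 :: "nat \<Rightarrow> nat \<times> nat" where "a0 x \<equiv> (x, 0)"
abbreviation a1 :: "nat \<Rightarrow> nat \<times> nat" where "a1 x \<equiv> (x, Suc 0)"
abbreviation a2 :: "nat \<Rightarrow> nat \<times> nat" where "a2 x \<equiv> (x, 2)"

definition two :: "nat set \<Rightarrow> (nat \<times> nat) set" where "two X = a0 ` X \<union> a1 ` X"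

text \<open>Index \<open>(x, 0)\<close>, \<open>(x, 1)\<close> with \<open>x \<in> X\<close> for the two copies of \<open>K\<^sup>a\<close> and \<open>(y, 2)\<close> with \<open>y \<in> Y\<close> for \<open>K\<^sup>b\<close>.
  Then \<open>Sr X\<close> is \<open>gl\<^sub>a(K[\<epsilon>])\<close> and \<open>Sd X\<close> the diagonal copy of \<open>gl\<^sub>a\<close>.\<close>

definition Sr :: "nat set \<Rightarrow> (nat \<times> nat, 'a :: field) fmat set" where
  "Sr X = cent (idm (two X)) (pm X a0 a1)"

definition Sd :: "nat set \<Rightarrow> (nat \<times> nat, 'a :: field) fmat set" where
  "Sd X = Sr X \<inter> cent (idm (two X)) (pm X a1 a0)"

definition ralg :: "nat set \<Rightarrow> nat set \<Rightarrow> (nat \<times> nat, 'a :: field) fmat set" where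
  "ralg X Y = tri (Sr X) (idm (two X)) (idm (a2 ` Y))"

definition qalg :: "nat set \<Rightarrow> nat set \<Rightarrow> (nat \<times> nat, 'a :: field) fmat set" where
  "qalg X Y = tri (Sd X) (idm (two X)) (idm (a2 ` Y))"

lemma inj_a: "inj_on a0 X" "inj_on a1 X" "inj_on a2 X"
  by (auto simp: inj_on_def)

lemma two_facts:
  assumes "finite X"
  shows "finite (two X)" "card (two X) = 2 * card X" "two X \<inter> a2 ` Y = {}"
    "idm (two X) = pm X a0 a0 + pm X a1 a1"
proof -
  have d: "a0 ` X \<inter> a1 ` X = {}" by auto
  show "finite (two X)" using assms by (simp add: two_def)
  show "card (two X) = 2 * card X"
    unfolding two_def using assms d by (subst card_Un_disjoint) (auto simp: card_image inj_a)
  show "two X \<inter> a2 ` Y = {}" by (auto simp: two_def)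
  show "idm (two X) = pm X a0 a0 + pm X a1 a1"
    unfolding two_def using assms d by (subst idm_Un) (auto simp: idm_eq_pm inj_a)
qed

lemma Sr_facts: "fm.subspace (Sr X)" "Sr X \<subseteq> corner (idm (two X)) (idm (two X))"
  unfolding Sr_def using subspace_cent by (auto simp: cent_def)

lemma Sd_facts: "fm.subspace (Sd X)" "Sd X \<subseteq> corner (idm (two X)) (idm (two X))"
  unfolding Sd_def by (intro fm.subspace_inter Sr_facts subspace_cent, intro le_infI1 Sr_facts)

definition swap :: "nat \<times> nat \<Rightarrow> nat \<times> nat" where
  "swap i = (fst i, if snd i = 0 then 1 else if snd i = 1 then 0 else snd i)"

interpretation sw: involution swap
  by unfold_locales (auto simp: swap_def)

lemma swap_images:
  "swap ` two X = two X" "swap ` a2 ` Y = a2 ` Y"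
  by (auto simp: swap_def two_def image_image image_Un)

lemma flip_cent:
  assumes "flip swap e = e" "flip swap N = N" "x \<in> cent e N"
  shows "flip swap x \<in> cent e N"
proof -
  have "flip swap (e * x) = flip swap x" "flip swap (x * e) = flip swap x" "flip swap (x * N) = flip swap (N * x)"
    using assms(3) by (auto simp: cent_def corner_def)
  then show ?thesis unfolding sw.flip_mult assms(1,2) by (simp add: cent_def corner_def)
qed

lemma flip_S:
  assumes "finite X"
  shows "x \<in> Sr X \<Longrightarrow> flip swap x \<in> Sr X" "x \<in> Sd X \<Longrightarrow> flip swap x \<in> Sd X"
proof -
  have e: "flip swap (idm (two X)) = idm (two X)"
    by (intro sw.flip_idm two_facts assms swap_images)
  have "flip swap (pm X a0 a1) = pm X a0 a1" "flip swap (pm X a1 a0) = pm X a1 a0"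
    by (simp_all add: sw.flip_pm swap_def)
  then show "x \<in> Sr X \<Longrightarrow> flip swap x \<in> Sr X" "x \<in> Sd X \<Longrightarrow> flip swap x \<in> Sd X"
    unfolding Sr_def Sd_def using flip_cent[OF e] by auto
qed

lemma enumerated_exists:
  assumes "finite J" "J \<noteq> {}"
  shows "\<exists>y. enumerated y (card J) J (idm J :: ('i, 'a :: field) fmat)"
proof -
  obtain y where "bij_betw y {..<card J} J"
    using ex_bij_betw_nat_finite[OF assms(1)] by (auto simp: lessThan_atLeast0)
  then show ?thesis using assms by (intro exI[of _ y]) (simp add: enumerated_def card_gt_0_iff)
qed

lemma doubled_exists:
  assumes "finite X" "X \<noteq> {}" "bij_betw h X Y"
  shows "\<exists>y. doubled y (card X) (\<lambda>x. a2 (h x)) X (idm (a2 ` Y) :: (nat \<times> nat, 'a :: field) fmat) a0 a1"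
proof -
  have im: "(\<lambda>x. a2 (h x)) ` X = a2 ` Y" and inj: "inj_on (\<lambda>x. a2 (h x)) X"
    using assms(3) by (auto simp: bij_betw_def inj_on_def)
  have "card ((\<lambda>x. a2 (h x)) ` X) = card X" by (rule card_image[OF inj])
  moreover obtain y where "enumerated y (card ((\<lambda>x. a2 (h x)) ` X)) ((\<lambda>x. a2 (h x)) ` X)
      (idm ((\<lambda>x. a2 (h x)) ` X) :: (nat \<times> nat, 'a) fmat)"
    using enumerated_exists[of "(\<lambda>x. a2 (h x)) ` X"] assms(1,2) by auto
  ultimately show ?thesis
    using inj assms(1) inj_a unfolding doubled_def doubled_axioms_def im by (intro exI[of _ y]) auto
qed

lemma tri_idm_empty_left:
  assumes "S \<subseteq> corner (idm {}) (idm {})" "0 \<in> S"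
  shows "tri S (idm {}) f = corner f f"
proof -
  have "idm {} = (0 :: ('a, 'b) fmat)" by (intro fmat_eqI) (simp add: ent_idm)
  then have "S = {0}" "corner (idm {}) f = {0}" using assms by (auto simp: corner_def)
  then show ?thesis by (auto simp: tri_def)
qed

lemma tri_idm_empty_right: "tri S e (idm {}) = S"
proof -
  have "idm {} = (0 :: ('a, 'b) fmat)" by (intro fmat_eqI) (simp add: ent_idm)
  then show ?thesis by (auto simp: tri_def corner_def)
qed

lemma has_index_left_empty:
  assumes "finite Y" "Y \<noteq> {}"
  shows "has_index (ralg {} Y :: (nat \<times> nat, 'a :: field_char_0) fmat set) (card Y)"
    "has_index (qalg {} Y :: (nat \<times> nat, 'a) fmat set) (card Y)"
proof -
  have "card (a2 ` Y) = card Y" by (simp add: card_image inj_a)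
  then obtain y where "enumerated y (card Y) (a2 ` Y) (idm (a2 ` Y) :: (nat \<times> nat, 'a) fmat)"
    using enumerated_exists[of "a2 ` Y"] assms by auto
  then have gl: "has_index (corner (idm (a2 ` Y)) (idm (a2 ` Y)) :: (nat \<times> nat, 'a) fmat set) (card Y)"
    by (rule has_index_gl)
  have t: "two {} = {}" by (simp add: two_def)
  have "tri (Sr {}) (idm {}) f = corner f f" "tri (Sd {}) (idm {}) f = corner f f" for f :: "(nat \<times> nat, 'a) fmat"
    by (intro tri_idm_empty_left Sr_facts(2)[of "{}", unfolded t] Sd_facts(2)[of "{}", unfolded t]
        fm.subspace_0 Sr_facts Sd_facts)+
  then show "has_index (ralg {} Y :: (nat \<times> nat, 'a) fmat set) (card Y)"
      "has_index (qalg {} Y :: (nat \<times> nat, 'a) fmat set) (card Y)"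
    using gl by (simp_all add: ralg_def qalg_def t)
qed

text \<open>The third index copy in \<open>doubled\<close> is filled with the image of
  \<open>X\<close> under \<open>a2\<close>; it only serves to write down block entries.\<close>

lemma has_index_Sr:
  assumes "finite X" "X \<noteq> {}"
  shows "has_index (ralg X {} :: (nat \<times> nat, 'a :: field_char_0) fmat set) (2 * card X)"
proof -
  obtain y where "doubled y (card X) (\<lambda>x. a2 (id x)) X (idm (a2 ` X) :: (nat \<times> nat, 'a) fmat) a0 a1"
    using doubled_exists[OF assms, of id X] by auto
  from has_index_cent[OF this] show ?thesis by (simp add: ralg_def tri_idm_empty_right Sr_def two_def)
qed

lemma has_index_q_equal:
  assumes "finite X" "X \<noteq> {}" "finite Y" "card Y = card X"
  shows "has_index (qalg X Y :: (nat \<times> nat, 'a :: field_char_0) fmat set) (2 * card X)"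
proof -
  obtain h where "bij_betw h X Y" using finite_same_card_bij[OF assms(1,3)] assms(4) by metis
  then obtain y where "doubled y (card X) (\<lambda>x. a2 (h x)) X (idm (a2 ` Y) :: (nat \<times> nat, 'a) fmat) a0 a1"
    using doubled_exists[OF assms(1,2)] by blast
  from has_index_Sq[OF this] show ?thesis by (simp add: qalg_def Sd_def Sr_def two_def)
qed

lemma has_index_remove:
  assumes fin: "finite X" "finite Y" and Y': "Y' \<subseteq> Y" and card: "card Y = card Y' + 2 * card X"
    and S: "fm.subspace S" "S \<subseteq> corner (idm (two X)) (idm (two X))"
    and idx: "has_index (tri S (idm (two X)) (idm (a2 ` Y'))) k"
  shows "has_index (tri S (idm (two X)) (idm (a2 ` Y)) :: (nat \<times> nat, 'a :: field_char_0) fmat set) k"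
proof (rule has_index_embedding[OF _ _ _ _ _ S idx])
  have "a2 ` Y - a2 ` Y' = a2 ` (Y - Y')" by auto
  moreover have "card (Y - Y') = card (two X)"
    using card Y' fin finite_subset[OF Y'] by (simp add: card_Diff_subset two_facts)
  ultimately show "card (a2 ` Y - a2 ` Y') = card (two X)" by (simp add: card_image inj_a)
qed (use fin Y' two_facts in auto)

lemma has_index_complement:
  assumes fin: "finite X" "finite Y" "finite Y'" and card: "card Y + card Y' = 2 * card X"
    and S: "fm.subspace S" "S \<subseteq> corner (idm (two X)) (idm (two X))" "\<And>x. x \<in> S \<Longrightarrow> flip swap x \<in> S"
    and idx: "has_index (tri S (idm (two X)) (idm (a2 ` Y'))) k"
  shows "has_index (tri S (idm (two X)) (idm (a2 ` Y)) :: (nat \<times> nat, 'a :: field_char_0) fmat set) k"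
  by (rule sw.has_index_dual[OF _ _ _ _ _ _ _ _ _ S idx])
     (use fin two_facts swap_images card in \<open>auto simp: card_image inj_a\<close>)

lemma pm_split: "finite X \<Longrightarrow> Z \<subseteq> X \<Longrightarrow> pm X \<phi> \<psi> = pm Z \<phi> \<psi> + pm (X - Z) \<phi> \<psi>"
  unfolding pm_def by (metis add.commute sum.subset_diff)

text \<open>Genericity is the invertibility of \<open>s1 * p + s2 * p * N + e'\<close>, the map over
  the dual numbers induced by \<open>p\<close> and completed by the identity on the indices outside
  \<open>Z\<close>. It commutes with \<open>N\<close>, hence so does its inverse \<open>G\<close>,
  and \<open>G\<close> carries the coordinate splitting to one adapted to \<open>p\<close>.\<close>

lemma has_index_r_reduce:
  assumes fin: "finite X" "finite Y" and Z: "Z \<subseteq> X" "card Z = card Y"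
    and idx: "has_index (ralg (X - Z) Y :: (nat \<times> nat, 'a :: field_char_0) fmat set) k"
  shows "has_index (ralg X Y :: (nat \<times> nat, 'a) fmat set) k"
proof -
  define X' where "X' = X - Z"
  have fin': "finite Z" "finite X'" using fin Z finite_subset by (auto simp: X'_def)
  obtain h where h: "bij_betw h Z Y" using finite_same_card_bij[OF fin'(1) fin(2) Z(2)] by blast
  have him: "(\<lambda>x. a2 (h x)) ` Z = a2 ` Y" and hinj: "inj_on (\<lambda>x. a2 (h x)) Z"
    using h by (auto simp: bij_betw_def inj_on_def)
  define b where "b = (\<lambda>x. a2 (h x))"
  note him = him[folded b_def] and hinj = hinj[folded b_def]
  define e where "e = (idm (two X) :: (nat \<times> nat, 'a) fmat)"
  define e' where "e' = (idm (two X') :: (nat \<times> nat, 'a) fmat)"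
  define f where "f = (idm (a2 ` Y) :: (nat \<times> nat, 'a) fmat)"
  define N where "N = (pm X a0 a1 :: (nat \<times> nat, 'a) fmat)"
  define s1 where "s1 = (pm Z a0 b :: (nat \<times> nat, 'a) fmat)"
  define s2 where "s2 = (pm Z a1 b :: (nat \<times> nat, 'a) fmat)"
  define p0 where "p0 = (pm Z b a0 :: (nat \<times> nat, 'a) fmat)"
  note tw = two_facts[OF fin(1)] two_facts[OF fin'(2)]
  have e_eq: "e = pm Z a0 a0 + pm Z a1 a1 + e'"
    unfolding e_def e'_def tw(4,8)
    by (simp only: pm_split[OF fin(1) Z(1), of a0 a0, folded X'_def] pm_split[OF fin(1) Z(1), of a1 a1, folded X'_def] add_ac)
  have e'_eq: "e' = pm X' a0 a0 + pm X' a1 a1" unfolding e'_def tw(8) ..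
  have N_eq: "N = pm Z a0 a1 + pm X' a0 a1" unfolding N_def X'_def by (rule pm_split[OF fin(1) Z(1)])
  have z: "pm Z \<phi> (\<lambda>x. (x, i)) * pm X' (\<lambda>x. (x, j)) \<psi> = (0 :: (nat \<times> nat, 'a) fmat)"
    "pm X' \<phi> (\<lambda>x. (x, i)) * pm Z (\<lambda>x. (x, j)) \<psi> = (0 :: (nat \<times> nat, 'a) fmat)"
    "pm Z \<phi> b * pm X' (\<lambda>x. (x, j)) \<psi> = 0 \<or> j = 2" for \<phi> \<psi> i j
    by (auto intro!: pm_mult_0 simp: X'_def b_def)
  have z': "pm Q \<phi> a0 * pm R a1 \<psi> = (0 :: (nat \<times> nat, 'a) fmat)" "pm Q \<phi> a1 * pm R a0 \<psi> = (0 :: (nat \<times> nat, 'a) fmat)" for Q R \<phi> \<psi>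
    by (auto intro!: pm_mult_0)
  note pmm = pm_mult[OF fin'(1)] pm_mult[OF fin'(2)] inj_a hinj z(1,2) z'
  have fb: "f = pm Z b b" unfolding f_def him[symmetric] by (rule idm_eq_pm[OF fin'(1) hinj])
  have facts: "N * s2 = s1" "N * s1 = 0" "p0 * s1 = f" "p0 * s2 = 0" "p0 * e' = 0" "e' * s1 = 0" "e' * s2 = 0"
    "N * e' = e' * N" "N * N = 0" "s1 * p0 + s2 * p0 * N + e' = e"
    unfolding N_eq s1_def s2_def p0_def e'_eq e_eq fb
    by (simp_all add: distrib_left distrib_right pmm)
  have ee: "e * e = e" "e' * e' = e'" "e * e' = e'" "e' * e = e'" "f * f = f"
    using tw fin by (simp_all add: e_def e'_def f_def idm_mult_idm) (auto simp: two_def X'_def intro!: arg_cong[of _ _ idm])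
  have Nc: "N \<in> corner e e" and s1c: "s1 \<in> corner e f" and s2c: "s2 \<in> corner e f" and p0c: "p0 \<in> corner f e"
    unfolding N_def s1_def s2_def p0_def e_def f_def him[symmetric]
    by (rule pm_in_corner; use fin fin' tw Z in \<open>auto simp: two_def\<close>)+
  have e'c: "e' \<in> corner e e" "e' \<in> corner e e'" "e' \<in> corner e' e"
    using ee by (auto simp: corner_def)
  note facts' = facts(1-9) facts(1-9)[THEN mult_assoc_eq] ee ee[THEN mult_assoc_eq]
  \<comment> \<open>On the block of \<open>e'\<close> the large \<open>N\<close> restricts to the
    one for \<open>X'\<close>, so the smaller centraliser can be formed with either.\<close>
  have cent': "cent e' N = Sr X'"
  proof -
    have "D * N = D * pm X' a0 a1 \<and> N * D = pm X' a0 a1 * D" if "D \<in> corner e' e'" for D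
    proof -
      have "e' * pm Z a0 a1 = 0" "pm Z a0 a1 * e' = (0 :: (nat \<times> nat, 'a) fmat)"
        unfolding e'_eq by (simp_all add: distrib_left distrib_right pmm)
      then have "D * e' * pm Z a0 a1 = 0" "pm Z a0 a1 * (e' * D) = 0"
        by (simp add: mult.assoc, simp add: mult.assoc[symmetric])
      then show ?thesis using corner_absorb[OF that] by (simp add: N_eq distrib_left distrib_right)
    qed
    then show ?thesis unfolding Sr_def cent_def e'_def[symmetric] by auto
  qed
  have centS: "cent e N = Sr X" by (simp add: Sr_def e_def N_def)
  have T1: "triangular (cent e N) e f" and F1: "fin_span (tri (cent e N) e f)"
    unfolding centS unfolding e_def f_def
    by (rule triangularI_idm fin_span_tri; rule tw finite_imageI[OF fin(2)] Sr_facts)+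
  have T2: "triangular (cent e' N) e' f" and F2: "fin_span (tri (cent e' N) e' f)"
    unfolding cent' unfolding e'_def f_def
    by (rule triangularI_idm fin_span_tri; rule tw finite_imageI[OF fin(2)] Sr_facts)+
  interpret T1: triangular "cent e N" e f by (rule T1)
  interpret T2: triangular "cent e' N" e' f by (rule T2)
  note idx' = idx[folded X'_def, unfolded ralg_def, folded e'_def f_def cent']
  have "k \<le> fm.dim (st (tri (cent e N) e f) \<gamma>)" for \<gamma>
  proof (rule st_dim_ge_generic[where M = "\<lambda>\<gamma>. s1 * (f * \<gamma> * e) + s2 * (f * \<gamma> * e) * N + e'" and J = "two X" and ?\<gamma>1.0 = p0])
    show "poly_fam (two X) (two X) (\<lambda>t. s1 * (f * line \<gamma>0 p0 t * e) + s2 * (f * line \<gamma>0 p0 t * e) * N + e')" for \<gamma>0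
      using s1c s2c Nc e'c(1) unfolding f_def e_def
      by (intro poly_fam_add poly_fam_mult[OF poly_fam_mult[OF _ poly_fam_line]] poly_fam_mult[OF _ poly_fam_line]
          poly_fam_const tw finite_imageI fin)
    show "inv_in (idm (two X)) (s1 * (f * p0 * e) + s2 * (f * p0 * e) * N + e')"
      using corner_absorb[OF p0c] inv_in_self[OF ee(1)] by (simp add: facts) (simp add: e_def)
  next
    fix \<gamma> assume "inv_in (idm (two X)) (s1 * (f * \<gamma> * e) + s2 * (f * \<gamma> * e) * N + e')"
    then obtain G where G: "G \<in> corner e e" "(s1 * (f * \<gamma> * e) + s2 * (f * \<gamma> * e) * N + e') * G = e"
      "G * (s1 * (f * \<gamma> * e) + s2 * (f * \<gamma> * e) * N + e') = e"
      unfolding e_def[symmetric] by (rule inv_inE)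
    define p where "p = f * \<gamma> * e"
    define H where "H = s1 * p + s2 * p * N + e'"
    note GH = G(2,3)[folded p_def, folded H_def]
    define \<beta> where "\<beta> = f * \<gamma> * f"
    define \<alpha> where "\<alpha> = e * \<gamma> * e"
    have pc: "p \<in> corner f e" unfolding p_def by (intro corner_cut ee)
    have \<alpha>c: "\<alpha> \<in> corner e e" unfolding \<alpha>_def by (intro corner_cut ee)
    have \<beta>c: "\<beta> \<in> corner f f" unfolding \<beta>_def by (intro corner_cut ee)
    have "N * H = H * N" "p0 * H = p" "e' * H = e'"
      using corner_absorb[OF pc] by (simp_all add: H_def distrib_left distrib_right mult.assoc facts')
    have NG: "N * G = G * N"
    proof -
      have "N * G = G * H * N * G" using corner_absorb[OF Nc] by (simp add: GH mult.assoc)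
      also have "\<dots> = G * (H * N) * G" by (simp add: mult.assoc)
      also have "\<dots> = G * N * (H * G)" unfolding \<open>N * H = H * N\<close>[symmetric] by (simp add: mult.assoc)
      also have "\<dots> = G * N" using corner_absorb[OF Nc] by (simp add: GH mult.assoc)
      finally show ?thesis .
    qed
    have pG: "p * G = p0"
      unfolding \<open>p0 * H = p\<close>[symmetric] using corner_absorb[OF p0c] by (simp add: mult.assoc GH)
    have eG: "e' * G = e'"
    proof -
      have "e' * G = (e' * H) * G" by (simp add: \<open>e' * H = e'\<close>)
      then show ?thesis by (simp add: mult.assoc GH ee)
    qed
    define t1 where "t1 = G * s1"
    define t2 where "t2 = G * s2"
    define n where "n = G * e'"
    have t1c: "t1 \<in> corner e f" and t2c: "t2 \<in> corner e f" and nc: "n \<in> corner e e'"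
      unfolding t1_def t2_def n_def by (intro corner_mult[OF G(1)] s1c s2c e'c)+
    have prods: "N * t2 = t1" "p * t1 = f" "p * t2 = 0" "N * n = n * N" "e' * N = N * e'" "p * n = 0"
      "e' * t1 = 0" "e' * t2 = 0" "e' * n = e'" "t1 * p + t2 * p * N + n * e' = e"
    proof -
      show "N * t2 = t1" by (simp add: t1_def t2_def mult.assoc[symmetric] NG) (simp add: mult.assoc facts)
      show "p * t1 = f" "p * t2 = 0" "p * n = 0" "e' * t1 = 0" "e' * t2 = 0" "e' * n = e'"
        by (simp_all add: t1_def t2_def n_def mult.assoc[symmetric] pG eG facts ee)
      show "e' * N = N * e'" by (simp add: facts)
      show "N * n = n * N" by (simp add: n_def mult.assoc[symmetric] NG) (simp add: mult.assoc facts)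
      have "t1 * p + t2 * p * N + n * e' = G * H"
        by (simp add: t1_def t2_def n_def H_def distrib_left mult.assoc ee)
      then show "t1 * p + t2 * p * N + n * e' = e" by (simp add: GH)
    qed
    have c: "e' * \<alpha> * n \<in> corner e' e'" "p * (N * \<alpha> + \<alpha> * N) * n \<in> corner f e'"
      "\<beta> + p * \<alpha> * t1 + p * N * \<alpha> * t2 \<in> corner f f"
      by (intro corner_add \<beta>c corner_mult[OF corner_mult[OF e'c(3) \<alpha>c] nc]
          corner_mult[OF corner_mult[OF pc corner_add[OF corner_mult[OF Nc \<alpha>c] corner_mult[OF \<alpha>c Nc]]] nc]
          corner_mult[OF corner_mult[OF pc \<alpha>c] t1c]
          corner_mult[OF corner_mult[OF corner_mult[OF pc Nc] \<alpha>c] t2c])+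
    have "fm.dim (st (tri (cent e N) e f) \<gamma>) = fm.dim (st (tri (cent e' N) e' f)
        (e' * \<alpha> * n + p * (N * \<alpha> + \<alpha> * N) * n + (\<beta> + p * \<alpha> * t1 + p * N * \<alpha> * t2)))"
      by (rule st_dual_numbers[OF T1 T2 F1 F2 Nc facts(9,8) e'c(1) pc t1c t2c nc e'c(3) prods
            \<alpha>_def[symmetric] p_def[symmetric] \<beta>_def[symmetric] T2.components(4-6)[OF c(1) corner_0 c(2,3)]])
    then show "k \<le> fm.dim (st (tri (cent e N) e f) \<gamma>)" using has_indexD[OF idx'] by simp
  qed (use T1.subspace_tri F1 in auto)
  moreover
  obtain \<gamma>' where \<gamma>': "fm.dim (st (tri (cent e' N) e' f) \<gamma>') \<le> k" using idx' by (auto simp: has_index_def)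
  define \<alpha>' where "\<alpha>' = e' * \<gamma>' * e'"
  define p' where "p' = f * \<gamma>' * e'"
  define \<beta> where "\<beta> = f * \<gamma>' * f"
  have \<alpha>'c: "\<alpha>' \<in> corner e' e'" unfolding \<alpha>'_def by (intro corner_cut ee)
  have p'c: "p' \<in> corner f e'" unfolding p'_def by (intro corner_cut ee)
  have \<beta>c: "\<beta> \<in> corner f f" unfolding \<beta>_def by (intro corner_cut ee)
  \<comment> \<open>The first term realises the prescribed \<open>p'\<close>:
    \<open>p0 * N * s2 = p0 * s1 = f\<close>, while \<open>p0 * s2 = 0\<close> removes its
    contribution to \<open>\<alpha> * N\<close>. The second term restores
    \<open>\<alpha>'\<close>.\<close>
  define \<alpha> where "\<alpha> = s2 * p' * e' + e' * \<alpha>' * e'"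
  have \<alpha>c: "\<alpha> \<in> corner e e"
    unfolding \<alpha>_def by (intro corner_add corner_mult[OF corner_mult[OF s2c p'c] e'c(3)] corner_mult[OF corner_mult[OF e'c(2) \<alpha>'c] e'c(3)])
  note ab = corner_absorb[OF \<alpha>'c] corner_absorb[OF p'c]
  have "p0 * (N * (e' * x)) = 0" for x
    using mult_assoc_eq[OF facts(8)] by (simp add: mult.assoc facts')
  then have p0N: "p0 * (N * \<alpha>') = 0" using ab by metis
  have p0a: "p0 * \<alpha>' = 0" "p0 * (\<alpha>' * x) = 0" for x using ab mult_assoc_eq[OF facts(5)] facts(5) by (metis mult_zero_left mult.assoc)+
  have as: "\<alpha>' * s1 = 0" "\<alpha>' * s2 = 0" "p' * s1 = 0" "p' * s2 = 0"
    using ab facts(6,7) by (metis mult_zero_right mult.assoc)+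
  have comps: "e' * \<alpha> * e' = \<alpha>'" "p0 * (N * \<alpha> + \<alpha> * N) * e' = p'" "\<beta> + p0 * \<alpha> * s1 + p0 * N * \<alpha> * s2 = \<beta>"
    by (simp_all add: \<alpha>_def distrib_left distrib_right mult.assoc facts' ab p0N p0a as)
  have "fm.dim (st (tri (cent e N) e f) (\<alpha> + p0 + \<beta>)) = fm.dim (st (tri (cent e' N) e' f) \<gamma>')"
  proof (rule st_dual_numbers[OF T1 T2 F1 F2 Nc facts(9,8) e'c(1) p0c s1c s2c e'c(2,3) facts(1,3,4,8) facts(8)[symmetric]
        facts(5,6,7) ee(2) _ T1.components(4-6)[OF \<alpha>c corner_0 p0c \<beta>c]])
    show "s1 * p0 + s2 * p0 * N + e' * e' = e" by (simp add: ee facts)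
  qed (simp_all only: comps, simp_all only: \<alpha>'_def p'_def \<beta>_def)
  then have "\<exists>\<gamma>. fm.dim (st (tri (cent e N) e f) \<gamma>) \<le> k" using \<gamma>' by metis
  ultimately show ?thesis unfolding has_index_def ralg_def e_def[symmetric] f_def[symmetric] centS[symmetric] by blast
qed

lemma has_index_ralg:
  assumes "finite X" "finite Y" "X \<noteq> {} \<or> Y \<noteq> {}"
  shows "has_index (ralg X Y :: (nat \<times> nat, 'a :: field_char_0) fmat set) (gcd (2 * card X) (card Y))"
  using assms
proof (induction "card X + card Y" arbitrary: X Y rule: less_induct)
  case less
  note fin = less.prems(1,2)
  \<comment> \<open>The sum of cardinalities drops in the last three cases; in the final one because
    \<open>card X < card Y\<close> gives \<open>2 * card X - card Y < card Y\<close>. Equality in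
    the third case leads to an empty \<open>Y\<close>, equality in the fourth to an empty
    \<open>X\<close>, which are the base cases.\<close>
  consider "X = {}" | "Y = {}" "X \<noteq> {}" | "X \<noteq> {}" "Y \<noteq> {}" "2 * card X \<le> card Y" | "X \<noteq> {}" "Y \<noteq> {}" "card Y \<le> card X"
    | "X \<noteq> {}" "Y \<noteq> {}" "card X < card Y" "card Y < 2 * card X"
    by linarith
  then show ?case
  proof cases
    case 1
    then show ?thesis using has_index_left_empty(1) less.prems by auto
  next
    case 2
    then show ?thesis using has_index_Sr less.prems by auto
  next
    case 3
    obtain Y' where Y': "Y' \<subseteq> Y" "card Y' = card Y - 2 * card X"
      using obtain_subset_with_card_n[of "card Y - 2 * card X" Y] by auto
    have "card X > 0" using 3 fin by (simp add: card_gt_0_iff)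
    then have "has_index (ralg X Y' :: (nat \<times> nat, 'a) fmat set) (gcd (2 * card X) (card Y'))"
      using less.hyps[of X Y'] 3 Y' fin finite_subset[OF Y'(1)] by simp
    then have "has_index (ralg X Y :: (nat \<times> nat, 'a) fmat set) (gcd (2 * card X) (card Y'))"
      unfolding ralg_def using 3 Y' by (intro has_index_remove[OF fin Y'(1) _ Sr_facts]) auto
    moreover have "gcd (2 * card X) (card Y') = gcd (2 * card X) (card Y)"
      using gcd_add2[of "2 * card X" "card Y'"] Y'(2) 3(3) by simp
    ultimately show ?thesis by simp
  next
    case 4
    obtain Z where Z: "Z \<subseteq> X" "card Z = card Y"
      using obtain_subset_with_card_n[of "card Y" X] 4 by auto
    have "card Y > 0" using 4 fin by (simp add: card_gt_0_iff)
    have c: "card (X - Z) = card X - card Y" using Z fin finite_subset[OF Z(1)] by (simp add: card_Diff_subset)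
    have "has_index (ralg (X - Z) Y :: (nat \<times> nat, 'a) fmat set) (gcd (2 * card (X - Z)) (card Y))"
      using less.hyps[of "X - Z" Y] 4 fin c \<open>card Y > 0\<close> by simp
    then have "has_index (ralg X Y :: (nat \<times> nat, 'a) fmat set) (gcd (2 * card (X - Z)) (card Y))"
      by (rule has_index_r_reduce[OF fin Z])
    moreover have "gcd (2 * card (X - Z)) (card Y) = gcd (2 * card X) (card Y)"
    proof -
      have "2 * card X = 2 * card (X - Z) + 2 * card Y" using c 4(3) by simp
      then show ?thesis by (metis gcd.commute gcd_add_mult mult.commute add.commute)
    qed
    ultimately show ?thesis by simp
  next
    case 5
    define Y' where "Y' = {..<2 * card X - card Y}"
    have c: "card Y' = 2 * card X - card Y" "finite Y'" by (simp_all add: Y'_def)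
    have "has_index (ralg X Y' :: (nat \<times> nat, 'a) fmat set) (gcd (2 * card X) (card Y'))"
      using less.hyps[of X Y'] 5 fin c by simp
    then have "has_index (ralg X Y :: (nat \<times> nat, 'a) fmat set) (gcd (2 * card X) (card Y'))"
      unfolding ralg_def using 5 c
      by (intro has_index_complement[OF fin c(2) _ Sr_facts flip_S(1)[OF fin(1)]]) auto
    moreover have "gcd (2 * card X) (card Y') = gcd (2 * card X) (card Y)"
      using gcd_diff1_nat[of "card Y" "2 * card X"] 5 c
      by (metis add_diff_inverse_nat gcd.commute gcd_add1 gcd_add2 less_imp_le_nat linorder_not_less)
    ultimately show ?thesis by simp
  qed
qed

section \<open>Transfer to Lie algebra records\<close>

text \<open>\<open>vectorspace.dim\<close> is the least size of a finite generating set, so it is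
  enough to carry generating sets across the injective linear map in both directions.\<close>

lemma dim_transfer:
  fixes M :: "('k :: field, 'v, 'm) module_scheme" and \<Phi> :: "'v \<Rightarrow> ('i, 'k) fmat"
  assumes vs: "vectorspace class_ring M"
    and add: "\<And>x y. x \<in> carrier M \<Longrightarrow> y \<in> carrier M \<Longrightarrow> \<Phi> (x \<oplus>\<^bsub>M\<^esub> y) = \<Phi> x + \<Phi> y"
    and smult: "\<And>c x. x \<in> carrier M \<Longrightarrow> \<Phi> (c \<odot>\<^bsub>M\<^esub> x) = sc c (\<Phi> x)"
    and inj: "inj_on \<Phi> (carrier M)" and fin: "fin_span (\<Phi> ` carrier M)"
  shows "vectorspace.dim class_ring M = fm.dim (\<Phi> ` carrier M)"
proof -
  interpret V: vectorspace class_ring M by (rule vs)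
  have zero: "\<Phi> \<zero>\<^bsub>M\<^esub> = 0"
    using smult[of "\<zero>\<^bsub>M\<^esub>" 0] V.lmult_0[of "\<zero>\<^bsub>M\<^esub>"] by (simp add: class_ring_simps)
  have lc: "\<Phi> (V.lincomb a A) = (\<Sum>x\<in>A. sc (a x) (\<Phi> x))" if "finite A" "A \<subseteq> carrier M" for a A
    using that
  proof (induction A rule: finite_induct)
    case empty
    then show ?case by (simp add: V.lincomb_def zero)
  next
    case (insert x A)
    have c: "a \<in> A \<rightarrow> carrier class_ring" "a x \<in> carrier class_ring" by (auto simp: class_ring_simps)
    have "V.lincomb a (insert x A) = a x \<odot>\<^bsub>M\<^esub> x \<oplus>\<^bsub>M\<^esub> V.lincomb a A"
      unfolding V.lincomb_def using insert c by (subst V.finsum_insert) (auto simp: class_ring_simps)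
    then show ?case
      using insert c V.lincomb_closed[of A a] by (simp add: add smult V.smult_closed)
  qed
  have span: "\<Phi> ` V.span A = fm.span (\<Phi> ` A)" if A: "finite A" "A \<subseteq> carrier M" for A
  proof -
    have injA: "inj_on \<Phi> A" using inj A(2) by (rule inj_on_subset)
    have "\<Phi> ` V.span A = range (\<lambda>a. \<Sum>x\<in>A. sc (a x) (\<Phi> x))"
    proof -
      have "V.span A = range (\<lambda>a. V.lincomb a A)"
        unfolding V.finite_span[OF A] by (auto simp: class_ring_simps)
      then show ?thesis by (simp add: image_image lc[OF A])
    qed
    also have "\<dots> = range (\<lambda>u. \<Sum>v\<in>\<Phi> ` A. sc (u v) v)"
    proof (intro equalityI subsetI)
      fix z assume "z \<in> range (\<lambda>a. \<Sum>x\<in>A. sc (a x) (\<Phi> x))"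
      then obtain a where "z = (\<Sum>x\<in>A. sc (a x) (\<Phi> x))" by blast
      also have "\<dots> = (\<Sum>v\<in>\<Phi> ` A. sc (a (the_inv_into A \<Phi> v)) v)"
        by (simp add: sum.reindex[OF injA] the_inv_into_f_f[OF injA])
      finally show "z \<in> range (\<lambda>u. \<Sum>v\<in>\<Phi> ` A. sc (u v) v)" by (intro range_eqI)
    qed (auto simp: sum.reindex[OF injA])
    finally show ?thesis using A(1) by (simp add: fm.span_finite)
  qed
  have sub: "V.span A \<subseteq> carrier M" if "A \<subseteq> carrier M" for A
    using that V.span_is_subset2 by blast
  obtain B where B: "finite B" "B \<subseteq> \<Phi> ` carrier M" "\<Phi> ` carrier M \<subseteq> fm.span B" "card B = fm.dim (\<Phi> ` carrier M)"
    using fin_span_basis[OF fin] by metis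
  obtain A where A: "A \<subseteq> carrier M" "B = \<Phi> ` A" using B(2) subset_imageE by metis
  have injA: "inj_on \<Phi> A" using inj A(1) by (rule inj_on_subset)
  have finA: "finite A" using B(1) unfolding A(2) by (rule finite_imageD[OF _ injA])
  have "\<Phi> ` carrier M \<subseteq> \<Phi> ` V.span A" using B(3) span[OF finA A(1)] by (simp add: A(2))
  then have "carrier M \<subseteq> V.span A" using inj_on_image_mem_iff[OF inj _ sub[OF A(1)]] by blast
  then have genA: "V.gen_set A" using sub[OF A(1)] by blast
  show ?thesis
    unfolding V.dim_def
  proof (rule Least_equality)
    show "\<exists>A. finite A \<and> card A = fm.dim (\<Phi> ` carrier M) \<and> A \<subseteq> carrier M \<and> V.gen_set A"
      using finA A(1) genA card_image[OF injA] B(4) by (intro exI[of _ A]) (simp add: A(2))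
    fix n assume "\<exists>A. finite A \<and> card A = n \<and> A \<subseteq> carrier M \<and> V.gen_set A"
    then obtain C where C: "finite C" "card C = n" "C \<subseteq> carrier M" "V.gen_set C" by blast
    then have "\<Phi> ` carrier M \<subseteq> fm.span (\<Phi> ` C)" using span[OF C(1,3)] by simp
    then have "fm.dim (\<Phi> ` carrier M) \<le> card (\<Phi> ` C)" using C(1) by (intro fm.dim_le_card) auto
    also have "\<dots> \<le> n" using C(1,2) card_image_le by blast
    finally show "fm.dim (\<Phi> ` carrier M) \<le> n" .
  qed
qed

text \<open>Under a faithful matrix representation every functional takes the form
  \<open>tr (\<delta> * \<Phi> x)\<close> on the carrier, and its stabiliser is mapped bijectively
  onto \<open>st\<close> of the image at \<open>\<delta>\<close>.\<close>

lemma lie_index_eq: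
  fixes L :: "('k :: field, 'v, 'm) lie_alg_scheme" and \<Phi> :: "'v \<Rightarrow> ('i, 'k) fmat"
  assumes L: "lie_algebra L"
    and add: "\<And>x y. x \<in> carrier L \<Longrightarrow> y \<in> carrier L \<Longrightarrow> \<Phi> (x \<oplus>\<^bsub>L\<^esub> y) = \<Phi> x + \<Phi> y"
    and smult: "\<And>c x. x \<in> carrier L \<Longrightarrow> \<Phi> (c \<odot>\<^bsub>L\<^esub> x) = sc c (\<Phi> x)"
    and inj: "inj_on \<Phi> (carrier L)"
    and br: "\<And>x y. x \<in> carrier L \<Longrightarrow> y \<in> carrier L \<Longrightarrow> \<Phi> (bracket L x y) = \<Phi> x * \<Phi> y - \<Phi> y * \<Phi> x"
    and I: "finite I" "\<Phi> ` carrier L \<subseteq> corner (idm I) (idm I)"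
    and idx: "has_index (\<Phi> ` carrier L) k"
  shows "lie_index L = k"
proof -
  interpret L: lie_algebra L by (rule L)
  let ?A = "\<Phi> ` carrier L"
  have zero: "\<Phi> \<zero>\<^bsub>L\<^esub> = 0"
    using smult[of "\<zero>\<^bsub>L\<^esub>" 0] L.lmult_0[of "\<zero>\<^bsub>L\<^esub>"] by (simp add: class_ring_simps)
  have cl: "x \<oplus>\<^bsub>L\<^esub> y \<in> carrier L" "c \<odot>\<^bsub>L\<^esub> x \<in> carrier L" if "x \<in> carrier L" "y \<in> carrier L" for x y c
    using that L.smult_closed[of c x] by (auto simp: class_ring_simps)
  have subA: "fm.subspace ?A"
  proof (rule fm.subspaceI)
    show "0 \<in> ?A" using zero by (intro image_eqI[of _ _ "\<zero>\<^bsub>L\<^esub>"]) auto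
    show "u + v \<in> ?A" if "u \<in> ?A" "v \<in> ?A" for u v
      using that cl add by (metis (no_types, lifting) imageE imageI)
    show "sc c u \<in> ?A" if "u \<in> ?A" for c u
      using that cl smult by (metis (no_types, lifting) imageE imageI)
  qed
  have finA: "fin_span ?A" using fin_span_corner[OF I(1) I(1)] I(2) by (rule fin_span_subset)
  have dim: "vectorspace.dim class_ring (L\<lparr>carrier := lie_stabiliser L \<gamma>\<rparr>) = fm.dim (st ?A \<delta>)"
    if \<gamma>: "\<And>x. x \<in> carrier L \<Longrightarrow> \<gamma> x = tr (\<delta> * \<Phi> x)" for \<gamma> \<delta>
  proof -
    have subst: "fm.subspace (st ?A \<delta>)" by (rule subspace_st[OF subA])
    have mem: "x \<in> lie_stabiliser L \<gamma> \<longleftrightarrow> x \<in> carrier L \<and> \<Phi> x \<in> st ?A \<delta>" for x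
    proof -
      have "\<gamma> (bracket L x y) = tr (\<delta> * (\<Phi> x * \<Phi> y - \<Phi> y * \<Phi> x))" if "x \<in> carrier L" "y \<in> carrier L" for x y
        using \<gamma>[OF L.bracket_closed[OF that]] br[OF that] by simp
      then show ?thesis by (auto simp: lie_stabiliser_def st_def)
    qed
    have im: "\<Phi> ` lie_stabiliser L \<gamma> = st ?A \<delta>"
    proof (intro equalityI subsetI)
      fix z assume "z \<in> st ?A \<delta>"
      moreover from this obtain x where "x \<in> carrier L" "z = \<Phi> x" by (auto simp: st_def)
      ultimately show "z \<in> \<Phi> ` lie_stabiliser L \<gamma>" by (simp add: mem)
    qed (auto simp: mem)
    have "subspace class_ring (lie_stabiliser L \<gamma>) L"
    proof (intro subspace.intro submodule.intro)
      show "vectorspace class_ring L" by (rule L.vectorspace_axioms)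
      show "Module.module class_ring L" by (rule L.module_axioms)
    qed (auto simp: mem zero add smult cl subst fm.subspace_add fm.subspace_scale fm.subspace_0)
    then have vs: "vectorspace class_ring (L\<lparr>carrier := lie_stabiliser L \<gamma>\<rparr>)"
      by (rule L.subspace_is_vs)
    have "vectorspace.dim class_ring (L\<lparr>carrier := lie_stabiliser L \<gamma>\<rparr>) = fm.dim (\<Phi> ` carrier (L\<lparr>carrier := lie_stabiliser L \<gamma>\<rparr>))"
    proof (rule dim_transfer[OF vs])
      show "inj_on \<Phi> (carrier (L\<lparr>carrier := lie_stabiliser L \<gamma>\<rparr>))"
        using inj by (rule inj_on_subset) (auto simp: lie_stabiliser_def)
      show "fin_span (\<Phi> ` carrier (L\<lparr>carrier := lie_stabiliser L \<gamma>\<rparr>))"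
        using finA by (rule fin_span_subset) (auto simp: lie_stabiliser_def)
    qed (auto simp: mem add smult)
    then show ?thesis by (simp add: im)
  qed
  have ex1: "\<exists>\<delta>. \<forall>x\<in>carrier L. \<gamma> x = tr (\<delta> * \<Phi> x)" if \<gamma>: "\<gamma> \<in> lie_dual L" for \<gamma>
  proof -
    have lin: "\<gamma> (x \<oplus>\<^bsub>L\<^esub> y) = \<gamma> x + \<gamma> y" "\<gamma> (c \<odot>\<^bsub>L\<^esub> x) = c * \<gamma> x" if "x \<in> carrier L" "y \<in> carrier L" for x y c
      using \<gamma> that by (auto simp: lie_dual_def LinearCombinations.module_hom_def field_module_def class_ring_simps)
    \<comment> \<open>\<open>\<gamma>\<close> is transported to the image of \<open>\<Phi>\<close>,
      where it is additive and homogeneous; \<open>tr_functional\<close> extends it from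
      there.\<close>
    define g where "g = \<gamma> \<circ> the_inv_into (carrier L) \<Phi>"
    have g: "g (\<Phi> x) = \<gamma> x" if "x \<in> carrier L" for x
      using that by (simp add: g_def the_inv_into_f_f[OF inj])
    have "\<exists>\<delta>. \<forall>x\<in>?A. g x = tr (\<delta> * x)"
    proof (rule tr_functional[OF subA I(2,1)])
      show "g (u + v) = g u + g v" if uv: "u \<in> ?A" "v \<in> ?A" for u v
      proof -
        obtain x y where "x \<in> carrier L" "y \<in> carrier L" "u = \<Phi> x" "v = \<Phi> y" using uv by blast
        then show ?thesis using g lin cl add by metis
      qed
      show "g (sc c u) = c * g u" if u: "u \<in> ?A" for c u
      proof -
        obtain x where "x \<in> carrier L" "u = \<Phi> x" using u by blast
        then show ?thesis using g lin cl smult by metis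
      qed
    qed
    then show ?thesis using g by auto
  qed
  have ex2: "(\<lambda>x. tr (\<delta> * \<Phi> x)) \<in> lie_dual L" for \<delta>
    by (auto simp: lie_dual_def LinearCombinations.module_hom_def field_module_def class_ring_simps add smult distrib_left)
  have lower: "k \<le> vectorspace.dim class_ring (L\<lparr>carrier := lie_stabiliser L \<gamma>\<rparr>)" if "\<gamma> \<in> lie_dual L" for \<gamma>
    using ex1[OF that] dim has_indexD[OF idx] by metis
  obtain \<delta> where \<delta>: "fm.dim (st ?A \<delta>) \<le> k" using idx by (auto simp: has_index_def)
  then have upper: "vectorspace.dim class_ring (L\<lparr>carrier := lie_stabiliser L (\<lambda>x. tr (\<delta> * \<Phi> x))\<rparr>) \<le> k"
    using dim[of "\<lambda>x. tr (\<delta> * \<Phi> x)" \<delta>] by simp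
  show ?thesis
    unfolding lie_index_def
  proof (rule antisym)
    show "(INF \<gamma>\<in>lie_dual L. vectorspace.dim class_ring (L\<lparr>carrier := lie_stabiliser L \<gamma>\<rparr>)) \<le> k"
      using upper by (rule order_trans[rotated]) (intro cINF_lower ex2, simp)
    show "k \<le> (INF \<gamma>\<in>lie_dual L. vectorspace.dim class_ring (L\<lparr>carrier := lie_stabiliser L \<gamma>\<rparr>))"
      using ex2 lower by (intro cINF_greatest) auto
  qed
qed

section \<open>Block embeddings of the two Lie algebras\<close>

definition emb :: "nat \<Rightarrow> nat \<Rightarrow> 'a :: field mat \<Rightarrow> (nat \<times> nat, 'a) fmat" where
  "emb k l M = Fmat (\<lambda>i j. if snd i = k \<and> snd j = l \<and> fst i < dim_row M \<and> fst j < dim_col M then M $$ (fst i, fst j) else 0)"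

lemma ent_emb:
  "ent (emb k l M) i j = (if snd i = k \<and> snd j = l \<and> fst i < dim_row M \<and> fst j < dim_col M then M $$ (fst i, fst j) else 0)"
  unfolding emb_def
  by (subst ent_Fmat[of "({..<dim_row M} \<times> {k}) \<union> ({..<dim_col M} \<times> {l})"]) (auto split: if_splits)

lemma emb_add: "A \<in> carrier_mat m n \<Longrightarrow> B \<in> carrier_mat m n \<Longrightarrow> emb k l (A + B) = emb k l A + emb k l B"
  by (intro fmat_eqI) (auto simp: ent_emb)

lemma emb_minus: "A \<in> carrier_mat m n \<Longrightarrow> B \<in> carrier_mat m n \<Longrightarrow> emb k l (A - B) = emb k l A - emb k l B"
  by (intro fmat_eqI) (auto simp: ent_emb)

lemma emb_smult: "emb k l (c \<cdot>\<^sub>m A) = sc c (emb k l A)"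
  by (intro fmat_eqI) (auto simp: ent_emb)

lemma emb_mult_0: "l \<noteq> l' \<Longrightarrow> emb k l A * emb l' m B = 0"
  by (intro fmat_eqI, subst ent_mult) (auto simp: ent_emb intro!: sum.neutral)

lemma emb_mult:
  assumes "dim_col A = dim_row B"
  shows "emb k l A * emb l m B = emb k m (A * B)"
proof (rule fmat_eqI)
  fix i j
  have inj: "inj_on (\<lambda>r. (r, l)) {..<dim_col A}" by (auto simp: inj_on_def)
  have "ent (emb k l A * emb l m B) i j = (\<Sum>r\<in>(\<lambda>r. (r, l)) ` {..<dim_col A}. ent (emb k l A) i r * ent (emb l m B) r j)"
    by (intro ent_mult_over) (auto simp: ent_emb split: if_splits)
  also have "\<dots> = (\<Sum>r<dim_col A. ent (emb k l A) i (r, l) * ent (emb l m B) (r, l) j)"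
    by (simp add: sum.reindex[OF inj])
  also have "\<dots> = ent (emb k m (A * B)) i j"
    using assms by (auto simp: ent_emb scalar_prod_def lessThan_atLeast0 intro!: sum.cong sum.neutral)
  finally show "ent (emb k l A * emb l m B) i j = ent (emb k m (A * B)) i j" .
qed

lemma emb_surj:
  assumes "x \<in> corner (idm ({..<m} \<times> {k})) (idm ({..<n} \<times> {l}))"
  obtains A where "A \<in> carrier_mat m n" "emb k l A = x"
proof (rule that)
  show "mat m n (\<lambda>(i, j). ent x (i, k) (j, l)) \<in> carrier_mat m n" by simp
  have *: "ent x i j = 0" if "\<not> (i \<in> {..<m} \<times> {k} \<and> j \<in> {..<n} \<times> {l})" for i j
  proof -
    from assms have "\<forall>i j. ent x i j \<noteq> 0 \<longrightarrow> i \<in> {..<m} \<times> {k} \<and> j \<in> {..<n} \<times> {l}"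
      by (subst (asm) corner_idm_iff) simp_all
    with that show ?thesis by blast
  qed
  show "emb k l (mat m n (\<lambda>(i, j). ent x (i, k) (j, l))) = x"
    by (intro fmat_eqI) (auto simp: ent_emb * mem_Times_iff)
qed

lemma two_lessThan: "two {..<a} = {..<a} \<times> {0} \<union> {..<a} \<times> {Suc 0}"
  by (auto simp: two_def)

lemma a2_lessThan: "a2 ` {..<b} = {..<b} \<times> {2}"
  by auto

lemma emb_one: "emb k k (1\<^sub>m n :: 'a :: field mat) = idm ({..<n} \<times> {k})"
  by (intro fmat_eqI) (auto simp: ent_emb ent_idm)

lemma emb_one_pm: "emb r s (1\<^sub>m n :: 'a :: field mat) = pm {..<n} (\<lambda>k. (k, r)) (\<lambda>k. (k, s))"
proof (rule fmat_eqI)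
  fix i j
  have "ent (pm {..<n} (\<lambda>k. (k, r)) (\<lambda>k. (k, s)) :: (nat \<times> nat, 'a) fmat) i j =
      (\<Sum>k<n. if k = fst i then if snd i = r \<and> j = (fst i, s) then 1 else 0 else 0)"
    unfolding pm_def ent_sum ent_mu by (intro sum.cong refl) (auto simp: prod_eq_iff)
  also have "\<dots> = (if fst i < n \<and> snd i = r \<and> j = (fst i, s) then 1 else 0)"
    by simp
  also have "\<dots> = ent (emb r s (1\<^sub>m n :: 'a mat)) i j"
    by (cases i; cases j) (auto simp: ent_emb)
  finally show "ent (emb r s (1\<^sub>m n :: 'a mat)) i j = ent (pm {..<n} (\<lambda>k. (k, r)) (\<lambda>k. (k, s)) :: (nat \<times> nat, 'a) fmat) i j" ..
qed

lemma e_emb: "idm (two {..<a}) = emb 0 0 (1\<^sub>m a) + emb (Suc 0) (Suc 0) (1\<^sub>m a)"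
  unfolding two_lessThan emb_one by (rule idm_Un) auto

lemma corner_ee_emb:
  assumes "x \<in> corner (idm (two {..<a})) (idm (two {..<a}))"
  obtains A X C D where "A \<in> carrier_mat a a" "X \<in> carrier_mat a a" "C \<in> carrier_mat a a" "D \<in> carrier_mat a a"
    "x = emb 0 0 A + emb 0 (Suc 0) X + emb (Suc 0) 0 C + emb (Suc 0) (Suc 0) D"
proof -
  let ?E = "\<lambda>k. idm ({..<a} \<times> {k}) :: (nat \<times> nat, 'a) fmat"
  have "?E k * ?E k = ?E k" for k by (simp add: idm_mult_idm)
  then have c: "?E k * x * ?E l \<in> corner (?E k) (?E l)" for k l by (intro corner_cut)
  obtain A where A: "A \<in> carrier_mat a a" "emb 0 0 A = ?E 0 * x * ?E 0" using emb_surj[OF c] by metis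
  obtain X where X: "X \<in> carrier_mat a a" "emb 0 (Suc 0) X = ?E 0 * x * ?E (Suc 0)" using emb_surj[OF c] by metis
  obtain C where C: "C \<in> carrier_mat a a" "emb (Suc 0) 0 C = ?E (Suc 0) * x * ?E 0" using emb_surj[OF c] by metis
  obtain D where D: "D \<in> carrier_mat a a" "emb (Suc 0) (Suc 0) D = ?E (Suc 0) * x * ?E (Suc 0)" using emb_surj[OF c] by metis
  have "x = (?E 0 + ?E (Suc 0)) * x * (?E 0 + ?E (Suc 0))"
    using corner_absorb[OF assms] by (simp add: e_emb emb_one)
  then have "x = emb 0 0 A + emb 0 (Suc 0) X + emb (Suc 0) 0 C + emb (Suc 0) (Suc 0) D"
    unfolding A(2) X(2) C(2) D(2) by (simp add: distrib_left distrib_right add_ac)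
  then show ?thesis using that A X C D by blast
qed

lemma corner_ef_emb:
  assumes "x \<in> corner (idm (two {..<a})) (idm (a2 ` {..<b}))"
  obtains u v where "u \<in> carrier_mat a b" "v \<in> carrier_mat a b" "x = emb 0 2 u + emb (Suc 0) 2 v"
proof -
  let ?E = "\<lambda>k. idm ({..<a} \<times> {k}) :: (nat \<times> nat, 'a) fmat"
  let ?F = "idm ({..<b} \<times> {2}) :: (nat \<times> nat, 'a) fmat"
  have "?E k * ?E k = ?E k" "?F * ?F = ?F" for k by (simp_all add: idm_mult_idm)
  then have c: "?E k * x * ?F \<in> corner (?E k) ?F" for k by (intro corner_cut)
  obtain u where u: "u \<in> carrier_mat a b" "emb 0 2 u = ?E 0 * x * ?F" using emb_surj[OF c] by metis
  obtain v where v: "v \<in> carrier_mat a b" "emb (Suc 0) 2 v = ?E (Suc 0) * x * ?F" using emb_surj[OF c] by metis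
  have "x = (?E 0 + ?E (Suc 0)) * x * ?F"
    using corner_absorb[OF assms] by (simp add: e_emb emb_one a2_lessThan)
  then have "x = emb 0 2 u + emb (Suc 0) 2 v"
    unfolding u(2) v(2) by (simp add: distrib_right)
  then show ?thesis using that u v by blast
qed

text \<open>Right multiplication by \<open>pm {..<a} a0 a1\<close> moves block column 0 to column 1,
  left multiplication moves block row 1 to row 0; comparing blocks gives the conditions. The other
  matrix acts with 0 and 1 exchanged.\<close>

lemma cent_emb:
  assumes "A \<in> carrier_mat a a" "X \<in> carrier_mat a a" "C \<in> carrier_mat a a" "D \<in> carrier_mat a a"
    and x: "x = emb 0 0 A + emb 0 (Suc 0) X + emb (Suc 0) 0 C + emb (Suc 0) (Suc 0) D"
  shows "x * pm {..<a} a0 a1 = pm {..<a} a0 a1 * x \<longleftrightarrow> C = 0\<^sub>m a a \<and> D = A"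
    "x * pm {..<a} a1 a0 = pm {..<a} a1 a0 * x \<longleftrightarrow> X = 0\<^sub>m a a \<and> D = A"
proof -
  have one: "M * 1\<^sub>m a = M" "1\<^sub>m a * M = M" if "M \<in> carrier_mat a a" for M :: "'a mat" using that by auto
  have d: "dim_row M = a" "dim_col M = a" if "M \<in> carrier_mat a a" for M :: "'a mat" using that by auto
  have p1: "x * pm {..<a} a0 a1 = emb 0 (Suc 0) A + emb (Suc 0) (Suc 0) C"
    "pm {..<a} a0 a1 * x = emb 0 0 C + emb 0 (Suc 0) D"
    and p2: "x * pm {..<a} a1 a0 = emb 0 0 X + emb (Suc 0) 0 D"
    "pm {..<a} a1 a0 * x = emb (Suc 0) 0 A + emb (Suc 0) (Suc 0) X"
    using assms(1-4) unfolding x emb_one_pm[symmetric]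
    by (simp_all add: distrib_left distrib_right emb_mult emb_mult_0 one d)
  have z: "emb k l (0\<^sub>m a a) = (0 :: (nat \<times> nat, 'a) fmat)" for k l by (intro fmat_eqI) (auto simp: ent_emb)
  show "x * pm {..<a} a0 a1 = pm {..<a} a0 a1 * x \<longleftrightarrow> C = 0\<^sub>m a a \<and> D = A"
  proof
    assume "x * pm {..<a} a0 a1 = pm {..<a} a0 a1 * x"
    then have eq: "ent (emb 0 (Suc 0) A + emb (Suc 0) (Suc 0) C) i j = ent (emb 0 0 C + emb 0 (Suc 0) D) i j" for i j
      unfolding p1 by simp
    show "C = 0\<^sub>m a a \<and> D = A"
    proof (intro conjI eq_matI)
      fix i j
      show "i < dim_row (0\<^sub>m a a :: 'a mat) \<Longrightarrow> j < dim_col (0\<^sub>m a a :: 'a mat) \<Longrightarrow> C $$ (i, j) = 0\<^sub>m a a $$ (i, j)"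
        using eq[of "(i, Suc 0)" "(j, Suc 0)"] by (simp add: ent_emb d assms)
      show "i < dim_row A \<Longrightarrow> j < dim_col A \<Longrightarrow> D $$ (i, j) = A $$ (i, j)"
        using eq[of "(i, 0)" "(j, Suc 0)"] by (simp add: ent_emb d assms)
    qed (simp_all add: d assms)
  qed (simp add: p1 z)
  show "x * pm {..<a} a1 a0 = pm {..<a} a1 a0 * x \<longleftrightarrow> X = 0\<^sub>m a a \<and> D = A"
  proof
    assume "x * pm {..<a} a1 a0 = pm {..<a} a1 a0 * x"
    then have eq: "ent (emb 0 0 X + emb (Suc 0) 0 D) i j = ent (emb (Suc 0) 0 A + emb (Suc 0) (Suc 0) X) i j" for i j
      unfolding p2 by simp
    show "X = 0\<^sub>m a a \<and> D = A"
    proof (intro conjI eq_matI)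
      fix i j
      show "i < dim_row (0\<^sub>m a a :: 'a mat) \<Longrightarrow> j < dim_col (0\<^sub>m a a :: 'a mat) \<Longrightarrow> X $$ (i, j) = 0\<^sub>m a a $$ (i, j)"
        using eq[of "(i, Suc 0)" "(j, Suc 0)"] by (simp add: ent_emb d assms)
      show "i < dim_row A \<Longrightarrow> j < dim_col A \<Longrightarrow> D $$ (i, j) = A $$ (i, j)"
        using eq[of "(i, Suc 0)" "(j, 0)"] by (simp add: ent_emb d assms)
    qed (simp_all add: d assms)
  qed (simp add: p2 z)
qed

lemma emb_corners:
  "A \<in> carrier_mat a a \<Longrightarrow> k < 2 \<Longrightarrow> l < 2 \<Longrightarrow> emb k l A \<in> corner (idm (two {..<a})) (idm (two {..<a}))"
  "u \<in> carrier_mat a b \<Longrightarrow> k < 2 \<Longrightarrow> emb k 2 u \<in> corner (idm (two {..<a})) (idm (a2 ` {..<b}))"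
  "B \<in> carrier_mat b b \<Longrightarrow> emb 2 2 B \<in> corner (idm (a2 ` {..<b})) (idm (a2 ` {..<b}))"
  unfolding two_lessThan a2_lessThan
  by (subst corner_idm_iff; auto simp: ent_emb less_2_cases_iff split: if_splits)+

lemma Sr_emb: "x \<in> Sr {..<a} \<longleftrightarrow>
    (\<exists>A\<in>carrier_mat a a. \<exists>X\<in>carrier_mat a a. x = emb 0 0 A + emb (Suc 0) (Suc 0) A + emb 0 (Suc 0) X)"
proof
  assume x: "x \<in> Sr {..<a}"
  then have "x \<in> corner (idm (two {..<a})) (idm (two {..<a}))" by (simp add: Sr_def cent_def)
  then obtain A X C D where m: "A \<in> carrier_mat a a" "X \<in> carrier_mat a a" "C \<in> carrier_mat a a" "D \<in> carrier_mat a a"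
    "x = emb 0 0 A + emb 0 (Suc 0) X + emb (Suc 0) 0 C + emb (Suc 0) (Suc 0) D"
    by (rule corner_ee_emb)
  have "C = 0\<^sub>m a a" "D = A" using cent_emb(1)[OF m] x by (auto simp: Sr_def cent_def)
  moreover have "emb (Suc 0) 0 (0\<^sub>m a a) = (0 :: (nat \<times> nat, 'a) fmat)" by (intro fmat_eqI) (auto simp: ent_emb)
  ultimately have "x = emb 0 0 A + emb (Suc 0) (Suc 0) A + emb 0 (Suc 0) X" using m(5) by (simp add: add_ac)
  then show "\<exists>A\<in>carrier_mat a a. \<exists>X\<in>carrier_mat a a. x = emb 0 0 A + emb (Suc 0) (Suc 0) A + emb 0 (Suc 0) X"
    using m by blast
next
  assume "\<exists>A\<in>carrier_mat a a. \<exists>X\<in>carrier_mat a a. x = emb 0 0 A + emb (Suc 0) (Suc 0) A + emb 0 (Suc 0) X"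
  then obtain A X where m: "A \<in> carrier_mat a a" "X \<in> carrier_mat a a" "x = emb 0 0 A + emb (Suc 0) (Suc 0) A + emb 0 (Suc 0) X"
    by blast
  have "emb (Suc 0) 0 (0\<^sub>m a a) = (0 :: (nat \<times> nat, 'a) fmat)" by (intro fmat_eqI) (auto simp: ent_emb)
  then have "x = emb 0 0 A + emb 0 (Suc 0) X + emb (Suc 0) 0 (0\<^sub>m a a) + emb (Suc 0) (Suc 0) A"
    using m(3) by (simp add: add_ac)
  from cent_emb(1)[OF m(1,2) _ m(1) this]
  show "x \<in> Sr {..<a}"
    unfolding Sr_def cent_def using m by (auto intro!: corner_add emb_corners)
qed

lemma Sd_emb: "x \<in> Sd {..<a} \<longleftrightarrow> (\<exists>A\<in>carrier_mat a a. x = emb 0 0 A + emb (Suc 0) (Suc 0) A)"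
proof -
  have z: "emb k l (0\<^sub>m a a) = (0 :: (nat \<times> nat, 'a) fmat)" for k l by (intro fmat_eqI) (auto simp: ent_emb)
  have *: "x * pm {..<a} a1 a0 = pm {..<a} a1 a0 * x \<longleftrightarrow> X = 0\<^sub>m a a"
    if "A \<in> carrier_mat a a" "X \<in> carrier_mat a a" "x = emb 0 0 A + emb (Suc 0) (Suc 0) A + emb 0 (Suc 0) X" for A X
    using cent_emb(2)[OF that(1,2) zero_carrier_mat that(1), of x] that(3) by (simp add: z add_ac)
  show ?thesis
  proof
    assume "x \<in> Sd {..<a}"
    then have "x \<in> Sr {..<a}" "x * pm {..<a} a1 a0 = pm {..<a} a1 a0 * x" by (auto simp: Sd_def cent_def)
    then show "\<exists>A\<in>carrier_mat a a. x = emb 0 0 A + emb (Suc 0) (Suc 0) A"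
      unfolding Sr_emb using * z by (metis add.right_neutral)
  next
    assume "\<exists>A\<in>carrier_mat a a. x = emb 0 0 A + emb (Suc 0) (Suc 0) A"
    then obtain A where A: "A \<in> carrier_mat a a" "x = emb 0 0 A + emb (Suc 0) (Suc 0) A + emb 0 (Suc 0) (0\<^sub>m a a)"
      by (auto simp: z)
    have "x \<in> Sr {..<a}" unfolding Sr_emb using A zero_carrier_mat[of a a] by blast
    moreover have "x * pm {..<a} a1 a0 = pm {..<a} a1 a0 * x" using *[OF A(1) _ A(2)] by simp
    ultimately show "x \<in> Sd {..<a}" by (auto simp: Sd_def Sr_def cent_def)
  qed
qed

text \<open>The action of \<open>B\<close> on \<open>K\<^sup>b\<close> becomes right multiplication by \<open>- B\<^sup>T\<close> in the triangular matrix algebra.\<close>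
definition neg_transpose :: "'a :: field mat \<Rightarrow> 'a mat" where
  "neg_transpose B = - B\<^sup>T"

lemma neg_transpose_carrier [simp]: "B \<in> carrier_mat b b \<Longrightarrow> neg_transpose B \<in> carrier_mat b b"
  by (simp add: neg_transpose_def)

lemma neg_transpose_invol [simp]: "neg_transpose (neg_transpose B) = B"
  by (rule eq_matI) (auto simp: neg_transpose_def)

lemma neg_transpose_simps:
  assumes "B \<in> carrier_mat b b" "B' \<in> carrier_mat b b"
  shows "neg_transpose (B + B') = neg_transpose B + neg_transpose B'"
    "neg_transpose (c \<cdot>\<^sub>m B) = c \<cdot>\<^sub>m neg_transpose B"
    "neg_transpose (commutator B B') = commutator (neg_transpose B) (neg_transpose B')"
  using assms
  by (auto intro!: eq_matI simp: neg_transpose_def commutator_def scalar_prod_def sum_negf mult.commute)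

lemma tensor_act_neg_transpose:
  assumes "A \<in> carrier_mat a a" "B \<in> carrier_mat b b" "u \<in> carrier_mat a b"
  shows "tensor_act A B u = A * u - u * neg_transpose B"
  using assms
  by (auto intro!: eq_matI simp: neg_transpose_def tensor_act_def scalar_prod_def sum_negf)

definition emb_q :: "('k :: field mat \<times> 'k mat) \<times> ('k mat \<times> 'k mat) \<Rightarrow> (nat \<times> nat, 'k) fmat" where
  "emb_q = (\<lambda>((A, B), (u, v)). (emb 0 0 A + emb (Suc 0) (Suc 0) A) + (emb 0 2 u + emb (Suc 0) 2 v) + emb 2 2 (neg_transpose B))"

text \<open>\<open>X\<close> sits in block \<open>(0, 1)\<close> and \<open>w\<close> in block
  \<open>(1, 2)\<close>, so that the product \<open>X * w\<close> falls into block
  \<open>(0, 2)\<close>, the place of \<open>v\<close>. This reproduces the bracket of the nilpotent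
  ideal.\<close>

definition emb_r :: "('k :: field mat \<times> 'k mat) \<times> (('k mat \<times> 'k mat) \<times> 'k mat) \<Rightarrow> (nat \<times> nat, 'k) fmat" where
  "emb_r = (\<lambda>((A, B), ((X, w), v)). (emb 0 0 A + emb (Suc 0) (Suc 0) A + emb 0 (Suc 0) X)
     + (emb 0 2 v + emb (Suc 0) 2 w) + emb 2 2 (neg_transpose B))"

lemma q_simps:
  "carrier (q_lie TYPE('k :: field) a b) = (carrier_mat a a \<times> carrier_mat b b) \<times> (carrier_mat a b \<times> carrier_mat a b)"
  "((A, B), (u, v)) \<oplus>\<^bsub>q_lie TYPE('k) a b\<^esub> ((A', B'), (u', v')) = ((A + A', B + B'), (u + u', v + v'))"
  "c \<odot>\<^bsub>q_lie TYPE('k) a b\<^esub> ((A, B), (u, v)) = ((c \<cdot>\<^sub>m A, c \<cdot>\<^sub>m B), (c \<cdot>\<^sub>m u, c \<cdot>\<^sub>m v))"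
  "bracket (q_lie TYPE('k) a b) ((A, B), (u, v)) ((A', B'), (u', v')) =
    ((commutator A A', commutator B B'), (tensor_act A B u' - tensor_act A' B' u, tensor_act A B v' - tensor_act A' B' v))"
  by (simp_all add: q_lie_def lie_simps)

lemma r_simps:
  "carrier (r_lie TYPE('k :: field) a b) =
    (carrier_mat a a \<times> carrier_mat b b) \<times> ((carrier_mat a a \<times> carrier_mat a b) \<times> carrier_mat a b)"
  "((A, B), ((X, w), v)) \<oplus>\<^bsub>r_lie TYPE('k) a b\<^esub> ((A', B'), ((X', w'), v')) = ((A + A', B + B'), ((X + X', w + w'), v + v'))"
  "c \<odot>\<^bsub>r_lie TYPE('k) a b\<^esub> ((A, B), ((X, w), v)) = ((c \<cdot>\<^sub>m A, c \<cdot>\<^sub>m B), ((c \<cdot>\<^sub>m X, c \<cdot>\<^sub>m w), c \<cdot>\<^sub>m v))"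
  "bracket (r_lie TYPE('k) a b) ((A, B), ((X, w), v)) ((A', B'), ((X', w'), v')) =
    ((commutator A A', commutator B B'),
      ((commutator A X' - commutator A' X, tensor_act A B w' - tensor_act A' B' w),
       (tensor_act A B v' - tensor_act A' B' v) + (X * w' - X' * w)))"
  by (simp_all add: r_lie_def lie_simps)

lemma emb_commutator:
  assumes "A \<in> carrier_mat n n" "B \<in> carrier_mat n n"
  shows "emb k l (commutator A B) = emb k l (A * B) - emb k l (B * A)"
  unfolding commutator_def using assms by (intro emb_minus[of _ n n]) auto

lemma emb_tensor_act:
  assumes "A \<in> carrier_mat a a" "B \<in> carrier_mat b b" "u \<in> carrier_mat a b"
  shows "emb k l (tensor_act A B u) = emb k l (A * u) - emb k l (u * neg_transpose B)"
  unfolding tensor_act_neg_transpose[OF assms] using assms by (intro emb_minus[of _ a b]) auto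

lemma emb_r_props:
  fixes x y :: "('k :: field mat \<times> 'k mat) \<times> (('k mat \<times> 'k mat) \<times> 'k mat)"
  assumes x: "x \<in> carrier (r_lie TYPE('k) a b)"
  shows "y \<in> carrier (r_lie TYPE('k) a b) \<Longrightarrow> emb_r (x \<oplus>\<^bsub>r_lie TYPE('k) a b\<^esub> y) = emb_r x + emb_r y"
    "emb_r (c \<odot>\<^bsub>r_lie TYPE('k) a b\<^esub> x) = sc c (emb_r x)"
    "y \<in> carrier (r_lie TYPE('k) a b) \<Longrightarrow> emb_r (bracket (r_lie TYPE('k) a b) x y) = emb_r x * emb_r y - emb_r y * emb_r x"
    "y \<in> carrier (r_lie TYPE('k) a b) \<Longrightarrow> emb_r x = emb_r y \<Longrightarrow> x = y"
proof -
  obtain A B X w v where x': "x = ((A, B), ((X, w), v))" "A \<in> carrier_mat a a" "B \<in> carrier_mat b b" "X \<in> carrier_mat a a"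
      "w \<in> carrier_mat a b" "v \<in> carrier_mat a b"
    using x by (auto simp: r_simps)
  show "emb_r (c \<odot>\<^bsub>r_lie TYPE('k) a b\<^esub> x) = sc c (emb_r x)"
    using x' by (simp add: r_simps emb_r_def emb_smult neg_transpose_simps fm.scale_right_distrib)
  assume y: "y \<in> carrier (r_lie TYPE('k) a b)"
  then obtain A' B' X' w' v' where y': "y = ((A', B'), ((X', w'), v'))" "A' \<in> carrier_mat a a" "B' \<in> carrier_mat b b" "X' \<in> carrier_mat a a"
      "w' \<in> carrier_mat a b" "v' \<in> carrier_mat a b"
    by (auto simp: r_simps)
  note C = x'(2-) y'(2-) neg_transpose_carrier[OF x'(3)] neg_transpose_carrier[OF y'(3)]
  note D = C[THEN carrier_matD(1)] C[THEN carrier_matD(2)]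
  show "emb_r (x \<oplus>\<^bsub>r_lie TYPE('k) a b\<^esub> y) = emb_r x + emb_r y"
    using C by (simp add: x'(1) y'(1) r_simps emb_r_def emb_add[of _ a a] emb_add[of _ a b] emb_add[of _ b b] neg_transpose_simps[of _ b])
  show "emb_r (bracket (r_lie TYPE('k) a b) x y) = emb_r x * emb_r y - emb_r y * emb_r x"
  proof -
    have m: "emb k l (tensor_act A B s' - tensor_act A' B' s) =
        (emb k l (A * s') - emb k l (s' * neg_transpose B)) - (emb k l (A' * s) - emb k l (s * neg_transpose B'))"
      if "s \<in> carrier_mat a b" "s' \<in> carrier_mat a b" for k l s s'
      using C that by (simp add: emb_minus[of _ a b] tensor_act_simps emb_tensor_act)
    have mv: "emb 0 2 (tensor_act A B v' - tensor_act A' B' v + (X * w' - X' * w)) =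
        emb 0 2 (tensor_act A B v' - tensor_act A' B' v) + (emb 0 2 (X * w') - emb 0 2 (X' * w))"
    proof -
      have 1: "X * w' \<in> carrier_mat a b" "X' * w \<in> carrier_mat a b" using C by auto
      have 2: "tensor_act A B v' - tensor_act A' B' v \<in> carrier_mat a b"
        using C by (intro minus_carrier_mat tensor_act_simps_1(1))
      show ?thesis unfolding emb_add[OF 2 minus_carrier_mat[OF 1(2)]] emb_minus[OF 1] ..
    qed
    have mX: "emb 0 (Suc 0) (commutator A X' - commutator A' X) =
        (emb 0 (Suc 0) (A * X') - emb 0 (Suc 0) (X' * A)) - (emb 0 (Suc 0) (A' * X) - emb 0 (Suc 0) (X * A'))"
      using C by (simp add: emb_minus[of _ a a] commutator_simps emb_commutator[of _ a])
    have c: "emb 2 2 (neg_transpose (commutator B B')) = emb 2 2 (neg_transpose B * neg_transpose B') - emb 2 2 (neg_transpose B' * neg_transpose B)"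
      using C by (simp add: neg_transpose_simps[of _ b] emb_commutator[of _ b])
    show ?thesis
      unfolding x'(1) y'(1) r_simps emb_r_def prod.case
      unfolding mv m[OF x'(5) y'(5)] m[OF x'(6) y'(6)] mX c emb_commutator[OF x'(2) y'(2)]
      by (simp add: distrib_left distrib_right emb_mult emb_mult_0 D)
  qed
  assume "emb_r x = emb_r y"
  then have eq: "ent (emb_r x) i j = ent (emb_r y) i j" for i j by simp
  have "A = A'"
  proof (rule eq_matI)
    fix i j assume "i < dim_row (A')" "j < dim_col (A')"
    then show "(A) $$ (i, j) = (A') $$ (i, j)"
      using eq[of "(i, 0)" "(j, 0)"] by (simp add: x'(1) y'(1) emb_r_def ent_emb D)
  qed (simp_all add: D)
  moreover have "X = X'"
  proof (rule eq_matI)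
    fix i j assume "i < dim_row (X')" "j < dim_col (X')"
    then show "(X) $$ (i, j) = (X') $$ (i, j)"
      using eq[of "(i, 0)" "(j, Suc 0)"] by (simp add: x'(1) y'(1) emb_r_def ent_emb D)
  qed (simp_all add: D)
  moreover have "v = v'"
  proof (rule eq_matI)
    fix i j assume "i < dim_row (v')" "j < dim_col (v')"
    then show "(v) $$ (i, j) = (v') $$ (i, j)"
      using eq[of "(i, 0)" "(j, 2)"] by (simp add: x'(1) y'(1) emb_r_def ent_emb D)
  qed (simp_all add: D)
  moreover have "w = w'"
  proof (rule eq_matI)
    fix i j assume "i < dim_row (w')" "j < dim_col (w')"
    then show "(w) $$ (i, j) = (w') $$ (i, j)"
      using eq[of "(i, Suc 0)" "(j, 2)"] by (simp add: x'(1) y'(1) emb_r_def ent_emb D)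
  qed (simp_all add: D)
  moreover have "neg_transpose B = neg_transpose B'"
  proof (rule eq_matI)
    fix i j assume "i < dim_row (neg_transpose B')" "j < dim_col (neg_transpose B')"
    then show "(neg_transpose B) $$ (i, j) = (neg_transpose B') $$ (i, j)"
      using eq[of "(i, 2)" "(j, 2)"] by (simp add: x'(1) y'(1) emb_r_def ent_emb D)
  qed (simp_all add: D)
  then have "B = B'" by (metis neg_transpose_invol)
  ultimately show "x = y" by (simp add: x'(1) y'(1))
qed

lemma emb_r_image: "emb_r ` carrier (r_lie TYPE('k :: field) a b) = ralg {..<a} {..<b}"
proof (intro equalityI subsetI)
  fix z :: "(nat \<times> nat, 'k) fmat"
  assume "z \<in> emb_r ` carrier (r_lie TYPE('k) a b)"
  then obtain A B X w v where "z = emb_r ((A, B), ((X, w), v))" "A \<in> carrier_mat a a" "B \<in> carrier_mat b b" "X \<in> carrier_mat a a"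
      "w \<in> carrier_mat a b" "v \<in> carrier_mat a b"
    by (auto simp: r_simps)
  then show "z \<in> ralg {..<a} {..<b}"
    unfolding ralg_def tri_def emb_r_def prod.case
    by (intro CollectI exI conjI) (auto simp: Sr_emb intro!: corner_add emb_corners)
next
  fix z :: "(nat \<times> nat, 'k) fmat"
  assume "z \<in> ralg {..<a} {..<b}"
  then obtain s w c where z: "z = s + w + c" "s \<in> Sr {..<a}" "w \<in> corner (idm (two {..<a})) (idm (a2 ` {..<b}))"
    "c \<in> corner (idm (a2 ` {..<b})) (idm (a2 ` {..<b}))"
    unfolding ralg_def tri_def by blast
  obtain A X where A: "A \<in> carrier_mat a a" "X \<in> carrier_mat a a" "s = emb 0 0 A + emb (Suc 0) (Suc 0) A + emb 0 (Suc 0) X"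
    using z(2) by (auto simp: Sr_emb)
  obtain u v where uv: "u \<in> carrier_mat a b" "v \<in> carrier_mat a b" "w = emb 0 2 u + emb (Suc 0) 2 v"
    using corner_ef_emb[OF z(3)] by metis
  obtain B where B: "B \<in> carrier_mat b b" "emb 2 2 B = c" using emb_surj[OF z(4)[unfolded a2_lessThan]] by metis
  have "z = emb_r ((A, neg_transpose B), ((X, v), u))" by (simp add: emb_r_def z(1) A uv B)
  then show "z \<in> emb_r ` carrier (r_lie TYPE('k) a b)" using A uv B by (auto simp: r_simps)
qed

text \<open>\<open>q\<close> is the subalgebra \<open>X = 0\<close> of \<open>r\<close>, with the
  first tensor copy in the place of \<open>V\<close> and the second in that of \<open>W\<close>.
  Linearity, injectivity and compatibility with brackets pass from \<open>emb_r\<close> to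
  \<open>emb_q\<close> along this inclusion.\<close>

definition q_in_r :: "('k :: field mat \<times> 'k mat) \<times> ('k mat \<times> 'k mat) \<Rightarrow> ('k mat \<times> 'k mat) \<times> (('k mat \<times> 'k mat) \<times> 'k mat)" where
  "q_in_r = (\<lambda>((A, B), (u, v)). ((A, B), ((0\<^sub>m (dim_row A) (dim_row A), v), u)))"

lemma emb_q_eq: "emb_q x = emb_r (q_in_r x)"
proof -
  have "emb 0 (Suc 0) (0\<^sub>m m m) = (0 :: (nat \<times> nat, 'a) fmat)" for m by (intro fmat_eqI) (auto simp: ent_emb)
  then show ?thesis by (auto simp: emb_q_def emb_r_def q_in_r_def split: prod.split)
qed

lemma q_in_r_props:
  fixes x y :: "('k :: field mat \<times> 'k mat) \<times> ('k mat \<times> 'k mat)"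
  assumes x: "x \<in> carrier (q_lie TYPE('k) a b)"
  shows "q_in_r x \<in> carrier (r_lie TYPE('k) a b)"
    "y \<in> carrier (q_lie TYPE('k) a b) \<Longrightarrow> q_in_r (x \<oplus>\<^bsub>q_lie TYPE('k) a b\<^esub> y) = q_in_r x \<oplus>\<^bsub>r_lie TYPE('k) a b\<^esub> q_in_r y"
    "q_in_r (c \<odot>\<^bsub>q_lie TYPE('k) a b\<^esub> x) = c \<odot>\<^bsub>r_lie TYPE('k) a b\<^esub> q_in_r x"
    "y \<in> carrier (q_lie TYPE('k) a b) \<Longrightarrow>
      q_in_r (bracket (q_lie TYPE('k) a b) x y) = bracket (r_lie TYPE('k) a b) (q_in_r x) (q_in_r y)"
proof -
  obtain A B u v where x': "x = ((A, B), (u, v))" "A \<in> carrier_mat a a" "B \<in> carrier_mat b b" "u \<in> carrier_mat a b" "v \<in> carrier_mat a b"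
    using x by (auto simp: q_simps)
  show "q_in_r x \<in> carrier (r_lie TYPE('k) a b)" "q_in_r (c \<odot>\<^bsub>q_lie TYPE('k) a b\<^esub> x) = c \<odot>\<^bsub>r_lie TYPE('k) a b\<^esub> q_in_r x"
    using x' by (auto simp: q_simps r_simps q_in_r_def)
  assume "y \<in> carrier (q_lie TYPE('k) a b)"
  then obtain A' B' u' v' where y': "y = ((A', B'), (u', v'))" "A' \<in> carrier_mat a a" "B' \<in> carrier_mat b b" "u' \<in> carrier_mat a b" "v' \<in> carrier_mat a b"
    by (auto simp: q_simps)
  show "q_in_r (x \<oplus>\<^bsub>q_lie TYPE('k) a b\<^esub> y) = q_in_r x \<oplus>\<^bsub>r_lie TYPE('k) a b\<^esub> q_in_r y"
    using x' y' by (simp add: q_simps r_simps q_in_r_def)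
  have "commutator A (0\<^sub>m a a) - commutator A' (0\<^sub>m a a) = 0\<^sub>m a a"
    using x' y' by (intro eq_matI) (auto simp: commutator_def)
  moreover have "w + (0\<^sub>m a a * v' - 0\<^sub>m a a * v) = w" if "w \<in> carrier_mat a b" for w
    using x' y' that by (intro eq_matI) auto
  moreover have "tensor_act A B u' - tensor_act A' B' u \<in> carrier_mat a b"
    using x' y' by (intro minus_carrier_mat tensor_act_simps_1(1))
  ultimately show "q_in_r (bracket (q_lie TYPE('k) a b) x y) = bracket (r_lie TYPE('k) a b) (q_in_r x) (q_in_r y)"
    using x' y' by (simp add: q_simps r_simps q_in_r_def)
qed

lemma emb_q_props:
  fixes x y :: "('k :: field mat \<times> 'k mat) \<times> ('k mat \<times> 'k mat)"
  assumes x: "x \<in> carrier (q_lie TYPE('k) a b)"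
  shows "y \<in> carrier (q_lie TYPE('k) a b) \<Longrightarrow> emb_q (x \<oplus>\<^bsub>q_lie TYPE('k) a b\<^esub> y) = emb_q x + emb_q y"
    "emb_q (c \<odot>\<^bsub>q_lie TYPE('k) a b\<^esub> x) = sc c (emb_q x)"
    "y \<in> carrier (q_lie TYPE('k) a b) \<Longrightarrow> emb_q (bracket (q_lie TYPE('k) a b) x y) = emb_q x * emb_q y - emb_q y * emb_q x"
    "y \<in> carrier (q_lie TYPE('k) a b) \<Longrightarrow> emb_q x = emb_q y \<Longrightarrow> x = y"
proof -
  note q = q_in_r_props[OF x] and r = emb_r_props[OF q_in_r_props(1)[OF x]]
  show "emb_q (c \<odot>\<^bsub>q_lie TYPE('k) a b\<^esub> x) = sc c (emb_q x)"
    by (simp only: emb_q_eq q(3) r(2))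
  assume y: "y \<in> carrier (q_lie TYPE('k) a b)"
  note y' = q_in_r_props(1)[OF y]
  show "emb_q (x \<oplus>\<^bsub>q_lie TYPE('k) a b\<^esub> y) = emb_q x + emb_q y"
    by (simp only: emb_q_eq q(2)[OF y] r(1)[OF y'])
  show "emb_q (bracket (q_lie TYPE('k) a b) x y) = emb_q x * emb_q y - emb_q y * emb_q x"
    by (simp only: emb_q_eq q(4)[OF y] r(3)[OF y'])
  assume "emb_q x = emb_q y"
  then have "q_in_r x = q_in_r y" unfolding emb_q_eq by (rule r(4)[OF y'])
  then show "x = y" by (cases x; cases y) (auto simp: q_in_r_def split: prod.splits)
qed

lemma emb_q_image: "emb_q ` carrier (q_lie TYPE('k :: field) a b) = qalg {..<a} {..<b}"
proof (intro equalityI subsetI)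
  fix z :: "(nat \<times> nat, 'k) fmat"
  assume "z \<in> emb_q ` carrier (q_lie TYPE('k) a b)"
  then obtain A B u v where "z = emb_q ((A, B), (u, v))" "A \<in> carrier_mat a a" "B \<in> carrier_mat b b" "u \<in> carrier_mat a b" "v \<in> carrier_mat a b"
    by (auto simp: q_simps)
  then show "z \<in> qalg {..<a} {..<b}"
    unfolding qalg_def tri_def emb_q_def prod.case
    by (intro CollectI exI conjI) (auto simp: Sd_emb intro!: corner_add emb_corners)
next
  fix z :: "(nat \<times> nat, 'k) fmat"
  assume "z \<in> qalg {..<a} {..<b}"
  then obtain s w c where z: "z = s + w + c" "s \<in> Sd {..<a}" "w \<in> corner (idm (two {..<a})) (idm (a2 ` {..<b}))"
    "c \<in> corner (idm (a2 ` {..<b})) (idm (a2 ` {..<b}))"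
    unfolding qalg_def tri_def by blast
  obtain A where A: "A \<in> carrier_mat a a" "s = emb 0 0 A + emb (Suc 0) (Suc 0) A" using z(2) by (auto simp: Sd_emb)
  obtain u v where uv: "u \<in> carrier_mat a b" "v \<in> carrier_mat a b" "w = emb 0 2 u + emb (Suc 0) 2 v"
    using corner_ef_emb[OF z(3)] by metis
  obtain B where B: "B \<in> carrier_mat b b" "emb 2 2 B = c" using emb_surj[OF z(4)[unfolded a2_lessThan]] by metis
  have "z = emb_q ((A, neg_transpose B), (u, v))" by (simp add: emb_q_def z(1) A uv B)
  then show "z \<in> emb_q ` carrier (q_lie TYPE('k) a b)" using A uv B by (auto simp: q_simps)
qed

lemma alg_in_corner:
  "qalg {..<a} {..<b} \<subseteq> corner (idm (two {..<a} \<union> a2 ` {..<b})) (idm (two {..<a} \<union> a2 ` {..<b}))"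
  "ralg {..<a} {..<b} \<subseteq> corner (idm (two {..<a} \<union> a2 ` {..<b})) (idm (two {..<a} \<union> a2 ` {..<b}))"
proof -
  have t: "finite (two {..<a})" "finite (a2 ` {..<b})" "two {..<a} \<inter> a2 ` {..<b} = {}"
    by (auto simp: two_def)
  show "qalg {..<a} {..<b} \<subseteq> corner (idm (two {..<a} \<union> a2 ` {..<b})) (idm (two {..<a} \<union> a2 ` {..<b}))"
    unfolding qalg_def idm_Un[OF t] by (rule triangular.tri_subset[OF triangularI_idm[OF t Sd_facts]])
  show "ralg {..<a} {..<b} \<subseteq> corner (idm (two {..<a} \<union> a2 ` {..<b})) (idm (two {..<a} \<union> a2 ` {..<b}))"
    unfolding ralg_def idm_Un[OF t] by (rule triangular.tri_subset[OF triangularI_idm[OF t Sr_facts]])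
qed

lemma finite_index_set: "finite (two {..<a} \<union> a2 ` {..<b})"
  by (simp add: two_def)

lemma lie_index_q:
  assumes "has_index (qalg {..<a} {..<b} :: (nat \<times> nat, 'k :: field) fmat set) k"
  shows "lie_index (q_lie TYPE('k) a b) = k"
proof (rule lie_index_eq[where \<Phi> = emb_q, OF q_lie_algebra emb_q_props(1,2) _ emb_q_props(3) finite_index_set])
  show "inj_on emb_q (carrier (q_lie TYPE('k) a b))" by (intro inj_onI emb_q_props(4))
qed (use assms alg_in_corner in \<open>simp_all add: emb_q_image\<close>)

lemma lie_index_r:
  assumes "has_index (ralg {..<a} {..<b} :: (nat \<times> nat, 'k :: field) fmat set) k"
  shows "lie_index (r_lie TYPE('k) a b) = k"
proof (rule lie_index_eq[where \<Phi> = emb_r, OF r_lie_algebra emb_r_props(1,2) _ emb_r_props(3) finite_index_set])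
  show "inj_on emb_r (carrier (r_lie TYPE('k) a b))" by (intro inj_onI emb_r_props(4))
qed (use assms alg_in_corner in \<open>simp_all add: emb_r_image\<close>)

text \<open>Transposing matrices exchanges the tensor factors and gives the isomorphism of
  \<open>q(a, b)\<close> with \<open>q(b, a)\<close>. It is set up for the Lie algebras themselves,
  as the two factors have unequal roles in the triangular form.\<close>

definition twist :: "('k :: field mat \<times> 'k mat) \<times> ('k mat \<times> 'k mat) \<Rightarrow> ('k mat \<times> 'k mat) \<times> ('k mat \<times> 'k mat)" where
  "twist = (\<lambda>((A, B), (u, v)). ((B, A), (u\<^sup>T, v\<^sup>T)))"

lemma twist_props:
  fixes x y :: "('k :: field mat \<times> 'k mat) \<times> ('k mat \<times> 'k mat)"
  assumes "x \<in> carrier (q_lie TYPE('k) a b)"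
  shows "twist x \<in> carrier (q_lie TYPE('k) b a)" "twist (twist x) = x"
    "twist (c \<odot>\<^bsub>q_lie TYPE('k) a b\<^esub> x) = c \<odot>\<^bsub>q_lie TYPE('k) b a\<^esub> twist x"
    "y \<in> carrier (q_lie TYPE('k) a b) \<Longrightarrow> twist (x \<oplus>\<^bsub>q_lie TYPE('k) a b\<^esub> y) = twist x \<oplus>\<^bsub>q_lie TYPE('k) b a\<^esub> twist y"
    "y \<in> carrier (q_lie TYPE('k) a b) \<Longrightarrow> twist (bracket (q_lie TYPE('k) a b) x y) = bracket (q_lie TYPE('k) b a) (twist x) (twist y)"
proof -
  have t: "(tensor_act A B u)\<^sup>T = tensor_act B A u\<^sup>T"
    if "A \<in> carrier_mat a a" "B \<in> carrier_mat b b" "u \<in> carrier_mat a b" for A B u :: "'k mat"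
    using that by (auto intro!: eq_matI simp: tensor_act_def scalar_prod_def mult.commute add.commute)
  obtain A B u v where x': "x = ((A, B), (u, v))" "A \<in> carrier_mat a a" "B \<in> carrier_mat b b" "u \<in> carrier_mat a b" "v \<in> carrier_mat a b"
    using assms by (auto simp: q_simps)
  show "twist x \<in> carrier (q_lie TYPE('k) b a)" "twist (twist x) = x"
    "twist (c \<odot>\<^bsub>q_lie TYPE('k) a b\<^esub> x) = c \<odot>\<^bsub>q_lie TYPE('k) b a\<^esub> twist x"
    using x' by (auto simp: q_simps twist_def mat_dim_simps)
  assume "y \<in> carrier (q_lie TYPE('k) a b)"
  then obtain A' B' u' v' where y': "y = ((A', B'), (u', v'))" "A' \<in> carrier_mat a a" "B' \<in> carrier_mat b b" "u' \<in> carrier_mat a b" "v' \<in> carrier_mat a b"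
    by (auto simp: q_simps)
  show "twist (x \<oplus>\<^bsub>q_lie TYPE('k) a b\<^esub> y) = twist x \<oplus>\<^bsub>q_lie TYPE('k) b a\<^esub> twist y"
    using x' y' by (simp add: q_simps twist_def mat_dim_simps)
  show "twist (bracket (q_lie TYPE('k) a b) x y) = bracket (q_lie TYPE('k) b a) (twist x) (twist y)"
    using x' y' by (simp add: q_simps twist_def t[symmetric] mat_dim_simps)
qed

lemma lie_index_q_swap:
  assumes "has_index (qalg {..<b} {..<a} :: (nat \<times> nat, 'k :: field) fmat set) k"
  shows "lie_index (q_lie TYPE('k) a b) = k"
proof (rule lie_index_eq[where \<Phi> = "\<lambda>x. emb_q (twist x)", OF q_lie_algebra _ _ _ _ finite_index_set])
  have "twist ` carrier (q_lie TYPE('k) a b) = carrier (q_lie TYPE('k) b a)"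
  proof (intro equalityI subsetI)
    fix x assume x: "x \<in> carrier (q_lie TYPE('k) b a)"
    show "x \<in> twist ` carrier (q_lie TYPE('k) a b)"
      by (intro image_eqI[where x = "twist x"]) (simp_all add: twist_props(1,2)[OF x])
  qed (auto intro: twist_props)
  then have im: "(\<lambda>x. emb_q (twist x)) ` carrier (q_lie TYPE('k) a b) = qalg {..<b} {..<a}"
    using emb_q_image[of b a, where ?'k = 'k] by (metis image_image)
  show "(\<lambda>x. emb_q (twist x)) ` carrier (q_lie TYPE('k) a b) \<subseteq> corner (idm (two {..<b} \<union> a2 ` {..<a})) (idm (two {..<b} \<union> a2 ` {..<a}))"
    unfolding im by (rule alg_in_corner)
  show "has_index ((\<lambda>x. emb_q (twist x)) ` carrier (q_lie TYPE('k) a b)) k" unfolding im by (rule assms)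
  show "inj_on (\<lambda>x. emb_q (twist x)) (carrier (q_lie TYPE('k) a b))"
    by (intro inj_onI) (metis emb_q_props(4) twist_props(1,2))
qed (simp_all add: twist_props emb_q_props)

lemma has_index_qalg:
  assumes "a \<noteq> 0 \<or> b \<noteq> 0"
  shows "has_index (qalg {..<a} {..<b} :: (nat \<times> nat, 'k :: field_char_0) fmat set) (gcd (2 * a) (a + b))"
  using assms
proof (induction "a + b" arbitrary: a b rule: less_induct)
  case less
  \<comment> \<open>When \<open>0 < c < d\<close>, either removal or complementation lowers the sum,
    the latter because \<open>2 * c - d < d\<close>. The statement is made for any ordered pair with
    the same sum so that it also covers \<open>(b, a)\<close>.\<close>
  have le: "has_index (qalg {..<c} {..<d} :: (nat \<times> nat, 'k) fmat set) (gcd (2 * c) (c + d))"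
    if s: "c + d = a + b" and cd: "c \<le> d" for c d
  proof -
    consider "c = 0" | "c > 0" "c = d" | "c > 0" "2 * c \<le> d" | "c > 0" "c < d" "d < 2 * c" using cd by linarith
    then show ?thesis
    proof cases
      case 1
      then have "d > 0" using s less.prems by simp
      then have "{..<d} \<noteq> {}" by auto
      then show ?thesis using has_index_left_empty(2)[of "{..<d}"] 1 by simp
    next
      case 2
      then have "{..<c} \<noteq> {}" by auto
      from has_index_q_equal[OF _ this, of "{..<d}"] 2 show ?thesis by (simp add: mult_2[symmetric])
    next
      case 3
      have "has_index (qalg {..<c} {..<d - 2 * c} :: (nat \<times> nat, 'k) fmat set) (gcd (2 * c) (c + (d - 2 * c)))"
        using 3 s by (intro less.hyps) auto
      then have "has_index (qalg {..<c} {..<d} :: (nat \<times> nat, 'k) fmat set) (gcd (2 * c) (c + (d - 2 * c)))"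
        unfolding qalg_def using 3 by (elim has_index_remove[rotated -1, OF _ _ _ _ _ Sd_facts]) auto
      moreover have "gcd (2 * c) (c + (d - 2 * c)) = gcd (2 * c) (c + d)"
        using gcd_add2[of "2 * c" "c + (d - 2 * c)"] 3 by simp
      ultimately show ?thesis by simp
    next
      case 4
      have "has_index (qalg {..<c} {..<2 * c - d} :: (nat \<times> nat, 'k) fmat set) (gcd (2 * c) (c + (2 * c - d)))"
        using 4 s by (intro less.hyps) auto
      then have "has_index (qalg {..<c} {..<d} :: (nat \<times> nat, 'k) fmat set) (gcd (2 * c) (c + (2 * c - d)))"
        unfolding qalg_def using 4
        by (elim has_index_complement[rotated -1, OF _ _ _ _ _ Sd_facts flip_S(2)]) auto
      moreover have "gcd (2 * c) (c + (2 * c - d)) = gcd (2 * c) (c + d)"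
      proof (rule gcd_unique_nat[THEN iffD1, rule_format])
        have "c + (2 * c - d) + (c + d) = 2 * (2 * c)" using 4 by simp
        then have "k dvd c + (2 * c - d) \<longleftrightarrow> k dvd c + d" if "k dvd 2 * c" for k
          using that by (metis dvd_add_right_iff dvd_add_left_iff dvd_mult)
        then show "gcd (2 * c) (c + (2 * c - d)) dvd 2 * c \<and> gcd (2 * c) (c + (2 * c - d)) dvd c + d \<and>
          (\<forall>e. e dvd 2 * c \<and> e dvd c + d \<longrightarrow> e dvd gcd (2 * c) (c + (2 * c - d)))"
          by auto
      qed
      ultimately show ?thesis by simp
    qed
  qed
  show ?case
  proof (cases "a \<le> b")
    case True
    then show ?thesis using le by blast
  next
    case False
    then have ba: "has_index (qalg {..<b} {..<a} :: (nat \<times> nat, 'k) fmat set) (gcd (2 * b) (b + a))"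
      using le[of b a] by simp
    \<comment> \<open>The index \<open>m\<close> is unknown at first. Representing
      \<open>q(a, b)\<close> by \<open>emb_q\<close> and by \<open>emb_q\<close> after
      \<open>twist\<close> computes the same \<open>lie_index\<close> twice, so \<open>m\<close>
      equals the value found for \<open>(b, a)\<close>.\<close>
    obtain m where m: "has_index (qalg {..<a} {..<b} :: (nat \<times> nat, 'k) fmat set) m" using has_index_exists by blast
    have "m = gcd (2 * b) (b + a)" using lie_index_q[OF m] lie_index_q_swap[OF ba] by simp
    moreover have "gcd (2 * b) (b + a) = gcd (2 * a) (a + b)"
    proof (rule gcd_unique_nat[THEN iffD1, rule_format])
      have "2 * a + 2 * b = 2 * (a + b)" by simp
      then have "k dvd 2 * a \<longleftrightarrow> k dvd 2 * b" if "k dvd a + b" for k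
        using that by (metis dvd_add_right_iff dvd_add_left_iff dvd_mult)
      then show "gcd (2 * b) (b + a) dvd 2 * a \<and> gcd (2 * b) (b + a) dvd a + b \<and>
          (\<forall>e. e dvd 2 * a \<and> e dvd a + b \<longrightarrow> e dvd gcd (2 * b) (b + a))"
        by (auto simp: add.commute)
    qed
    ultimately show ?thesis using m by simp
  qed
qed

theorem theorem4p1:
  fixes a b :: nat
  assumes "a \<noteq> 0 \<or> b \<noteq> 0"
  shows "lie_index (q_lie TYPE('k :: {alg_closed_field, field_char_0}) a b) = gcd (2 * a) (a + b)
       \<and> lie_index (r_lie TYPE('k) a b) = gcd (2 * a) b"
proof
  show "lie_index (q_lie TYPE('k) a b) = gcd (2 * a) (a + b)"
    by (rule lie_index_q[OF has_index_qalg[OF assms]])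
  have "{..<a} \<noteq> {} \<or> {..<b} \<noteq> {}" using assms by auto
  then show "lie_index (r_lie TYPE('k) a b) = gcd (2 * a) b"
    using lie_index_r[OF has_index_ralg[of "{..<a}" "{..<b}"]] by simp
qed

end
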